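(* The map $A\mapsto \{A\}_\infty$ (the sequential colimit of the iterated one-step truncations of $A$) satisfies all the formation, introduction, elimination and computation rules of the propositional truncation, including the universe level and the judgmental computation rule. That is, for every universe $\mathcal{U}$ and every type $A:\mathcal{U}$: 1. (Formation) $\{A\}_\infty:\mathcal{U}$, i.e. $\{A\}_\infty$ lives in the same universe as $A$. 2. (Point constructor) There is a map $i_0:A\to\{A\}_\infty$. 3. (Path constructor) $\{A\}_\infty$ is a mere proposition: there is an element of $\Pi(x,y:\{A\}_\infty),\ x=y$. 4. (Elimination and computation) For every family of mere propositions $P:\{A\}_\infty\to\mathrm{Prop}$ and every $h:\Pi(a:A),\ P(i_0(a))$ there is a function $k:\Pi(x:\{A\}_\infty),\ P(x)$ such that $k(i_0(a))\equiv h(a)$ holds judgmentally for $a:A$.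
   Context: We work in homotopy type theory (intensional Martin-Löf type theory with universes and the two non-recursive higher inductive types (HITs) described below), assuming function extensionality; the Univalence Axiom is not assumed. $x=y$ denotes the identity (path) type and $\equiv$ denotes judgmental equality. For a function $f$ and a path $p:x=y$, $\mathrm{ap}_f(p):f(x)=f(y)$. The induction principles of the HITs have judgmental computation rules on point constructors. A type $X$ is a mere proposition if $\Pi(x,y:X),\ x=y$; $\mathrm{Prop}:\equiv\Sigma(X:\mathcal{U}),\ \mathrm{isprop}(X)$, and an element of $\mathrm{Prop}$ is identified with its underlying type. One-step truncation: for a type $A$, $\{A\}$ is the HIT (in the same universe as $A$) with constructors $f:A\to\{A\}$ and $e:\Pi(x,y:A),\ f(x)=f(y)$ (the path constructor quantifies only over elements of $A$). Sequential colimit: for $A:\mathbb{N}\to\mathcal{U}$ and $f:\Pi(n:\mathbb{N}),\ A_n\to A_{n+1}$, $\mathrm{colim}(A,f):\mathcal{U}$ is the HIT with constructors $i:\Pi(n:\mathbb{N}),\ A_n\to\mathrm{colim}(A,f)$ and $g:\Pi(n:\mathbb{N}),\Pi(a:A_n),\ i_{n+1}(f_n(a))=i_n(a)$. Definition of $\{A\}_\infty$: put $\{A\}_0:\equiv A$, $\{A\}_{n+1}:\equiv\{\{A\}_n\}$, and let $f_n:\{A\}_n\to\{A\}_{n+1}$ be the point constructor $f$ of the one-step truncation of $\{A\}_n$. Then $\{A\}_\infty:\equiv\mathrm{colim}(\{A\}_{-},f_{-})$, with constructors $i_n:\{A\}_n\to\{A\}_\infty$ and $g_n(a):i_{n+1}(f_n(a))=i_n(a)$.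 *)

theory Defs
  imports Main
begin

text \<open>
  A deep embedding of the type theory: intensional Martin-Loef type theory with a cumulative
  hierarchy of Russell universes, function extensionality, one-step truncation and sequential
  colimits, without univalence. The only variable binders are dependent product and
  lambda-abstraction; every other type former, introduction and elimination is a constant that is
  applied to its arguments. Variables are de Bruijn indices; in a context the head of the list is
  the type of variable 0.
\<close>

section \<open>Syntax\<close>

datatype cnst =
    cSigma | cPair | cIndSigma
  | cSum | cInl | cInr | cIndSum
  | cEmpty | cIndEmpty
  | cUnit | cStar | cIndUnit
  | cNat | cZero | cSucc | cIndNat
  | cId | cRefl | cIndId
  | cFunext
  | cTr | cTrPt | cTrPath | cIndTr | cIndTrPath
  | cColim | cColimIn | cColimGlue | cIndColim | cIndColimGlue

datatype tm =
    V nat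
  | U nat
  | Const cnst
  | Pi tm tm     \<comment> \<open>binds one variable in the second argument\<close>
  | Lam tm tm    \<comment> \<open>annotated with the domain; binds one variable in the second argument\<close>
  | App tm tm  (infixl \<open>\<cdot>\<close> 70)

primrec ren :: "(nat \<Rightarrow> nat) \<Rightarrow> tm \<Rightarrow> tm" where
  "ren r (V n) = V (r n)"
| "ren r (U i) = U i"
| "ren r (Const c) = Const c"
| "ren r (Pi A B) = Pi (ren r A) (ren (case_nat 0 (\<lambda>n. Suc (r n))) B)"
| "ren r (Lam A b) = Lam (ren r A) (ren (case_nat 0 (\<lambda>n. Suc (r n))) b)"
| "ren r (f \<cdot> a) = ren r f \<cdot> ren r a"

text \<open>Weakening of a term by \<open>n\<close> variables.\<close>

definition lift :: "tm \<Rightarrow> nat \<Rightarrow> tm"  (infixl \<open>\<up>\<close> 90) where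
  "t \<up> n = ren (\<lambda>k. k + n) t"

primrec sub :: "(nat \<Rightarrow> tm) \<Rightarrow> tm \<Rightarrow> tm" where
  "sub s (V n) = s n"
| "sub s (U i) = U i"
| "sub s (Const c) = Const c"
| "sub s (Pi A B) = Pi (sub s A) (sub (case_nat (V 0) (\<lambda>n. s n \<up> 1)) B)"
| "sub s (Lam A b) = Lam (sub s A) (sub (case_nat (V 0) (\<lambda>n. s n \<up> 1)) b)"
| "sub s (f \<cdot> a) = sub s f \<cdot> sub s a"

text \<open>\<open>inst b a\<close> replaces variable 0 of \<open>b\<close> by \<open>a\<close> and lowers the other variables.\<close>

definition inst :: "tm \<Rightarrow> tm \<Rightarrow> tm" where
  "inst b a = sub (case_nat a V) b"


section \<open>Derived notions of the type theory\<close>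

definition arr :: "tm \<Rightarrow> tm \<Rightarrow> tm" where
  "arr A B = Pi A (B \<up> 1)"

text \<open>The dependent product of a family given as a function: \<open>\<Pi>(x:A). B x\<close>.\<close>

definition piF :: "tm \<Rightarrow> tm \<Rightarrow> tm" where
  "piF A B = Pi A (B \<up> 1 \<cdot> V 0)"

definition sig :: "tm \<Rightarrow> tm \<Rightarrow> tm" where
  "sig A B = Const cSigma \<cdot> A \<cdot> B"

definition pair :: "tm \<Rightarrow> tm \<Rightarrow> tm \<Rightarrow> tm \<Rightarrow> tm" where
  "pair A B a b = Const cPair \<cdot> A \<cdot> B \<cdot> a \<cdot> b"

definition prodT :: "tm \<Rightarrow> tm \<Rightarrow> tm" where
  "prodT A B = sig A (Lam A (B \<up> 1))"

text \<open>First projection \<open>\<Sigma>(x:A). B x \<rightarrow> A\<close>, applied to \<open>p\<close>.\<close>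

definition proj1 :: "tm \<Rightarrow> tm \<Rightarrow> tm \<Rightarrow> tm" where
  "proj1 A B p = Const cIndSigma \<cdot> A \<cdot> B \<cdot> Lam (sig A B) (A \<up> 1)
     \<cdot> Lam A (Lam (B \<up> 1 \<cdot> V 0) (V 1)) \<cdot> p"

definition sumT :: "tm \<Rightarrow> tm \<Rightarrow> tm" where
  "sumT A B = Const cSum \<cdot> A \<cdot> B"

definition inl :: "tm \<Rightarrow> tm \<Rightarrow> tm \<Rightarrow> tm" where
  "inl A B a = Const cInl \<cdot> A \<cdot> B \<cdot> a"

definition inr :: "tm \<Rightarrow> tm \<Rightarrow> tm \<Rightarrow> tm" where
  "inr A B b = Const cInr \<cdot> A \<cdot> B \<cdot> b"

abbreviation natT :: tm where "natT \<equiv> Const cNat"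
abbreviation zero :: tm where "zero \<equiv> Const cZero"

definition succ :: "tm \<Rightarrow> tm" where
  "succ n = Const cSucc \<cdot> n"

definition idT :: "tm \<Rightarrow> tm \<Rightarrow> tm \<Rightarrow> tm" where
  "idT A a b = Const cId \<cdot> A \<cdot> a \<cdot> b"

definition rfl :: "tm \<Rightarrow> tm \<Rightarrow> tm" where
  "rfl A a = Const cRefl \<cdot> A \<cdot> a"

text \<open>
  Transport \<open>P x \<rightarrow> P y\<close> along \<open>p : x = y\<close>, by path induction with motive
  \<open>\<lambda>x y p. P x \<rightarrow> P y\<close> and the identity function in the reflexive case.
\<close>

definition transp :: "tm \<Rightarrow> tm \<Rightarrow> tm \<Rightarrow> tm \<Rightarrow> tm \<Rightarrow> tm \<Rightarrow> tm" where
  "transp A P x y p u = Const cIndId \<cdot> A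
     \<cdot> Lam A (Lam (A \<up> 1) (Lam (idT (A \<up> 2) (V 1) (V 0)) (arr (P \<up> 3 \<cdot> V 2) (P \<up> 3 \<cdot> V 1))))
     \<cdot> Lam A (Lam (P \<up> 1 \<cdot> V 0) (V 0))
     \<cdot> x \<cdot> y \<cdot> p \<cdot> u"

text \<open>
  The dependent action \<open>transport p (k x) = k y\<close> of \<open>k : \<Pi>(x:A). P x\<close> on \<open>p : x = y\<close>.
\<close>

definition apd :: "tm \<Rightarrow> tm \<Rightarrow> tm \<Rightarrow> tm \<Rightarrow> tm \<Rightarrow> tm \<Rightarrow> tm" where
  "apd A P k x y p = Const cIndId \<cdot> A
     \<cdot> Lam A (Lam (A \<up> 1) (Lam (idT (A \<up> 2) (V 1) (V 0))
         (idT (P \<up> 3 \<cdot> V 1) (transp (A \<up> 3) (P \<up> 3) (V 2) (V 1) (V 0) (k \<up> 3 \<cdot> V 2)) (k \<up> 3 \<cdot> V 1))))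
     \<cdot> Lam A (rfl (P \<up> 1 \<cdot> V 0) (k \<up> 1 \<cdot> V 0))
     \<cdot> x \<cdot> y \<cdot> p"

text \<open>Pointwise equality \<open>\<Pi>(x:A). f x = g x\<close> of \<open>f g : \<Pi>(x:A). B x\<close>.\<close>

definition htpy :: "tm \<Rightarrow> tm \<Rightarrow> tm \<Rightarrow> tm \<Rightarrow> tm" where
  "htpy A B f g = Pi A (idT (B \<up> 1 \<cdot> V 0) (f \<up> 1 \<cdot> V 0) (g \<up> 1 \<cdot> V 0))"

definition happly :: "tm \<Rightarrow> tm \<Rightarrow> tm \<Rightarrow> tm \<Rightarrow> tm \<Rightarrow> tm" where
  "happly A B f g p = Const cIndId \<cdot> piF A B
     \<cdot> Lam (piF A B) (Lam (piF A B \<up> 1) (Lam (idT (piF A B \<up> 2) (V 1) (V 0))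
         (htpy (A \<up> 3) (B \<up> 3) (V 2) (V 1))))
     \<cdot> Lam (piF A B) (Lam (A \<up> 1) (rfl (B \<up> 2 \<cdot> V 0) (V 1 \<cdot> V 0)))
     \<cdot> f \<cdot> g \<cdot> p"

text \<open>\<open>(\<Sigma>(g:B\<rightarrow>A). \<Pi>(y:B). f (g y) = y) \<times> (\<Sigma>(h:B\<rightarrow>A). \<Pi>(x:A). h (f x) = x)\<close>\<close>

definition isequiv :: "tm \<Rightarrow> tm \<Rightarrow> tm \<Rightarrow> tm" where
  "isequiv A B f = prodT
     (sig (arr B A) (Lam (arr B A) (Pi (B \<up> 1) (idT (B \<up> 2) (f \<up> 2 \<cdot> (V 1 \<cdot> V 0)) (V 0)))))
     (sig (arr B A) (Lam (arr B A) (Pi (A \<up> 1) (idT (A \<up> 2) (V 1 \<cdot> (f \<up> 2 \<cdot> V 0)) (V 0)))))"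

definition isprop :: "tm \<Rightarrow> tm" where
  "isprop A = Pi A (Pi (A \<up> 1) (idT (A \<up> 2) (V 1) (V 0)))"

text \<open>\<open>Prop = \<Sigma>(X:U i). isprop X\<close>, and the underlying type of an element of it.\<close>

definition propT :: "nat \<Rightarrow> tm" where
  "propT i = sig (U i) (Lam (U i) (isprop (V 0)))"

definition El :: "nat \<Rightarrow> tm \<Rightarrow> tm" where
  "El i Q = proj1 (U i) (Lam (U i) (isprop (V 0))) Q"

text \<open>One-step truncation: the type, its point constructor and its path constructor.\<close>

definition tr :: "tm \<Rightarrow> tm" where
  "tr A = Const cTr \<cdot> A"

definition trpt :: "tm \<Rightarrow> tm \<Rightarrow> tm" where
  "trpt A a = Const cTrPt \<cdot> A \<cdot> a"

definition trpath :: "tm \<Rightarrow> tm \<Rightarrow> tm \<Rightarrow> tm" where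
  "trpath A a b = Const cTrPath \<cdot> A \<cdot> a \<cdot> b"

text \<open>Sequential colimit: the type, its point constructor and its path constructor.\<close>

definition seqmaps :: "tm \<Rightarrow> tm" where
  "seqmaps A = Pi natT (arr (A \<up> 1 \<cdot> V 0) (A \<up> 1 \<cdot> succ (V 0)))"

definition colim :: "tm \<Rightarrow> tm \<Rightarrow> tm" where
  "colim A f = Const cColim \<cdot> A \<cdot> f"

definition cin :: "tm \<Rightarrow> tm \<Rightarrow> tm \<Rightarrow> tm \<Rightarrow> tm" where
  "cin A f n a = Const cColimIn \<cdot> A \<cdot> f \<cdot> n \<cdot> a"

definition glue :: "tm \<Rightarrow> tm \<Rightarrow> tm \<Rightarrow> tm \<Rightarrow> tm" where
  "glue A f n a = Const cColimGlue \<cdot> A \<cdot> f \<cdot> n \<cdot> a"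


section \<open>Types of the cases of the induction principles\<close>

text \<open>\<open>\<Pi>(a:A). \<Pi>(b:B a). C (a, b)\<close>\<close>

definition case_sig :: "tm \<Rightarrow> tm \<Rightarrow> tm \<Rightarrow> tm" where
  "case_sig A B C = Pi A (Pi (B \<up> 1 \<cdot> V 0) (C \<up> 2 \<cdot> pair (A \<up> 2) (B \<up> 2) (V 1) (V 0)))"

definition case_inl :: "tm \<Rightarrow> tm \<Rightarrow> tm \<Rightarrow> tm" where
  "case_inl A B C = Pi A (C \<up> 1 \<cdot> inl (A \<up> 1) (B \<up> 1) (V 0))"

definition case_inr :: "tm \<Rightarrow> tm \<Rightarrow> tm \<Rightarrow> tm" where
  "case_inr A B C = Pi B (C \<up> 1 \<cdot> inr (A \<up> 1) (B \<up> 1) (V 0))"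

definition case_succ :: "tm \<Rightarrow> tm" where
  "case_succ C = Pi natT (arr (C \<up> 1 \<cdot> V 0) (C \<up> 1 \<cdot> succ (V 0)))"

text \<open>\<open>\<Pi>(x y:A). x = y \<rightarrow> U j\<close> and \<open>\<Pi>(x:A). C x x refl\<close>\<close>

definition motive_id :: "nat \<Rightarrow> tm \<Rightarrow> tm" where
  "motive_id j A = Pi A (Pi (A \<up> 1) (arr (idT (A \<up> 2) (V 1) (V 0)) (U j)))"

definition case_refl :: "tm \<Rightarrow> tm \<Rightarrow> tm" where
  "case_refl A C = Pi A (C \<up> 1 \<cdot> V 0 \<cdot> V 0 \<cdot> rfl (A \<up> 1) (V 0))"

text \<open>
  \<open>\<Pi>(a:A). P (f a)\<close> and
  \<open>\<Pi>(x y:A). transport (e x y) (h x) = h y\<close>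
\<close>

definition case_trpt :: "tm \<Rightarrow> tm \<Rightarrow> tm" where
  "case_trpt A P = Pi A (P \<up> 1 \<cdot> trpt (A \<up> 1) (V 0))"

definition case_trpath :: "tm \<Rightarrow> tm \<Rightarrow> tm \<Rightarrow> tm" where
  "case_trpath A P h = Pi A (Pi (A \<up> 1)
     (idT (P \<up> 2 \<cdot> trpt (A \<up> 2) (V 0))
        (transp (tr (A \<up> 2)) (P \<up> 2) (trpt (A \<up> 2) (V 1)) (trpt (A \<up> 2) (V 0))
           (trpath (A \<up> 2) (V 1) (V 0)) (h \<up> 2 \<cdot> V 1))
        (h \<up> 2 \<cdot> V 0)))"

text \<open>
  \<open>\<Pi>(n:N). \<Pi>(a:A n). P (i n a)\<close> and
  \<open>\<Pi>(n:N). \<Pi>(a:A n). transport (g n a) (h (n+1) (f n a)) = h n a\<close>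
\<close>

definition case_cin :: "tm \<Rightarrow> tm \<Rightarrow> tm \<Rightarrow> tm" where
  "case_cin A f P = Pi natT (Pi (A \<up> 1 \<cdot> V 0) (P \<up> 2 \<cdot> cin (A \<up> 2) (f \<up> 2) (V 1) (V 0)))"

definition case_glue :: "tm \<Rightarrow> tm \<Rightarrow> tm \<Rightarrow> tm \<Rightarrow> tm" where
  "case_glue A f P h = Pi natT (Pi (A \<up> 1 \<cdot> V 0)
     (idT (P \<up> 2 \<cdot> cin (A \<up> 2) (f \<up> 2) (V 1) (V 0))
        (transp (colim (A \<up> 2) (f \<up> 2)) (P \<up> 2)
           (cin (A \<up> 2) (f \<up> 2) (succ (V 1)) (f \<up> 2 \<cdot> V 1 \<cdot> V 0))
           (cin (A \<up> 2) (f \<up> 2) (V 1) (V 0))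
           (glue (A \<up> 2) (f \<up> 2) (V 1) (V 0))
           (h \<up> 2 \<cdot> succ (V 1) \<cdot> (f \<up> 2 \<cdot> V 1 \<cdot> V 0)))
        (h \<up> 2 \<cdot> V 1 \<cdot> V 0)))"


section \<open>Types of the constants\<close>

text \<open>
  The constants are typically ambiguous, as are the type formers of the HoTT Book: a constant has
  the type below at all levels, where \<open>i\<close> is the universe of the type parameters and \<open>j\<close> that of
  the motive of an induction principle.
\<close>

primrec ctype :: "nat \<Rightarrow> nat \<Rightarrow> cnst \<Rightarrow> tm" where
  \<comment> \<open>\<open>\<Pi>(A:U i). (A \<rightarrow> U i) \<rightarrow> U i\<close>\<close>
  "ctype i j cSigma = Pi (U i) (arr (arr (V 0) (U i)) (U i))"
  \<comment> \<open>\<open>\<Pi>A B (a:A). B a \<rightarrow> sig A B\<close>\<close>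
| "ctype i j cPair = Pi (U i) (Pi (arr (V 0) (U i)) (Pi (V 1) (arr (V 1 \<cdot> V 0) (sig (V 2) (V 1)))))"
  \<comment> \<open>\<open>\<Pi>A B (C : sig A B \<rightarrow> U j) (g : \<Pi>a b. C (a, b)) p. C p\<close>\<close>
| "ctype i j cIndSigma = Pi (U i) (Pi (arr (V 0) (U i)) (Pi (arr (sig (V 1) (V 0)) (U j))
     (arr (case_sig (V 2) (V 1) (V 0)) (piF (sig (V 2) (V 1)) (V 0)))))"
| "ctype i j cSum = arr (U i) (arr (U i) (U i))"
| "ctype i j cInl = Pi (U i) (Pi (U i) (arr (V 1) (sumT (V 1) (V 0))))"
| "ctype i j cInr = Pi (U i) (Pi (U i) (arr (V 0) (sumT (V 1) (V 0))))"
| "ctype i j cIndSum = Pi (U i) (Pi (U i) (Pi (arr (sumT (V 1) (V 0)) (U j))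
     (arr (case_inl (V 2) (V 1) (V 0)) (arr (case_inr (V 2) (V 1) (V 0))
        (piF (sumT (V 2) (V 1)) (V 0))))))"
| "ctype i j cEmpty = U i"
| "ctype i j cIndEmpty = Pi (arr (Const cEmpty) (U j)) (piF (Const cEmpty) (V 0))"
| "ctype i j cUnit = U i"
| "ctype i j cStar = Const cUnit"
| "ctype i j cIndUnit = Pi (arr (Const cUnit) (U j))
     (arr (V 0 \<cdot> Const cStar) (piF (Const cUnit) (V 0)))"
| "ctype i j cNat = U i"
| "ctype i j cZero = natT"
| "ctype i j cSucc = arr natT natT"
  \<comment> \<open>\<open>\<Pi>(C : N \<rightarrow> U j). C 0 \<rightarrow> (\<Pi>n. C n \<rightarrow> C (n+1)) \<rightarrow> \<Pi>n. C n\<close>\<close>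
| "ctype i j cIndNat = Pi (arr natT (U j))
     (arr (V 0 \<cdot> zero) (arr (case_succ (V 0)) (piF natT (V 0))))"
| "ctype i j cId = Pi (U i) (arr (V 0) (arr (V 0) (U i)))"
| "ctype i j cRefl = Pi (U i) (Pi (V 0) (idT (V 1) (V 0) (V 0)))"
  \<comment> \<open>\<open>\<Pi>A C (c : \<Pi>x. C x x refl) x y (p : x = y). C x y p\<close>\<close>
| "ctype i j cIndId = Pi (U i) (Pi (motive_id j (V 0)) (arr (case_refl (V 1) (V 0))
     (Pi (V 1) (Pi (V 2) (Pi (idT (V 3) (V 1) (V 0)) (V 3 \<cdot> V 2 \<cdot> V 1 \<cdot> V 0))))))"
  \<comment> \<open>\<open>\<Pi>A B f g. isequiv (happly : f = g \<rightarrow> \<Pi>x. f x = g x)\<close>\<close>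
| "ctype i j cFunext = Pi (U i) (Pi (arr (V 0) (U i)) (Pi (piF (V 1) (V 0)) (Pi (piF (V 2) (V 1))
     (isequiv (idT (piF (V 3) (V 2)) (V 1) (V 0)) (htpy (V 3) (V 2) (V 1) (V 0))
        (Lam (idT (piF (V 3) (V 2)) (V 1) (V 0)) (happly (V 4) (V 3) (V 2) (V 1) (V 0)))))))"
| "ctype i j cTr = arr (U i) (U i)"
| "ctype i j cTrPt = Pi (U i) (arr (V 0) (tr (V 0)))"
  \<comment> \<open>\<open>\<Pi>A (x y:A). f x = f y\<close>\<close>
| "ctype i j cTrPath = Pi (U i) (Pi (V 0) (Pi (V 1)
     (idT (tr (V 2)) (trpt (V 2) (V 1)) (trpt (V 2) (V 0)))))"
  \<comment> \<open>\<open>\<Pi>A (P : tr A \<rightarrow> U j) h (q : case_trpath A P h) z. P z\<close>\<close>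
| "ctype i j cIndTr = Pi (U i) (Pi (arr (tr (V 0)) (U j)) (Pi (case_trpt (V 1) (V 0))
     (arr (case_trpath (V 2) (V 1) (V 0)) (piF (tr (V 2)) (V 1)))))"
  \<comment> \<open>\<open>\<Pi>A P h q x y. apd (ind A P h q) (e x y) = q x y\<close>\<close>
| "ctype i j cIndTrPath = Pi (U i) (Pi (arr (tr (V 0)) (U j)) (Pi (case_trpt (V 1) (V 0))
     (Pi (case_trpath (V 2) (V 1) (V 0)) (Pi (V 3) (Pi (V 4)
       (idT (idT (V 4 \<cdot> trpt (V 5) (V 0))
               (transp (tr (V 5)) (V 4) (trpt (V 5) (V 1)) (trpt (V 5) (V 0))
                  (trpath (V 5) (V 1) (V 0)) (V 3 \<cdot> V 1))
               (V 3 \<cdot> V 0))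
          (apd (tr (V 5)) (V 4) (Const cIndTr \<cdot> V 5 \<cdot> V 4 \<cdot> V 3 \<cdot> V 2)
             (trpt (V 5) (V 1)) (trpt (V 5) (V 0)) (trpath (V 5) (V 1) (V 0)))
          (V 2 \<cdot> V 1 \<cdot> V 0)))))))"
| "ctype i j cColim = Pi (arr natT (U i)) (arr (seqmaps (V 0)) (U i))"
| "ctype i j cColimIn = Pi (arr natT (U i)) (Pi (seqmaps (V 0)) (Pi natT
     (arr (V 2 \<cdot> V 0) (colim (V 2) (V 1)))))"
  \<comment> \<open>\<open>\<Pi>A f n (a : A n). i (n+1) (f n a) = i n a\<close>\<close>
| "ctype i j cColimGlue = Pi (arr natT (U i)) (Pi (seqmaps (V 0)) (Pi natT (Pi (V 2 \<cdot> V 0)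
     (idT (colim (V 3) (V 2)) (cin (V 3) (V 2) (succ (V 1)) (V 2 \<cdot> V 1 \<cdot> V 0))
        (cin (V 3) (V 2) (V 1) (V 0))))))"
  \<comment> \<open>\<open>\<Pi>A f (P : colim A f \<rightarrow> U j) h (q : case_glue A f P h) x. P x\<close>\<close>
| "ctype i j cIndColim = Pi (arr natT (U i)) (Pi (seqmaps (V 0)) (Pi (arr (colim (V 1) (V 0)) (U j))
     (Pi (case_cin (V 2) (V 1) (V 0)) (arr (case_glue (V 3) (V 2) (V 1) (V 0))
        (piF (colim (V 3) (V 2)) (V 1))))))"
  \<comment> \<open>\<open>\<Pi>A f P h q n a. apd (ind A f P h q) (g n a) = q n a\<close>\<close>
| "ctype i j cIndColimGlue = Pi (arr natT (U i)) (Pi (seqmaps (V 0))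
     (Pi (arr (colim (V 1) (V 0)) (U j))
     (Pi (case_cin (V 2) (V 1) (V 0)) (Pi (case_glue (V 3) (V 2) (V 1) (V 0))
     (Pi natT (Pi (V 5 \<cdot> V 0)
       (idT (idT (V 4 \<cdot> cin (V 6) (V 5) (V 1) (V 0))
               (transp (colim (V 6) (V 5)) (V 4)
                  (cin (V 6) (V 5) (succ (V 1)) (V 5 \<cdot> V 1 \<cdot> V 0)) (cin (V 6) (V 5) (V 1) (V 0))
                  (glue (V 6) (V 5) (V 1) (V 0)) (V 3 \<cdot> succ (V 1) \<cdot> (V 5 \<cdot> V 1 \<cdot> V 0)))
               (V 3 \<cdot> V 1 \<cdot> V 0))
          (apd (colim (V 6) (V 5)) (V 4) (Const cIndColim \<cdot> V 6 \<cdot> V 5 \<cdot> V 4 \<cdot> V 3 \<cdot> V 2)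
             (cin (V 6) (V 5) (succ (V 1)) (V 5 \<cdot> V 1 \<cdot> V 0)) (cin (V 6) (V 5) (V 1) (V 0))
             (glue (V 6) (V 5) (V 1) (V 0)))
          (V 2 \<cdot> V 1 \<cdot> V 0))))))))"


section \<open>Judgements\<close>

text \<open>
  Well-formed contexts, typing, and judgmental equality. A type is a term of some universe.
  Weakening and substitution are not primitive; as usual they are admissible. The computation
  rules on path constructors are the constants \<open>cIndTrPath\<close> and \<open>cIndColimGlue\<close> and so hold only
  up to the identity type; all other computation rules are judgmental.
\<close>

inductive
      wf :: "tm list \<Rightarrow> bool"
  and typed :: "tm list \<Rightarrow> tm \<Rightarrow> tm \<Rightarrow> bool"  (\<open>_ \<turnstile> _ \<Ztypecolon> _\<close> [50, 51, 51] 50)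
  and jeq :: "tm list \<Rightarrow> tm \<Rightarrow> tm \<Rightarrow> tm \<Rightarrow> bool"  (\<open>_ \<turnstile> _ \<doteq> _ \<Ztypecolon> _\<close> [50, 51, 51, 51] 50)
where
  wf_Nil: "wf []"
| wf_Cons: "\<Gamma> \<turnstile> A \<Ztypecolon> U i \<Longrightarrow> wf (A # \<Gamma>)"

| ty_V: "wf \<Gamma> \<Longrightarrow> n < length \<Gamma> \<Longrightarrow> \<Gamma> \<turnstile> V n \<Ztypecolon> (\<Gamma> ! n) \<up> Suc n"
| ty_U: "wf \<Gamma> \<Longrightarrow> \<Gamma> \<turnstile> U i \<Ztypecolon> U (Suc i)"
| ty_cumul: "\<Gamma> \<turnstile> A \<Ztypecolon> U i \<Longrightarrow> \<Gamma> \<turnstile> A \<Ztypecolon> U (Suc i)"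
| ty_Const: "wf \<Gamma> \<Longrightarrow> \<Gamma> \<turnstile> Const c \<Ztypecolon> ctype i j c"
| ty_Pi: "\<Gamma> \<turnstile> A \<Ztypecolon> U i \<Longrightarrow> A # \<Gamma> \<turnstile> B \<Ztypecolon> U i \<Longrightarrow> \<Gamma> \<turnstile> Pi A B \<Ztypecolon> U i"
| ty_Lam: "A # \<Gamma> \<turnstile> b \<Ztypecolon> B \<Longrightarrow> \<Gamma> \<turnstile> Lam A b \<Ztypecolon> Pi A B"
| ty_App: "\<Gamma> \<turnstile> f \<Ztypecolon> Pi A B \<Longrightarrow> \<Gamma> \<turnstile> a \<Ztypecolon> A \<Longrightarrow> \<Gamma> \<turnstile> f \<cdot> a \<Ztypecolon> inst B a"
| ty_conv: "\<Gamma> \<turnstile> a \<Ztypecolon> A \<Longrightarrow> \<Gamma> \<turnstile> A \<doteq> B \<Ztypecolon> U i \<Longrightarrow> \<Gamma> \<turnstile> a \<Ztypecolon> B"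

| eq_refl: "\<Gamma> \<turnstile> a \<Ztypecolon> A \<Longrightarrow> \<Gamma> \<turnstile> a \<doteq> a \<Ztypecolon> A"
| eq_sym: "\<Gamma> \<turnstile> a \<doteq> b \<Ztypecolon> A \<Longrightarrow> \<Gamma> \<turnstile> b \<doteq> a \<Ztypecolon> A"
| eq_trans: "\<Gamma> \<turnstile> a \<doteq> b \<Ztypecolon> A \<Longrightarrow> \<Gamma> \<turnstile> b \<doteq> c \<Ztypecolon> A \<Longrightarrow> \<Gamma> \<turnstile> a \<doteq> c \<Ztypecolon> A"
| eq_conv: "\<Gamma> \<turnstile> a \<doteq> b \<Ztypecolon> A \<Longrightarrow> \<Gamma> \<turnstile> A \<doteq> B \<Ztypecolon> U i \<Longrightarrow> \<Gamma> \<turnstile> a \<doteq> b \<Ztypecolon> B"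
| eq_cumul: "\<Gamma> \<turnstile> A \<doteq> B \<Ztypecolon> U i \<Longrightarrow> \<Gamma> \<turnstile> A \<doteq> B \<Ztypecolon> U (Suc i)"
| eq_Pi: "\<Gamma> \<turnstile> A \<doteq> A' \<Ztypecolon> U i \<Longrightarrow> A # \<Gamma> \<turnstile> B \<doteq> B' \<Ztypecolon> U i \<Longrightarrow> \<Gamma> \<turnstile> Pi A B \<doteq> Pi A' B' \<Ztypecolon> U i"
| eq_Lam: "\<Gamma> \<turnstile> A \<doteq> A' \<Ztypecolon> U i \<Longrightarrow> A # \<Gamma> \<turnstile> b \<doteq> b' \<Ztypecolon> B \<Longrightarrow> \<Gamma> \<turnstile> Lam A b \<doteq> Lam A' b' \<Ztypecolon> Pi A B"
| eq_App: "\<Gamma> \<turnstile> f \<doteq> f' \<Ztypecolon> Pi A B \<Longrightarrow> \<Gamma> \<turnstile> a \<doteq> a' \<Ztypecolon> A \<Longrightarrow> \<Gamma> \<turnstile> f \<cdot> a \<doteq> f' \<cdot> a' \<Ztypecolon> inst B a"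

| beta: "A # \<Gamma> \<turnstile> b \<Ztypecolon> B \<Longrightarrow> \<Gamma> \<turnstile> a \<Ztypecolon> A \<Longrightarrow> \<Gamma> \<turnstile> Lam A b \<cdot> a \<doteq> inst b a \<Ztypecolon> inst B a"
| eta: "\<Gamma> \<turnstile> f \<Ztypecolon> Pi A B \<Longrightarrow> \<Gamma> \<turnstile> f \<doteq> Lam A (f \<up> 1 \<cdot> V 0) \<Ztypecolon> Pi A B"

| comp_Sigma: "\<Gamma> \<turnstile> A \<Ztypecolon> U i \<Longrightarrow> \<Gamma> \<turnstile> B \<Ztypecolon> arr A (U i) \<Longrightarrow> \<Gamma> \<turnstile> C \<Ztypecolon> arr (sig A B) (U j) \<Longrightarrow>
    \<Gamma> \<turnstile> g \<Ztypecolon> case_sig A B C \<Longrightarrow> \<Gamma> \<turnstile> a \<Ztypecolon> A \<Longrightarrow> \<Gamma> \<turnstile> b \<Ztypecolon> B \<cdot> a \<Longrightarrow>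
    \<Gamma> \<turnstile> Const cIndSigma \<cdot> A \<cdot> B \<cdot> C \<cdot> g \<cdot> pair A B a b \<doteq> g \<cdot> a \<cdot> b \<Ztypecolon> C \<cdot> pair A B a b"
| comp_Inl: "\<Gamma> \<turnstile> A \<Ztypecolon> U i \<Longrightarrow> \<Gamma> \<turnstile> B \<Ztypecolon> U i \<Longrightarrow> \<Gamma> \<turnstile> C \<Ztypecolon> arr (sumT A B) (U j) \<Longrightarrow>
    \<Gamma> \<turnstile> l \<Ztypecolon> case_inl A B C \<Longrightarrow> \<Gamma> \<turnstile> r \<Ztypecolon> case_inr A B C \<Longrightarrow> \<Gamma> \<turnstile> a \<Ztypecolon> A \<Longrightarrow>
    \<Gamma> \<turnstile> Const cIndSum \<cdot> A \<cdot> B \<cdot> C \<cdot> l \<cdot> r \<cdot> inl A B a \<doteq> l \<cdot> a \<Ztypecolon> C \<cdot> inl A B a"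
| comp_Inr: "\<Gamma> \<turnstile> A \<Ztypecolon> U i \<Longrightarrow> \<Gamma> \<turnstile> B \<Ztypecolon> U i \<Longrightarrow> \<Gamma> \<turnstile> C \<Ztypecolon> arr (sumT A B) (U j) \<Longrightarrow>
    \<Gamma> \<turnstile> l \<Ztypecolon> case_inl A B C \<Longrightarrow> \<Gamma> \<turnstile> r \<Ztypecolon> case_inr A B C \<Longrightarrow> \<Gamma> \<turnstile> b \<Ztypecolon> B \<Longrightarrow>
    \<Gamma> \<turnstile> Const cIndSum \<cdot> A \<cdot> B \<cdot> C \<cdot> l \<cdot> r \<cdot> inr A B b \<doteq> r \<cdot> b \<Ztypecolon> C \<cdot> inr A B b"
| comp_Unit: "\<Gamma> \<turnstile> C \<Ztypecolon> arr (Const cUnit) (U j) \<Longrightarrow> \<Gamma> \<turnstile> c \<Ztypecolon> C \<cdot> Const cStar \<Longrightarrow>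
    \<Gamma> \<turnstile> Const cIndUnit \<cdot> C \<cdot> c \<cdot> Const cStar \<doteq> c \<Ztypecolon> C \<cdot> Const cStar"
| comp_Zero: "\<Gamma> \<turnstile> C \<Ztypecolon> arr natT (U j) \<Longrightarrow> \<Gamma> \<turnstile> c \<Ztypecolon> C \<cdot> zero \<Longrightarrow> \<Gamma> \<turnstile> s \<Ztypecolon> case_succ C \<Longrightarrow>
    \<Gamma> \<turnstile> Const cIndNat \<cdot> C \<cdot> c \<cdot> s \<cdot> zero \<doteq> c \<Ztypecolon> C \<cdot> zero"
| comp_Succ: "\<Gamma> \<turnstile> C \<Ztypecolon> arr natT (U j) \<Longrightarrow> \<Gamma> \<turnstile> c \<Ztypecolon> C \<cdot> zero \<Longrightarrow> \<Gamma> \<turnstile> s \<Ztypecolon> case_succ C \<Longrightarrow>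
    \<Gamma> \<turnstile> n \<Ztypecolon> natT \<Longrightarrow>
    \<Gamma> \<turnstile> Const cIndNat \<cdot> C \<cdot> c \<cdot> s \<cdot> succ n \<doteq> s \<cdot> n \<cdot> (Const cIndNat \<cdot> C \<cdot> c \<cdot> s \<cdot> n) \<Ztypecolon> C \<cdot> succ n"
| comp_Refl: "\<Gamma> \<turnstile> A \<Ztypecolon> U i \<Longrightarrow> \<Gamma> \<turnstile> C \<Ztypecolon> motive_id j A \<Longrightarrow> \<Gamma> \<turnstile> c \<Ztypecolon> case_refl A C \<Longrightarrow> \<Gamma> \<turnstile> a \<Ztypecolon> A \<Longrightarrow>
    \<Gamma> \<turnstile> Const cIndId \<cdot> A \<cdot> C \<cdot> c \<cdot> a \<cdot> a \<cdot> rfl A a \<doteq> c \<cdot> a \<Ztypecolon> C \<cdot> a \<cdot> a \<cdot> rfl A a"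
| comp_TrPt: "\<Gamma> \<turnstile> A \<Ztypecolon> U i \<Longrightarrow> \<Gamma> \<turnstile> P \<Ztypecolon> arr (tr A) (U j) \<Longrightarrow> \<Gamma> \<turnstile> h \<Ztypecolon> case_trpt A P \<Longrightarrow>
    \<Gamma> \<turnstile> q \<Ztypecolon> case_trpath A P h \<Longrightarrow> \<Gamma> \<turnstile> a \<Ztypecolon> A \<Longrightarrow>
    \<Gamma> \<turnstile> Const cIndTr \<cdot> A \<cdot> P \<cdot> h \<cdot> q \<cdot> trpt A a \<doteq> h \<cdot> a \<Ztypecolon> P \<cdot> trpt A a"
| comp_ColimIn: "\<Gamma> \<turnstile> A \<Ztypecolon> arr natT (U i) \<Longrightarrow> \<Gamma> \<turnstile> f \<Ztypecolon> seqmaps A \<Longrightarrow>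
    \<Gamma> \<turnstile> P \<Ztypecolon> arr (colim A f) (U j) \<Longrightarrow> \<Gamma> \<turnstile> h \<Ztypecolon> case_cin A f P \<Longrightarrow> \<Gamma> \<turnstile> q \<Ztypecolon> case_glue A f P h \<Longrightarrow>
    \<Gamma> \<turnstile> n \<Ztypecolon> natT \<Longrightarrow> \<Gamma> \<turnstile> a \<Ztypecolon> A \<cdot> n \<Longrightarrow>
    \<Gamma> \<turnstile> Const cIndColim \<cdot> A \<cdot> f \<cdot> P \<cdot> h \<cdot> q \<cdot> cin A f n a \<doteq> h \<cdot> n \<cdot> a \<Ztypecolon> P \<cdot> cin A f n a"


section \<open>The colimit of the iterated one-step truncations\<close>

text \<open>
  For \<open>A : U i\<close>, the family \<open>n \<mapsto> {A}\<^sub>n : N \<rightarrow> U i\<close> is defined inside the theory by recursion on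
  \<open>n\<close> with values in \<open>U i\<close>. The level is an argument because it occurs in the motive.
\<close>

definition iter_tr :: "nat \<Rightarrow> tm \<Rightarrow> tm" where
  "iter_tr i A = Lam natT (Const cIndNat \<cdot> Lam natT (U i) \<cdot> A \<up> 1
     \<cdot> Lam natT (Lam (U i) (tr (V 0))) \<cdot> V 0)"

definition iter_map :: "nat \<Rightarrow> tm \<Rightarrow> tm" where
  "iter_map i A = Lam natT (Lam (iter_tr i A \<up> 1 \<cdot> V 0) (trpt (iter_tr i A \<up> 2 \<cdot> V 1) (V 0)))"

definition tr_inf :: "nat \<Rightarrow> tm \<Rightarrow> tm" where
  "tr_inf i A = colim (iter_tr i A) (iter_map i A)"

definition i0 :: "nat \<Rightarrow> tm \<Rightarrow> tm" where
  "i0 i A = Const cColimIn \<cdot> iter_tr i A \<cdot> iter_map i A \<cdot> zero"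

end

theory Submission
  imports Defs
begin

text \<open>
  Write \<open>F n\<close> for \<open>{A}\<^sub>n\<close>, \<open>f\<close> for the point constructors \<open>F n \<rightarrow> F (n+1)\<close>, \<open>e\<close> for the path
  constructors \<open>f a = f b\<close>, and \<open>X\<close> for the colimit, with points \<open>i n a\<close> and paths
  \<open>g n a : i (n+1) (f a) = i n a\<close>. Formation and the point constructor are read off from the types
  of the colimit; the content is in the other two rules.

  Elimination (\<open>tr_inf_elim\<close>). To map \<open>X\<close> into a family \<open>Q\<close> of propositions, components
  \<open>H n : \<Pi>(a : F n). Q (i n a)\<close> are enough, since coherence along \<open>g\<close> is an equation in a
  proposition. They are defined by recursion on \<open>n\<close>: \<open>H 0\<close> is the given function, and \<open>H (n+1)\<close>
  is an induction on \<open>F (n+1) = {F n}\<close> whose value at \<open>f a\<close> is \<open>H n a\<close> transported backwards along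
  \<open>g n a\<close> and whose path case is again free. Recursion at zero and induction on points compute
  judgmentally, so the resulting function extends the given one judgmentally.

  Being a proposition (\<open>tr_inf_isprop\<close>). Apply elimination to the family \<open>x \<mapsto> \<Pi>(y : X). x = y\<close>.
  It consists of propositions: an element of it makes \<open>X\<close> contractible, hence a set
  (\<open>contr_set\<close>), and a product of propositions is a proposition by function extensionality
  (\<open>isprop_contraction\<close>). So it remains to contract \<open>X\<close> to \<open>c = i 0 a\<close> for a given \<open>a : A\<close>. This
  uses only that the maps \<open>f\<close> are weakly constant (\<open>colim_contractible\<close>).

  Let \<open>a\<^sub>n\<close> be the \<open>n\<close>-fold image of \<open>a\<close> and \<open>d\<^sub>n : c = i n a\<^sub>n\<close> the evident path. A contraction needs
  paths \<open>p n b : c = i n b\<close> that are compatible with \<open>g\<close>. First normalise \<open>e\<close>: the path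
  \<open>e' a b = e a a\<inverse> \<cdot> e a b\<close> still joins \<open>f a\<close> to \<open>f b\<close>, and \<open>e' a a\<close> is reflexivity. Then
  \<open>move\<close> takes \<open>d : c = i n a\<close> back along \<open>g n a\<close>, across \<open>e' a b\<close> and forward along \<open>g n b\<close>, giving
  a path \<open>c = i n b\<close>; put \<open>p n b = move a\<^sub>n b d\<^sub>n\<close>. By the normalisation \<open>move a a d = d\<close>, so by path
  induction \<open>move u v d\<close> is the transport of \<open>d\<close> along \<^emph>\<open>any\<close> \<open>q : u = v\<close> (\<open>move_natural\<close>). For
  \<open>q = e' a\<^sub>n b\<close> in \<open>F (n+1)\<close> this says that \<open>p (n+1) (f b)\<close> carried along \<open>g n b\<close> is \<open>p n b\<close>
  (\<open>move_step\<close>), which is the compatibility.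

  All of this happens inside the embedded theory. Weakening and substitution are proved admissible
  first. After that, statements that only assert the existence of a term are phrased with \<open>inh\<close>, so
  that proof terms are built only where later equations compute with them.
\<close>

section \<open>Renaming and substitution of terms\<close>

text \<open>
  The primitive recursions on terms carry their lifted renamings and substitutions as explicit case
  expressions. With names for these and for shifts and single substitutions, pushing a renaming or a
  substitution through a concrete term is a terminating rewriting process, which the simplifier
  carries out from here on.
\<close>

definition upr :: "(nat \<Rightarrow> nat) \<Rightarrow> nat \<Rightarrow> nat" where
  "upr r = case_nat 0 (\<lambda>n. Suc (r n))"

definition up :: "(nat \<Rightarrow> tm) \<Rightarrow> nat \<Rightarrow> tm" where
  "up s = case_nat (V 0) (\<lambda>n. s n \<up> 1)"

definition shift :: "nat \<Rightarrow> nat \<Rightarrow> nat" where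
  "shift n = (\<lambda>k. k + n)"

definition single :: "tm \<Rightarrow> nat \<Rightarrow> tm" where
  "single a = case_nat a V"

lemma upr_simps [simp]:
  "upr r 0 = 0" "upr r (Suc n) = Suc (r n)" "upr r 1 = Suc (r 0)"
  "upr r (numeral k) = Suc (r (pred_numeral k))"
  by (simp_all add: upr_def numeral_eq_Suc)

lemma up_simps [simp]:
  "up s 0 = V 0" "up s (Suc n) = s n \<up> 1" "up s 1 = s 0 \<up> 1"
  "up s (numeral k) = s (pred_numeral k) \<up> 1"
  by (simp_all add: up_def numeral_eq_Suc)

lemma single_simps [simp]:
  "single a 0 = a" "single a (Suc n) = V n" "single a 1 = V 0"
  "single a (numeral k) = V (pred_numeral k)"
  by (simp_all add: single_def numeral_eq_Suc)

lemma shift_apply [simp]: "shift n k = k + n"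
  by (simp add: shift_def)

lemma ren_Pi_Lam [simp]:
  "ren r (Pi A B) = Pi (ren r A) (ren (upr r) B)"
  "ren r (Lam A B) = Lam (ren r A) (ren (upr r) B)"
  by (simp_all add: upr_def)

lemma sub_Pi_Lam [simp]:
  "sub s (Pi A B) = Pi (sub s A) (sub (up s) B)"
  "sub s (Lam A B) = Lam (sub s A) (sub (up s) B)"
  by (simp_all add: up_def)

declare ren.simps(4,5) [simp del] sub.simps(4,5) [simp del]

text \<open>
  Shifts are kept in the form \<open>\<up>\<close>, so that iterated weakenings of the same term meet in one normal form.
\<close>

lemma ren_shift [simp]: "ren (shift n) t = t \<up> n"
  by (simp add: lift_def shift_def)

lemma lift_simps [simp]:
  "V k \<up> n = V (k + n)" "U i \<up> n = U i" "Const c \<up> n = Const c"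
  "Pi A B \<up> n = Pi (A \<up> n) (ren (upr (shift n)) B)"
  "Lam A B \<up> n = Lam (A \<up> n) (ren (upr (shift n)) B)"
  "(f \<cdot> a) \<up> n = f \<up> n \<cdot> a \<up> n"
  by (simp_all flip: ren_shift)

lemma inst_single: "inst b a = sub (single a) b"
  by (simp add: inst_def single_def)

lemma upr_comp: "upr r \<circ> upr q = upr (r \<circ> q)"
  by (rule ext, rename_tac n, case_tac n; simp)

lemma ren_ren: "ren r (ren q t) = ren (r \<circ> q) t"
  by (induction t arbitrary: r q) (simp_all add: upr_comp)

lemma upr_id: "upr (\<lambda>n. n) = (\<lambda>n. n)"
  by (rule ext, rename_tac n, case_tac n; simp)

lemma ren_id: "ren (\<lambda>n. n) t = t"
  by (induction t) (simp_all add: upr_id)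

lemma lift_0 [simp]: "t \<up> 0 = t"
  by (simp add: lift_def ren_id)

lemma lift_lift [simp]: "t \<up> m \<up> n = t \<up> (m + n)"
  by (simp add: lift_def ren_ren comp_def add.assoc)

lemma ren_upr_lift [simp]:
  "ren (upr r) (t \<up> Suc n) = ren r (t \<up> n) \<up> 1"
  by (simp add: lift_def ren_ren comp_def)

lemma ren_upr_lift_numeral [simp]:
  "ren (upr r) (t \<up> numeral k) = ren r (t \<up> pred_numeral k) \<up> 1"
  using ren_upr_lift[of r t "pred_numeral k"]
  by (simp add: numeral_eq_Suc)

lemma up_upr: "up s \<circ> upr r = up (s \<circ> r)"
  by (rule ext, rename_tac n, case_tac n; simp)

lemma sub_ren: "sub s (ren r t) = sub (s \<circ> r) t"
  by (induction t arbitrary: s r) (simp_all add: up_upr)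

lemma ren_up: "ren (upr r) \<circ> up s = up (ren r \<circ> s)"
  by (rule ext, rename_tac n, case_tac n; simp)

lemma ren_sub: "ren r (sub s t) = sub (ren r \<circ> s) t"
  by (induction t arbitrary: s r) (simp_all add: ren_up)

lemma sub_up_lift [simp]:
  "sub (up s) (t \<up> Suc n) = sub s (t \<up> n) \<up> 1"
  by (simp add: lift_def sub_ren ren_sub comp_def)

lemma sub_up_lift_numeral [simp]:
  "sub (up s) (t \<up> numeral k) = sub s (t \<up> pred_numeral k) \<up> 1"
  using sub_up_lift[of s t "pred_numeral k"]
  by (simp add: numeral_eq_Suc)

lemma sub_up_up: "sub (up s) \<circ> up t = up (sub s \<circ> t)"
  by (rule ext, rename_tac n, case_tac n; simp)

lemma sub_sub: "sub s (sub t u) = sub (sub s \<circ> t) u"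
  by (induction u arbitrary: s t) (simp_all add: sub_up_up)

lemma up_V: "up V = V"
  by (rule ext, rename_tac n, case_tac n; simp)

lemma sub_V: "sub V t = t"
  by (induction t) (simp_all add: up_V)

text \<open>
  A renaming is a substitution of variables, so commutation with renaming is an instance of
  commutation with substitution.
\<close>

lemma ren_eq_sub: "ren r t = sub (V \<circ> r) t"
  using sub_ren[of V r t] by (simp add: sub_V)

lemma sub_single_lift [simp]:
  "sub (single a) (t \<up> Suc n) = t \<up> n"
proof -
  have "sub (single a) (t \<up> Suc n) = sub (\<lambda>k. V (k + n)) t"
    by (simp add: lift_def sub_ren comp_def)
  also have "\<dots> = sub V (t \<up> n)"
    by (simp add: lift_def sub_ren comp_def)
  finally show ?thesis by (simp add: sub_V)
qed

lemma sub_single_lift_numeral [simp]: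
  "sub (single a) (t \<up> numeral k) = t \<up> pred_numeral k"
  using sub_single_lift[of a t "pred_numeral k"]
  by (simp add: numeral_eq_Suc)

lemma sub_single: "sub s (sub (single a) t) = sub (single (sub s a)) (sub (up s) t)"
proof -
  have "sub s \<circ> single a = sub (single (sub s a)) \<circ> up s"
    by (rule ext, rename_tac n, case_tac n; simp)
  then show ?thesis by (simp add: sub_sub)
qed

lemma sub_inst: "sub s (inst t a) = inst (sub (up s) t) (sub s a)"
  by (simp add: inst_single sub_single)

text \<open>
  The rules above recurse on \<open>Suc\<close>, whereas the definitions write indices and shifts as numerals; the
  unary form is the common normal form.
\<close>

lemma numeral_norm [simp]:
  "V 2 = V (Suc (Suc 0))" "t \<up> 2 = t \<up> (Suc (Suc 0))"
  "V 3 = V (Suc (Suc (Suc 0)))" "t \<up> 3 = t \<up> (Suc (Suc (Suc 0)))"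
  "V 4 = V (Suc (Suc (Suc (Suc 0))))" "t \<up> 4 = t \<up> (Suc (Suc (Suc (Suc 0))))"
  "V 5 = V (Suc (Suc (Suc (Suc (Suc 0)))))" "t \<up> 5 = t \<up> (Suc (Suc (Suc (Suc (Suc 0)))))"
  "V 6 = V (Suc (Suc (Suc (Suc (Suc (Suc 0))))))" "t \<up> 6 = t \<up> (Suc (Suc (Suc (Suc (Suc (Suc 0))))))"
  "V 7 = V (Suc (Suc (Suc (Suc (Suc (Suc (Suc 0)))))))" "t \<up> 7 = t \<up> (Suc (Suc (Suc (Suc (Suc (Suc (Suc 0)))))))"
  by (simp_all add: eval_nat_numeral)

lemmas former_defs = arr_def piF_def sig_def pair_def prodT_def proj1_def sumT_def inl_def inr_def
  succ_def idT_def rfl_def transp_def apd_def htpy_def happly_def isequiv_def isprop_def propT_def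
  El_def tr_def trpt_def trpath_def seqmaps_def colim_def cin_def glue_def

lemmas case_defs = case_sig_def case_inl_def case_inr_def case_succ_def motive_id_def case_refl_def
  case_trpt_def case_trpath_def case_cin_def case_glue_def

lemma sub_defs [simp]:
  "sub s (arr A B) = arr (sub s A) (sub s B)"
  "sub s (piF A B) = piF (sub s A) (sub s B)"
  "sub s (sig A B) = sig (sub s A) (sub s B)"
  "sub s (pair A B a b) = pair (sub s A) (sub s B) (sub s a) (sub s b)"
  "sub s (prodT A B) = prodT (sub s A) (sub s B)"
  "sub s (proj1 A B a) = proj1 (sub s A) (sub s B) (sub s a)"
  "sub s (sumT A B) = sumT (sub s A) (sub s B)"
  "sub s (inl A B a) = inl (sub s A) (sub s B) (sub s a)"
  "sub s (inr A B a) = inr (sub s A) (sub s B) (sub s a)"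
  "sub s (succ n) = succ (sub s n)"
  "sub s (idT A a b) = idT (sub s A) (sub s a) (sub s b)"
  "sub s (rfl A a) = rfl (sub s A) (sub s a)"
  "sub s (transp A P x y p u) = transp (sub s A) (sub s P) (sub s x) (sub s y) (sub s p) (sub s u)"
  "sub s (htpy A B f g) = htpy (sub s A) (sub s B) (sub s f) (sub s g)"
  "sub s (isequiv A B f) = isequiv (sub s A) (sub s B) (sub s f)"
  "sub s (isprop A) = isprop (sub s A)"
  "sub s (propT i) = propT i"
  "sub s (El i Q) = El i (sub s Q)"
  "sub s (tr A) = tr (sub s A)"
  "sub s (trpt A a) = trpt (sub s A) (sub s a)"
  "sub s (trpath A a b) = trpath (sub s A) (sub s a) (sub s b)"
  "sub s (seqmaps A) = seqmaps (sub s A)"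
  "sub s (colim A f) = colim (sub s A) (sub s f)"
  "sub s (cin A f n a) = cin (sub s A) (sub s f) (sub s n) (sub s a)"
  "sub s (glue A f n a) = glue (sub s A) (sub s f) (sub s n) (sub s a)"
  by (simp_all add: former_defs)

lemmas ren_defs [simp] = sub_defs[of "V \<circ> r" for r, folded ren_eq_sub]

lemma sub_defs2 [simp]:
  "sub r (apd A P k x y p) = apd (sub r A) (sub r P) (sub r k) (sub r x) (sub r y) (sub r p)"
  "sub r (happly A B f g p) = happly (sub r A) (sub r B) (sub r f) (sub r g) (sub r p)"
  by (simp_all add: apd_def happly_def)

lemmas ren_defs2 [simp] = sub_defs2[of "V \<circ> r" for r, folded ren_eq_sub]

lemma sub_cases [simp]:
  "sub r (case_sig A B C) = case_sig (sub r A) (sub r B) (sub r C)"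
  "sub r (case_inl A B C) = case_inl (sub r A) (sub r B) (sub r C)"
  "sub r (case_inr A B C) = case_inr (sub r A) (sub r B) (sub r C)"
  "sub r (case_succ C) = case_succ (sub r C)"
  "sub r (motive_id j A) = motive_id j (sub r A)"
  "sub r (case_refl A C) = case_refl (sub r A) (sub r C)"
  "sub r (case_trpt A P) = case_trpt (sub r A) (sub r P)"
  "sub r (case_trpath A P h) = case_trpath (sub r A) (sub r P) (sub r h)"
  "sub r (case_cin A f P) = case_cin (sub r A) (sub r f) (sub r P)"
  "sub r (case_glue A f P h) = case_glue (sub r A) (sub r f) (sub r P) (sub r h)"
  by (simp_all add: case_defs)

lemmas ren_cases [simp] = sub_cases[of "V \<circ> r" for r, folded ren_eq_sub]

lemma sub_ctype [simp]: "sub s (ctype i j c) = ctype i j c"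
  by (cases c) simp_all

lemmas ren_ctype [simp] = sub_ctype[of "V \<circ> r" for r, folded ren_eq_sub]

lemmas lift_defs [simp] = ren_defs[of "shift n" for n, unfolded ren_shift]
  ren_defs2[of "shift n" for n, unfolded ren_shift] ren_cases[of "shift n" for n, unfolded ren_shift]
  ren_ctype[of "shift n" for n, unfolded ren_shift]

section \<open>Admissibility of weakening and substitution\<close>

text \<open>
  Stability of the judgements is needed for renamings first, because lifting a substitution under a
  binder weakens it, and then for substitutions. One induction serves both: it is carried out for any
  relation \<open>R \<Delta> s \<Gamma>\<close> that supplies typed values for the variables and survives lifting.
\<close>

definition up_closed :: "(tm list \<Rightarrow> (nat \<Rightarrow> tm) \<Rightarrow> tm list \<Rightarrow> bool) \<Rightarrow> bool" where
  "up_closed R \<longleftrightarrow> (\<forall>\<Delta> s \<Gamma>. R \<Delta> s \<Gamma> \<longrightarrow> wf \<Delta> \<and> (\<forall>n<length \<Gamma>. \<Delta> \<turnstile> s n \<Ztypecolon> sub s (\<Gamma> ! n \<up> Suc n)) \<and>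
     (\<forall>A. wf (sub s A # \<Delta>) \<longrightarrow> R (sub s A # \<Delta>) (up s) (A # \<Gamma>)))"

text \<open>
  The premise of the typing rule for \<open>Lam\<close> mentions the domain only through the context, yet to lift
  \<open>s\<close> one must know that the substituted domain is a type. The induction therefore also carries
  this statement about every entry of the context.
\<close>

definition ctx_stable :: "(tm list \<Rightarrow> (nat \<Rightarrow> tm) \<Rightarrow> tm list \<Rightarrow> bool) \<Rightarrow> tm list \<Rightarrow> bool" where
  "ctx_stable R \<Gamma> \<longleftrightarrow> (\<forall>\<Xi> A \<Gamma>' \<Delta> s. \<Gamma> = \<Xi> @ A # \<Gamma>' \<longrightarrow> R \<Delta> s \<Gamma>' \<longrightarrow> (\<exists>i. \<Delta> \<turnstile> sub s A \<Ztypecolon> U i))"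

lemma ctx_stable_Nil: "ctx_stable R []" by (simp add: ctx_stable_def)

lemma ctx_stable_Cons: "ctx_stable R (A # \<Gamma>) \<longleftrightarrow> ctx_stable R \<Gamma> \<and> (\<forall>\<Delta> s. R \<Delta> s \<Gamma> \<longrightarrow> (\<exists>i. \<Delta> \<turnstile> sub s A \<Ztypecolon> U i))"
  unfolding ctx_stable_def by (auto simp: Cons_eq_append_conv) blast+

lemma judgements_stable:
  assumes "up_closed R"
  shows "wf \<Gamma> \<Longrightarrow> ctx_stable R \<Gamma>"
    and "\<Gamma> \<turnstile> t \<Ztypecolon> T \<Longrightarrow> ctx_stable R \<Gamma> \<and> (\<forall>\<Delta> s. R \<Delta> s \<Gamma> \<longrightarrow> \<Delta> \<turnstile> sub s t \<Ztypecolon> sub s T)"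
    and "\<Gamma> \<turnstile> t \<doteq> u \<Ztypecolon> T \<Longrightarrow> ctx_stable R \<Gamma> \<and> (\<forall>\<Delta> s. R \<Delta> s \<Gamma> \<longrightarrow> \<Delta> \<turnstile> sub s t \<doteq> sub s u \<Ztypecolon> sub s T)"
proof (induction rule: wf_typed_jeq.inducts)
  have Rwf: "R \<Delta> s \<Gamma> \<Longrightarrow> wf \<Delta>" for \<Delta> s \<Gamma> using assms unfolding up_closed_def by blast
  have RV: "R \<Delta> s \<Gamma> \<Longrightarrow> n < length \<Gamma> \<Longrightarrow> \<Delta> \<turnstile> s n \<Ztypecolon> sub s (\<Gamma> ! n \<up> Suc n)" for \<Delta> s \<Gamma> n
    using assms unfolding up_closed_def by blast
  have Rup: "R \<Delta> s \<Gamma> \<Longrightarrow> \<Delta> \<turnstile> sub s A \<Ztypecolon> U i \<Longrightarrow> R (sub s A # \<Delta>) (up s) (A # \<Gamma>)" for \<Delta> s \<Gamma> A i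
    using assms wf_Cons unfolding up_closed_def by blast
  {
    case wf_Nil
    show ?case by (rule ctx_stable_Nil)
  next
    case (wf_Cons \<Gamma> A i)
    then show ?case by (auto simp: ctx_stable_Cons)
  next
    case (ty_V \<Gamma> n)
    then show ?case by (auto simp: RV)
  next
    case (ty_U \<Gamma> i)
    then show ?case by (auto intro: wf_typed_jeq.intros Rwf)
  next
    case (ty_cumul \<Gamma> A i)
    then show ?case by (auto intro: wf_typed_jeq.intros)
  next
    case (ty_Const \<Gamma> c i j)
    then show ?case by (auto intro: wf_typed_jeq.intros Rwf)
  next
    case (ty_Pi \<Gamma> A i B)
    then show ?case by (auto intro!: wf_typed_jeq.ty_Pi) (metis Rup)
  next
    case (ty_Lam A \<Gamma> b B)
    then show ?case by (auto simp: ctx_stable_Cons intro!: wf_typed_jeq.ty_Lam) (metis Rup)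
  next
    case (ty_App \<Gamma> f A B a)
    then show ?case by (auto simp: sub_inst intro!: wf_typed_jeq.ty_App)
  next
    case (ty_conv \<Gamma> a A B i)
    then show ?case by simp (metis wf_typed_jeq.ty_conv)
  next
    case (eq_refl \<Gamma> a A)
    then show ?case by (auto intro: wf_typed_jeq.eq_refl)
  next
    case (eq_sym \<Gamma> a b A)
    then show ?case by (auto intro: wf_typed_jeq.eq_sym)
  next
    case (eq_trans \<Gamma> a b A c)
    then show ?case by simp (metis wf_typed_jeq.eq_trans)
  next
    case (eq_conv \<Gamma> a b A B i)
    then show ?case by simp (metis wf_typed_jeq.eq_conv)
  next
    case (eq_cumul \<Gamma> A B i)
    then show ?case by (auto intro: wf_typed_jeq.eq_cumul)
  next
    case (eq_Pi \<Gamma> A A' i B B')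
    then have "\<Delta> \<turnstile> sub s (Pi A B) \<doteq> sub s (Pi A' B') \<Ztypecolon> U i" if "R \<Delta> s \<Gamma>" for \<Delta> s
      using that by (auto simp: ctx_stable_Cons intro!: wf_typed_jeq.eq_Pi) (metis Rup)
    with eq_Pi show ?case by auto
  next
    case (eq_Lam \<Gamma> A A' i b b' B)
    then show ?case by (auto simp: ctx_stable_Cons intro!: wf_typed_jeq.eq_Lam) (metis Rup)+
  next
    case (eq_App \<Gamma> f f' A B a a')
    then show ?case by (auto simp: sub_inst intro!: wf_typed_jeq.eq_App)
  next
    case (beta A \<Gamma> b B a)
    then show ?case by (auto simp: ctx_stable_Cons sub_inst intro!: wf_typed_jeq.beta) (metis Rup)+
  next
    case (eta \<Gamma> f A B)
    then have "\<Delta> \<turnstile> sub s f \<doteq> sub s (Lam A (f \<up> 1 \<cdot> V 0)) \<Ztypecolon> sub s (Pi A B)" if "R \<Delta> s \<Gamma>" for \<Delta> s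
      using wf_typed_jeq.eta[of \<Delta> "sub s f" "sub s A" "sub (up s) B"] that by auto
    with eta show ?case by auto
  next
    case (comp_Sigma \<Gamma> A i B C j g a b)
    then show ?case by simp (blast intro: wf_typed_jeq.comp_Sigma)
  next
    case comp_Inl
    then show ?case by simp (blast intro: wf_typed_jeq.comp_Inl)
  next
    case comp_Inr
    then show ?case by simp (blast intro: wf_typed_jeq.comp_Inr)
  next
    case comp_Unit
    then show ?case by simp (blast intro: wf_typed_jeq.comp_Unit)
  next
    case comp_Zero
    then show ?case by simp (blast intro: wf_typed_jeq.comp_Zero)
  next
    case comp_Succ
    then show ?case by simp (blast intro: wf_typed_jeq.comp_Succ)
  next
    case comp_Refl
    then show ?case by simp (blast intro: wf_typed_jeq.comp_Refl)
  next
    case comp_TrPt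
    then show ?case by simp (blast intro: wf_typed_jeq.comp_TrPt)
  next
    case comp_ColimIn
    then show ?case by simp (blast intro: wf_typed_jeq.comp_ColimIn)
  }
qed

text \<open>
  Proved for all tails of the context at once, since passing from the body of a \<open>Lam\<close> to the
  abstraction drops an entry.
\<close>

lemma typed_wf: "\<Gamma> \<turnstile> t \<Ztypecolon> T \<Longrightarrow> wf \<Gamma>" "\<Gamma> \<turnstile> t \<doteq> u \<Ztypecolon> T \<Longrightarrow> wf \<Gamma>"
proof -
  have "wf \<Gamma> \<Longrightarrow> \<forall>n. wf (drop n \<Gamma>)" and "\<Gamma> \<turnstile> t \<Ztypecolon> T \<Longrightarrow> \<forall>n. wf (drop n \<Gamma>)"
    and "\<Gamma> \<turnstile> t \<doteq> u \<Ztypecolon> T \<Longrightarrow> \<forall>n. wf (drop n \<Gamma>)" for \<Gamma> t u T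
  proof (induction rule: wf_typed_jeq.inducts)
    case (wf_Cons \<Gamma> A i)
    then show ?case by (metis drop0 drop_Suc_Cons not0_implies_Suc wf_typed_jeq.wf_Cons)
  qed (auto intro: wf_typed_jeq.intros, (metis drop_Suc_Cons)+)
  then show "\<Gamma> \<turnstile> t \<Ztypecolon> T \<Longrightarrow> wf \<Gamma>" "\<Gamma> \<turnstile> t \<doteq> u \<Ztypecolon> T \<Longrightarrow> wf \<Gamma>"
    by (metis drop0)+
qed

text \<open>
  Well-typed renamings, presented as substitutions of variables.
\<close>

definition is_ren :: "tm list \<Rightarrow> (nat \<Rightarrow> tm) \<Rightarrow> tm list \<Rightarrow> bool" where
  "is_ren \<Delta> s \<Gamma> \<longleftrightarrow> wf \<Delta> \<and> (\<exists>r. s = V \<circ> r \<and>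
     (\<forall>n<length \<Gamma>. r n < length \<Delta> \<and> ren r (\<Gamma> ! n \<up> Suc n) = \<Delta> ! r n \<up> Suc (r n)))"

lemma is_ren_up_closed: "up_closed is_ren"
proof -
  have "is_ren (sub s A # \<Delta>) (up s) (A # \<Gamma>)" if "is_ren \<Delta> s \<Gamma>" "wf (sub s A # \<Delta>)" for \<Delta> s \<Gamma> A
  proof -
    from that obtain r where r: "s = V \<circ> r"
      "\<And>n. n < length \<Gamma> \<Longrightarrow> r n < length \<Delta> \<and> ren r (\<Gamma> ! n \<up> Suc n) = \<Delta> ! r n \<up> Suc (r n)"
      unfolding is_ren_def by blast
    have "up s = V \<circ> upr r"
      by (rule ext, rename_tac n, case_tac n; simp add: r(1))
    moreover have "upr r n < length (sub s A # \<Delta>) \<and>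
        ren (upr r) ((A # \<Gamma>) ! n \<up> Suc n) = (sub s A # \<Delta>) ! upr r n \<up> Suc (upr r n)"
      if "n < length (A # \<Gamma>)" for n
    proof (cases n)
      case 0
      then show ?thesis by (simp add: ren_eq_sub[of r] r(1))
    next
      case (Suc m)
      with that r(2)[of m] show ?thesis by simp
    qed
    ultimately show ?thesis using that(2) unfolding is_ren_def by blast
  qed
  moreover have "\<Delta> \<turnstile> s n \<Ztypecolon> sub s (\<Gamma> ! n \<up> Suc n)" if "is_ren \<Delta> s \<Gamma>" "n < length \<Gamma>" for \<Delta> s \<Gamma> n
    using that ty_V unfolding is_ren_def by (force simp flip: ren_eq_sub)
  ultimately show ?thesis unfolding up_closed_def is_ren_def by blast
qed

lemma is_ren_weak: "wf (B # \<Gamma>) \<Longrightarrow> is_ren (B # \<Gamma>) (V \<circ> shift 1) \<Gamma>"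
  unfolding is_ren_def by (intro conjI exI[of _ "shift 1"]) auto

lemma weak:
  assumes "wf (B # \<Gamma>)"
  shows "\<Gamma> \<turnstile> t \<Ztypecolon> T \<Longrightarrow> B # \<Gamma> \<turnstile> t \<up> 1 \<Ztypecolon> T \<up> 1"
    and "\<Gamma> \<turnstile> t \<doteq> u \<Ztypecolon> T \<Longrightarrow> B # \<Gamma> \<turnstile> t \<up> 1 \<doteq> u \<up> 1 \<Ztypecolon> T \<up> 1"
  using judgements_stable(2,3)[OF is_ren_up_closed] is_ren_weak[OF assms]
  by (metis ren_eq_sub ren_shift)+

definition is_sub :: "tm list \<Rightarrow> (nat \<Rightarrow> tm) \<Rightarrow> tm list \<Rightarrow> bool" where
  "is_sub \<Delta> s \<Gamma> \<longleftrightarrow> wf \<Delta> \<and> (\<forall>n<length \<Gamma>. \<Delta> \<turnstile> s n \<Ztypecolon> sub s (\<Gamma> ! n \<up> Suc n))"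

lemma is_sub_up_closed: "up_closed is_sub"
proof -
  have "sub s A # \<Delta> \<turnstile> up s n \<Ztypecolon> sub (up s) ((A # \<Gamma>) ! n \<up> Suc n)"
    if "is_sub \<Delta> s \<Gamma>" "wf (sub s A # \<Delta>)" "n < length (A # \<Gamma>)" for \<Delta> s \<Gamma> A n
  proof (cases n)
    case 0
    then show ?thesis using ty_V[OF that(2), of 0] by simp
  next
    case (Suc m)
    with that have "\<Delta> \<turnstile> s m \<Ztypecolon> sub s (\<Gamma> ! m \<up> Suc m)" by (simp add: is_sub_def)
    from weak(1)[OF that(2) this] Suc show ?thesis by simp
  qed
  then show ?thesis unfolding up_closed_def is_sub_def by blast
qed

lemma is_sub_single:
  assumes "\<Gamma> \<turnstile> a \<Ztypecolon> A"
  shows "is_sub \<Gamma> (single a) (A # \<Gamma>)"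
proof -
  have "\<Gamma> \<turnstile> single a n \<Ztypecolon> sub (single a) ((A # \<Gamma>) ! n \<up> Suc n)" if "n < length (A # \<Gamma>)" for n
    using assms that ty_V[OF typed_wf(1)[OF assms]] by (cases n) auto
  then show ?thesis using typed_wf(1)[OF assms] unfolding is_sub_def by blast
qed

section \<open>Derived typing and conversion rules\<close>

text \<open>
  Most steps of the argument only assert that some term of a given type exists.
\<close>

definition inh :: "tm list \<Rightarrow> tm \<Rightarrow> bool" where
  "inh \<Gamma> T \<longleftrightarrow> (\<exists>t. \<Gamma> \<turnstile> t \<Ztypecolon> T)"

lemma inhI: "\<Gamma> \<turnstile> t \<Ztypecolon> T \<Longrightarrow> inh \<Gamma> T" by (auto simp: inh_def)

lemma cumul_le: "\<Gamma> \<turnstile> A \<Ztypecolon> U i \<Longrightarrow> i \<le> j \<Longrightarrow> \<Gamma> \<turnstile> A \<Ztypecolon> U j"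
  by (rotate_tac, induction rule: dec_induct) (auto intro: ty_cumul)

lemma inst_simps [simp]:
  "inst (t \<up> Suc n) a = t \<up> n"
  "inst (V 0) a = a" "inst (V (Suc n)) a = V n" "inst (U i) a = U i" "inst (Const c) a = Const c"
  "inst (f \<cdot> b) a = inst f a \<cdot> inst b a"
  "inst (Pi A B) a = Pi (inst A a) (sub (up (single a)) B)"
  "inst (Lam A B) a = Lam (inst A a) (sub (up (single a)) B)"
  by (simp_all add: inst_single)

lemma sub_single_inst [simp]: "sub (single a) t = inst t a" by (simp add: inst_single)

lemmas inst_defs [simp] = sub_defs[of "single a" for a, unfolded sub_single_inst]
  sub_defs2[of "single a" for a, unfolded sub_single_inst] sub_cases[of "single a" for a, unfolded sub_single_inst]

text \<open>
  The equation for the type leaves the computation of the substitution to the simplifier.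
\<close>

lemma ty_AppE: "\<Gamma> \<turnstile> f \<Ztypecolon> Pi A B \<Longrightarrow> \<Gamma> \<turnstile> a \<Ztypecolon> A \<Longrightarrow> T = inst B a \<Longrightarrow> \<Gamma> \<turnstile> f \<cdot> a \<Ztypecolon> T"
  using ty_App by blast

lemma ty_arrE: "\<Gamma> \<turnstile> f \<Ztypecolon> arr A B \<Longrightarrow> \<Gamma> \<turnstile> a \<Ztypecolon> A \<Longrightarrow> \<Gamma> \<turnstile> f \<cdot> a \<Ztypecolon> B"
  unfolding arr_def using ty_App by fastforce

lemma ty_piFE: "\<Gamma> \<turnstile> f \<Ztypecolon> piF A B \<Longrightarrow> \<Gamma> \<turnstile> a \<Ztypecolon> A \<Longrightarrow> \<Gamma> \<turnstile> f \<cdot> a \<Ztypecolon> B \<cdot> a"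
  unfolding piF_def using ty_App by fastforce

lemma weakU: "\<Gamma> \<turnstile> t \<Ztypecolon> U i \<Longrightarrow> wf (B # \<Gamma>) \<Longrightarrow> B # \<Gamma> \<turnstile> t \<up> 1 \<Ztypecolon> U i"
  using weak(1)[of B \<Gamma> t "U i"] by simp

lemma ty_V': "wf \<Gamma> \<Longrightarrow> n < length \<Gamma> \<Longrightarrow> T = (\<Gamma> ! n) \<up> Suc n \<Longrightarrow> \<Gamma> \<turnstile> V n \<Ztypecolon> T"
  using ty_V by simp

lemma ty_V0: "\<Gamma> \<turnstile> A \<Ztypecolon> U i \<Longrightarrow> A # \<Gamma> \<turnstile> V 0 \<Ztypecolon> A \<up> 1"
  using ty_V[OF wf_Cons, of \<Gamma> A i 0] by simp

lemma ty_arr: "\<Gamma> \<turnstile> A \<Ztypecolon> U i \<Longrightarrow> \<Gamma> \<turnstile> B \<Ztypecolon> U i \<Longrightarrow> \<Gamma> \<turnstile> arr A B \<Ztypecolon> U i"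
  unfolding arr_def by (blast intro: ty_Pi weakU wf_Cons)

lemma ty_Pi_le: "\<Gamma> \<turnstile> A \<Ztypecolon> U i \<Longrightarrow> A # \<Gamma> \<turnstile> B \<Ztypecolon> U j \<Longrightarrow> i \<le> k \<Longrightarrow> j \<le> k \<Longrightarrow> \<Gamma> \<turnstile> Pi A B \<Ztypecolon> U k"
  by (meson cumul_le ty_Pi)

lemma ty_Lam_arr: "A # \<Gamma> \<turnstile> b \<Ztypecolon> B \<up> 1 \<Longrightarrow> \<Gamma> \<turnstile> Lam A b \<Ztypecolon> arr A B"
  unfolding arr_def by (rule ty_Lam)

lemma ty_Lam_fam: "A # \<Gamma> \<turnstile> b \<Ztypecolon> U j \<Longrightarrow> \<Gamma> \<turnstile> Lam A b \<Ztypecolon> arr A (U j)"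
  by (rule ty_Lam_arr) simp

lemma ty_piF:
  assumes "\<Gamma> \<turnstile> A \<Ztypecolon> U i" "\<Gamma> \<turnstile> B \<Ztypecolon> arr A (U j)" "i \<le> k" "j \<le> k"
  shows "\<Gamma> \<turnstile> piF A B \<Ztypecolon> U k"
proof -
  have "A # \<Gamma> \<turnstile> B \<up> 1 \<Ztypecolon> arr (A \<up> 1) (U j)"
    using weak(1)[OF wf_Cons[OF assms(1)] assms(2)] by simp
  from ty_Pi_le[OF assms(1) ty_arrE[OF this ty_V0[OF assms(1)]] assms(3,4)]
  show ?thesis by (simp add: piF_def)
qed

lemma ty_constE: "wf \<Gamma> \<Longrightarrow> ctype i j c = T \<Longrightarrow> \<Gamma> \<turnstile> Const c \<Ztypecolon> T"
  using ty_Const by blast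

lemma ty_idT:
  assumes "\<Gamma> \<turnstile> A \<Ztypecolon> U i" "\<Gamma> \<turnstile> a \<Ztypecolon> A" "\<Gamma> \<turnstile> b \<Ztypecolon> A"
  shows "\<Gamma> \<turnstile> idT A a b \<Ztypecolon> U i"
proof -
  have "\<Gamma> \<turnstile> Const cId \<cdot> A \<Ztypecolon> arr A (arr A (U i))"
    by (rule ty_AppE[OF ty_Const[where c=cId and i=i and j=0, simplified] assms(1)]) (use assms typed_wf in simp_all)
  then show ?thesis unfolding idT_def using assms ty_arrE by blast
qed

lemma ty_rfl:
  assumes "\<Gamma> \<turnstile> A \<Ztypecolon> U i" "\<Gamma> \<turnstile> a \<Ztypecolon> A"
  shows "\<Gamma> \<turnstile> rfl A a \<Ztypecolon> idT A a a"
proof -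
  have "\<Gamma> \<turnstile> Const cRefl \<cdot> A \<Ztypecolon> Pi A (idT (A \<up> 1) (V 0) (V 0))"
    by (rule ty_AppE[OF ty_Const[where c=cRefl and i=i and j=0, simplified] assms(1)]) (use assms typed_wf in simp_all)
  then show ?thesis unfolding rfl_def by (rule ty_AppE) (use assms in simp_all)
qed

lemma ty_succ: assumes "\<Gamma> \<turnstile> n \<Ztypecolon> natT" shows "\<Gamma> \<turnstile> succ n \<Ztypecolon> natT"
  unfolding succ_def
  by (rule ty_arrE[OF ty_constE[where i=0 and j=0]]) (use assms typed_wf in simp_all)

lemma ty_natT: "wf \<Gamma> \<Longrightarrow> \<Gamma> \<turnstile> natT \<Ztypecolon> U i"
  by (rule ty_constE) simp_all

lemma ty_zero: "wf \<Gamma> \<Longrightarrow> \<Gamma> \<turnstile> zero \<Ztypecolon> natT"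
  by (rule ty_constE) simp_all

lemma ty_tr:
  assumes "\<Gamma> \<turnstile> A \<Ztypecolon> U i" shows "\<Gamma> \<turnstile> tr A \<Ztypecolon> U i"
  unfolding tr_def
  by (rule ty_arrE[OF ty_constE[where i=i and j=0] assms(1)]) (use assms typed_wf in simp_all)

lemma ty_trpt:
  assumes "\<Gamma> \<turnstile> A \<Ztypecolon> U i" "\<Gamma> \<turnstile> a \<Ztypecolon> A" shows "\<Gamma> \<turnstile> trpt A a \<Ztypecolon> tr A"
proof -
  have "\<Gamma> \<turnstile> Const cTrPt \<cdot> A \<Ztypecolon> arr A (tr A)"
    by (rule ty_AppE[OF ty_Const[where c=cTrPt and i=i and j=0, simplified] assms(1)]) (use assms typed_wf in simp_all)
  then show ?thesis unfolding trpt_def using assms ty_arrE by blast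
qed

lemma ty_trpath:
  assumes "\<Gamma> \<turnstile> A \<Ztypecolon> U i" "\<Gamma> \<turnstile> a \<Ztypecolon> A" "\<Gamma> \<turnstile> b \<Ztypecolon> A"
  shows "\<Gamma> \<turnstile> trpath A a b \<Ztypecolon> idT (tr A) (trpt A a) (trpt A b)"
proof -
  have "\<Gamma> \<turnstile> Const cTrPath \<cdot> A \<Ztypecolon>
      Pi A (Pi (A \<up> 1) (idT (tr (A \<up> 2)) (trpt (A \<up> 2) (V 1)) (trpt (A \<up> 2) (V 0))))"
    by (rule ty_AppE[OF ty_Const[where c=cTrPath and i=i and j=0, simplified] assms(1)]) (use assms typed_wf in simp_all)
  then have "\<Gamma> \<turnstile> Const cTrPath \<cdot> A \<cdot> a \<Ztypecolon>
      Pi A (idT (tr (A \<up> 1)) (trpt (A \<up> 1) (a \<up> 1)) (trpt (A \<up> 1) (V 0)))"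
    by (rule ty_AppE) (use assms in simp_all)
  then show ?thesis unfolding trpath_def by (rule ty_AppE) (use assms in simp_all)
qed

lemma ty_colim:
  assumes "\<Gamma> \<turnstile> F \<Ztypecolon> arr natT (U i)" "\<Gamma> \<turnstile> f \<Ztypecolon> seqmaps F"
  shows "\<Gamma> \<turnstile> colim F f \<Ztypecolon> U i"
proof -
  have "\<Gamma> \<turnstile> Const cColim \<cdot> F \<Ztypecolon> arr (seqmaps F) (U i)"
    by (rule ty_AppE[OF ty_Const[where c=cColim and i=i and j=0, simplified] assms(1)]) (use assms typed_wf in simp_all)
  then show ?thesis unfolding colim_def using assms ty_arrE by blast
qed

lemma ty_cin_const:
  assumes "\<Gamma> \<turnstile> F \<Ztypecolon> arr natT (U i)" "\<Gamma> \<turnstile> f \<Ztypecolon> seqmaps F" "\<Gamma> \<turnstile> n \<Ztypecolon> natT"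
  shows "\<Gamma> \<turnstile> Const cColimIn \<cdot> F \<cdot> f \<cdot> n \<Ztypecolon> arr (F \<cdot> n) (colim F f)"
proof -
  have "\<Gamma> \<turnstile> Const cColimIn \<cdot> F \<Ztypecolon>
      Pi (seqmaps F) (Pi natT (arr (F \<up> 2 \<cdot> V 0) (colim (F \<up> 2) (V 1))))"
    by (rule ty_AppE[OF ty_Const[where c=cColimIn and i=i and j=0, simplified] assms(1)]) (use assms typed_wf in simp_all)
  then have "\<Gamma> \<turnstile> Const cColimIn \<cdot> F \<cdot> f \<Ztypecolon> Pi natT (arr (F \<up> 1 \<cdot> V 0) (colim (F \<up> 1) (f \<up> 1)))"
    by (rule ty_AppE) (use assms in simp_all)
  then show ?thesis by (rule ty_AppE) (use assms in simp_all)
qed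

lemma ty_cin:
  assumes "\<Gamma> \<turnstile> F \<Ztypecolon> arr natT (U i)" "\<Gamma> \<turnstile> f \<Ztypecolon> seqmaps F" "\<Gamma> \<turnstile> n \<Ztypecolon> natT" "\<Gamma> \<turnstile> a \<Ztypecolon> F \<cdot> n"
  shows "\<Gamma> \<turnstile> cin F f n a \<Ztypecolon> colim F f"
  unfolding cin_def by (rule ty_arrE[OF ty_cin_const[OF assms(1-3)] assms(4)])

lemma ty_glue:
  assumes "\<Gamma> \<turnstile> F \<Ztypecolon> arr natT (U i)" "\<Gamma> \<turnstile> f \<Ztypecolon> seqmaps F" "\<Gamma> \<turnstile> n \<Ztypecolon> natT" "\<Gamma> \<turnstile> a \<Ztypecolon> F \<cdot> n"
  shows "\<Gamma> \<turnstile> glue F f n a \<Ztypecolon> idT (colim F f) (cin F f (succ n) (f \<cdot> n \<cdot> a)) (cin F f n a)"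
proof -
  have "\<Gamma> \<turnstile> Const cColimGlue \<cdot> F \<Ztypecolon>
      Pi (seqmaps F) (Pi natT (Pi (F \<up> 2 \<cdot> V 0) (idT (colim (F \<up> 3) (V 2))
        (cin (F \<up> 3) (V 2) (succ (V 1)) (V 2 \<cdot> V 1 \<cdot> V 0)) (cin (F \<up> 3) (V 2) (V 1) (V 0)))))"
    by (rule ty_AppE[OF ty_Const[where c=cColimGlue and i=i and j=0, simplified] assms(1)]) (use assms typed_wf in simp_all)
  then have "\<Gamma> \<turnstile> Const cColimGlue \<cdot> F \<cdot> f \<Ztypecolon> Pi natT (Pi (F \<up> 1 \<cdot> V 0) (idT (colim (F \<up> 2) (f \<up> 2))
        (cin (F \<up> 2) (f \<up> 2) (succ (V 1)) (f \<up> 2 \<cdot> V 1 \<cdot> V 0)) (cin (F \<up> 2) (f \<up> 2) (V 1) (V 0))))"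
    by (rule ty_AppE) (use assms in simp_all)
  then have "\<Gamma> \<turnstile> Const cColimGlue \<cdot> F \<cdot> f \<cdot> n \<Ztypecolon> Pi (F \<cdot> n) (idT (colim (F \<up> 1) (f \<up> 1))
        (cin (F \<up> 1) (f \<up> 1) (succ (n \<up> 1)) (f \<up> 1 \<cdot> n \<up> 1 \<cdot> V 0)) (cin (F \<up> 1) (f \<up> 1) (n \<up> 1) (V 0)))"
    by (rule ty_AppE) (use assms in simp_all)
  then show ?thesis unfolding glue_def by (rule ty_AppE) (use assms in simp_all)
qed

lemma ty_seqmap:
  assumes "\<Gamma> \<turnstile> f \<Ztypecolon> seqmaps F" "\<Gamma> \<turnstile> n \<Ztypecolon> natT" "\<Gamma> \<turnstile> a \<Ztypecolon> F \<cdot> n"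
  shows "\<Gamma> \<turnstile> f \<cdot> n \<cdot> a \<Ztypecolon> F \<cdot> succ n"
proof -
  have "\<Gamma> \<turnstile> f \<cdot> n \<Ztypecolon> arr (F \<cdot> n) (F \<cdot> succ n)"
    by (rule ty_AppE[OF assms(1)[unfolded seqmaps_def]]) (use assms in simp_all)
  then show ?thesis using assms ty_arrE by blast
qed

lemma eq_App_arr: "\<Gamma> \<turnstile> f \<doteq> f' \<Ztypecolon> arr A B \<Longrightarrow> \<Gamma> \<turnstile> a \<doteq> a' \<Ztypecolon> A \<Longrightarrow> \<Gamma> \<turnstile> f \<cdot> a \<doteq> f' \<cdot> a' \<Ztypecolon> B"
  unfolding arr_def using eq_App by fastforce

lemma beta': "\<Gamma> \<turnstile> f \<doteq> Lam A b \<Ztypecolon> Pi A B \<Longrightarrow> A # \<Gamma> \<turnstile> b \<Ztypecolon> B \<Longrightarrow> \<Gamma> \<turnstile> a \<Ztypecolon> A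
  \<Longrightarrow> t = inst b a \<Longrightarrow> T = inst B a \<Longrightarrow> \<Gamma> \<turnstile> f \<cdot> a \<doteq> t \<Ztypecolon> T"
  using eq_trans[OF eq_App[OF _ eq_refl] beta] by blast

lemma fam_beta: "A # \<Gamma> \<turnstile> B \<Ztypecolon> U j \<Longrightarrow> \<Gamma> \<turnstile> a \<Ztypecolon> A \<Longrightarrow> T = inst B a \<Longrightarrow> \<Gamma> \<turnstile> Lam A B \<cdot> a \<doteq> T \<Ztypecolon> U j"
  using beta[of A \<Gamma> B "U j" a] by simp

lemma idT_cong:
  assumes "\<Gamma> \<turnstile> A \<Ztypecolon> U i" "\<Gamma> \<turnstile> a \<doteq> a' \<Ztypecolon> A" "\<Gamma> \<turnstile> b \<doteq> b' \<Ztypecolon> A"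
  shows "\<Gamma> \<turnstile> idT A a b \<doteq> idT A a' b' \<Ztypecolon> U i"
proof -
  have "\<Gamma> \<turnstile> Const cId \<cdot> A \<Ztypecolon> arr A (arr A (U i))"
    by (rule ty_AppE[OF ty_Const[where c=cId and i=i and j=0, simplified] assms(1)]) (use assms typed_wf in simp_all)
  then show ?thesis unfolding idT_def using assms by (meson eq_App_arr eq_refl)
qed

lemma idT_cong_ty:
  assumes "\<Gamma> \<turnstile> A \<doteq> A' \<Ztypecolon> U i" "\<Gamma> \<turnstile> a \<doteq> a' \<Ztypecolon> A" "\<Gamma> \<turnstile> b \<doteq> b' \<Ztypecolon> A"
  shows "\<Gamma> \<turnstile> idT A a b \<doteq> idT A' a' b' \<Ztypecolon> U i"
proof -
  have "\<Gamma> \<turnstile> Const cId \<Ztypecolon> Pi (U i) (arr (V 0) (arr (V 0) (U i)))"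
    by (rule ty_constE[where i=i and j=0]) (use assms typed_wf in simp_all)
  from eq_App[OF eq_refl[OF this] assms(1)]
  have "\<Gamma> \<turnstile> Const cId \<cdot> A \<doteq> Const cId \<cdot> A' \<Ztypecolon> arr A (arr A (U i))" by simp
  then show ?thesis unfolding idT_def using assms by (meson eq_App_arr)
qed

lemma inh_conv: "inh \<Gamma> T \<Longrightarrow> \<Gamma> \<turnstile> T \<doteq> T' \<Ztypecolon> U i \<Longrightarrow> inh \<Gamma> T'"
  unfolding inh_def using ty_conv by blast

lemma ty_conv_sym: "\<Gamma> \<turnstile> a \<Ztypecolon> B \<Longrightarrow> \<Gamma> \<turnstile> A \<doteq> B \<Ztypecolon> U i \<Longrightarrow> \<Gamma> \<turnstile> a \<Ztypecolon> A"
  using ty_conv eq_sym by blast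

lemma inh_Pi: "inh (A # \<Gamma>) B \<Longrightarrow> inh \<Gamma> (Pi A B)"
  unfolding inh_def using ty_Lam by blast

text \<open>
  Judgmentally equal terms are equal by reflexivity.
\<close>

lemma inh_idT_conv:
  assumes "\<Gamma> \<turnstile> A \<Ztypecolon> U i" "\<Gamma> \<turnstile> a \<Ztypecolon> A" "\<Gamma> \<turnstile> a \<doteq> b \<Ztypecolon> A"
  shows "inh \<Gamma> (idT A a b)"
  using inh_conv[OF inhI[OF ty_rfl[OF assms(1,2)]] idT_cong[OF assms(1) eq_refl[OF assms(2)] assms(3)]] .

section \<open>Path induction with an open motive\<close>

text \<open>
  Open motives live under three binders, so the typed renamings and substitutions have to be lifted
  under each of them.
\<close>

lemma is_ren_up:
  assumes "is_ren \<Delta> (V \<circ> r) \<Gamma>" "\<Gamma> \<turnstile> A \<Ztypecolon> U i"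
  shows "is_ren (ren r A # \<Delta>) (V \<circ> upr r) (A # \<Gamma>)"
proof -
  have "\<Delta> \<turnstile> ren r A \<Ztypecolon> U i"
    using judgements_stable(2)[OF is_ren_up_closed assms(2)] assms(1) by (simp add: ren_eq_sub)
  moreover have "up (V \<circ> r) = V \<circ> upr r"
    by (rule ext, rename_tac n, case_tac n; simp)
  ultimately show ?thesis
    using is_ren_up_closed assms(1) wf_Cons unfolding up_closed_def by (metis ren_eq_sub)
qed

lemma ren_ty: "is_ren \<Delta> (V \<circ> r) \<Gamma> \<Longrightarrow> \<Gamma> \<turnstile> t \<Ztypecolon> T \<Longrightarrow> \<Delta> \<turnstile> ren r t \<Ztypecolon> ren r T"
  using judgements_stable(2)[OF is_ren_up_closed] by (simp add: ren_eq_sub)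

lemma is_sub_up:
  assumes "is_sub \<Delta> s \<Gamma>" "\<Gamma> \<turnstile> A \<Ztypecolon> U i"
  shows "is_sub (sub s A # \<Delta>) (up s) (A # \<Gamma>)"
proof -
  have "\<Delta> \<turnstile> sub s A \<Ztypecolon> U i"
    using judgements_stable(2)[OF is_sub_up_closed assms(2)] assms(1) by simp
  then show ?thesis
    using is_sub_up_closed assms(1) wf_Cons unfolding up_closed_def by metis
qed

lemma sub_ty: "is_sub \<Delta> s \<Gamma> \<Longrightarrow> \<Gamma> \<turnstile> t \<Ztypecolon> T \<Longrightarrow> \<Delta> \<turnstile> sub s t \<Ztypecolon> sub s T"
  using judgements_stable(2)[OF is_sub_up_closed] by simp

text \<open>
  The context \<open>x : A, y : A, p : x = y\<close> of a motive for path induction.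
\<close>

definition path_ctx :: "tm \<Rightarrow> tm list \<Rightarrow> tm list" where
  "path_ctx A \<Gamma> = idT (A \<up> 2) (V 1) (V 0) # A \<up> 1 # A # \<Gamma>"

text \<open>
  The instance of an open motive at \<open>x\<close>, \<open>y\<close>, \<open>p\<close>, in the form in which three successive beta
  reductions produce it.
\<close>

definition inst3 :: "tm \<Rightarrow> tm \<Rightarrow> tm \<Rightarrow> tm \<Rightarrow> tm" where
  "inst3 C x y p = inst (sub (up (single y)) (sub (up (up (single x))) C)) p"

definition path_motive :: "tm \<Rightarrow> tm \<Rightarrow> tm" where
  "path_motive A C = Lam A (Lam (A \<up> 1) (Lam (idT (A \<up> 2) (V 1) (V 0)) C))"

lemma ren_path_motive: "ren r (path_motive B C) = path_motive (ren r B) (ren (upr (upr (upr r))) C)"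
  unfolding path_motive_def by simp

context
  fixes \<Gamma> A i assumes A: "\<Gamma> \<turnstile> A \<Ztypecolon> U i"
begin

lemma path_ctx_prefix: "wf (A # \<Gamma>)" "A # \<Gamma> \<turnstile> A \<up> 1 \<Ztypecolon> U i" "wf (A \<up> 1 # A # \<Gamma>)"
  using A wf_Cons weakU by blast+

lemma path_ctx_type:
  shows "A \<up> 1 # A # \<Gamma> \<turnstile> idT (A \<up> 2) (V 1) (V 0) \<Ztypecolon> U i"
proof (rule ty_idT)
  show "A \<up> 1 # A # \<Gamma> \<turnstile> A \<up> 2 \<Ztypecolon> U i" using weakU[OF path_ctx_prefix(2,3)] by simp
qed (use path_ctx_prefix in \<open>auto intro!: ty_V'\<close>)

lemma wf_path_ctx: "wf (path_ctx A \<Gamma>)"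
  unfolding path_ctx_def using wf_Cons path_ctx_type by blast

lemma path_ctx_weak: "\<Gamma> \<turnstile> t \<Ztypecolon> T \<Longrightarrow> T' = T \<up> 3 \<Longrightarrow> path_ctx A \<Gamma> \<turnstile> t \<up> 3 \<Ztypecolon> T'"
  using weak(1)[OF wf_path_ctx[unfolded path_ctx_def] weak(1)[OF path_ctx_prefix(3) weak(1)[OF path_ctx_prefix(1)]]]
  unfolding path_ctx_def by simp

lemma path_ctx_vars: "path_ctx A \<Gamma> \<turnstile> V 2 \<Ztypecolon> A \<up> 3" "path_ctx A \<Gamma> \<turnstile> V 1 \<Ztypecolon> A \<up> 3"
  "path_ctx A \<Gamma> \<turnstile> V 0 \<Ztypecolon> idT (A \<up> 3) (V 2) (V 1)"
  using wf_path_ctx by (auto intro!: ty_V' simp: path_ctx_def)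

lemma ty_indId:
  assumes C: "\<Gamma> \<turnstile> C \<Ztypecolon> motive_id j A" and c: "\<Gamma> \<turnstile> c \<Ztypecolon> case_refl A C"
    and x: "\<Gamma> \<turnstile> x \<Ztypecolon> A" and y: "\<Gamma> \<turnstile> y \<Ztypecolon> A"
  shows "\<Gamma> \<turnstile> Const cIndId \<cdot> A \<cdot> C \<cdot> c \<cdot> x \<cdot> y \<Ztypecolon> Pi (idT A x y) (C \<up> 1 \<cdot> x \<up> 1 \<cdot> y \<up> 1 \<cdot> V 0)"
proof -
  have "\<Gamma> \<turnstile> Const cIndId \<cdot> A \<Ztypecolon> Pi (motive_id j A) (arr (case_refl (A \<up> 1) (V 0))
     (Pi (A \<up> 1) (Pi (A \<up> 2) (Pi (idT (A \<up> 3) (V 1) (V 0)) (V 3 \<cdot> V 2 \<cdot> V 1 \<cdot> V 0)))))"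
    by (rule ty_AppE[OF ty_Const[where c=cIndId and i=i and j=j, simplified] A]) (use A typed_wf in simp_all)
  then have "\<Gamma> \<turnstile> Const cIndId \<cdot> A \<cdot> C \<Ztypecolon> arr (case_refl A C)
     (Pi A (Pi (A \<up> 1) (Pi (idT (A \<up> 2) (V 1) (V 0)) (C \<up> 3 \<cdot> V 2 \<cdot> V 1 \<cdot> V 0))))"
    by (rule ty_AppE) (use C in simp_all)
  from ty_arrE[OF this c]
  have "\<Gamma> \<turnstile> Const cIndId \<cdot> A \<cdot> C \<cdot> c \<cdot> x \<Ztypecolon>
     Pi A (Pi (idT (A \<up> 1) (x \<up> 1) (V 0)) (C \<up> 2 \<cdot> x \<up> 2 \<cdot> V 1 \<cdot> V 0))"
    by (rule ty_AppE) (use x in simp_all)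
  then show ?thesis
    by (rule ty_AppE) (use y in simp_all)
qed

lemma ty_path_motive: "path_ctx A \<Gamma> \<turnstile> C \<Ztypecolon> U j \<Longrightarrow> \<Gamma> \<turnstile> path_motive A C \<Ztypecolon> motive_id j A"
  unfolding path_motive_def motive_id_def path_ctx_def by (intro ty_Lam ty_Lam_fam)

text \<open>
  Each beta step needs the remaining body to be typed in the context where the earlier variables are
  already replaced, which the lifted substitutions provide.
\<close>

lemma path_motive_beta:
  assumes C: "path_ctx A \<Gamma> \<turnstile> C \<Ztypecolon> U j"
    and x: "\<Gamma> \<turnstile> x \<Ztypecolon> A" and y: "\<Gamma> \<turnstile> y \<Ztypecolon> A" and p: "\<Gamma> \<turnstile> p \<Ztypecolon> idT A x y"
    and T: "T = inst3 C x y p"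
  shows "\<Gamma> \<turnstile> path_motive A C \<cdot> x \<cdot> y \<cdot> p \<doteq> T \<Ztypecolon> U j"
proof -
  let ?C1 = "sub (up (up (single x))) C" and ?C2 = "sub (up (single y)) (sub (up (up (single x))) C)"
  have C1: "idT (A \<up> 1) (x \<up> 1) (V 0) # A # \<Gamma> \<turnstile> ?C1 \<Ztypecolon> U j"
    using sub_ty[OF is_sub_up[OF is_sub_up[OF is_sub_single[OF x] path_ctx_prefix(2)] path_ctx_type] C[unfolded path_ctx_def]] by simp
  have I: "A # \<Gamma> \<turnstile> idT (A \<up> 1) (x \<up> 1) (V 0) \<Ztypecolon> U i"
    using ty_idT[OF path_ctx_prefix(2) weak(1)[OF path_ctx_prefix(1) x] ty_V0[OF A]] .
  have C2: "idT A x y # \<Gamma> \<turnstile> ?C2 \<Ztypecolon> U j"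
    using sub_ty[OF is_sub_up[OF is_sub_single[OF y] I] C1] by simp
  have 1: "\<Gamma> \<turnstile> path_motive A C \<cdot> x \<doteq> Lam A (Lam (idT (A \<up> 1) (x \<up> 1) (V 0)) ?C1)
      \<Ztypecolon> Pi A (arr (idT (A \<up> 1) (x \<up> 1) (V 0)) (U j))"
    unfolding path_motive_def
    by (rule beta'[OF eq_refl, where B="Pi (A \<up> 1) (arr (idT (A \<up> 2) (V 1) (V 0)) (U j))"])
      (use x C in \<open>auto intro!: ty_Lam ty_Lam_fam simp: path_ctx_def\<close>)
  have 2: "\<Gamma> \<turnstile> path_motive A C \<cdot> x \<cdot> y \<doteq> Lam (idT A x y) ?C2 \<Ztypecolon> arr (idT A x y) (U j)"
    by (rule beta'[OF 1 ty_Lam_fam[OF C1] y]) simp_all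
  show ?thesis unfolding T inst3_def
    by (rule beta'[OF 2[unfolded arr_def] _ p]) (use C2 in simp_all)
qed

lemma path_motive_lift:
  assumes C: "path_ctx A \<Gamma> \<turnstile> C \<Ztypecolon> U j"
  shows "path_motive A C \<up> 1 = path_motive (A \<up> 1) (ren (upr (upr (upr (shift 1)))) C)"
    "path_ctx (A \<up> 1) (A # \<Gamma>) \<turnstile> ren (upr (upr (upr (shift 1)))) C \<Ztypecolon> U j"
proof -
  show "path_motive A C \<up> 1 = path_motive (A \<up> 1) (ren (upr (upr (upr (shift 1)))) C)"
    using ren_path_motive[of "shift 1" A C] by simp
  show "path_ctx (A \<up> 1) (A # \<Gamma>) \<turnstile> ren (upr (upr (upr (shift 1)))) C \<Ztypecolon> U j"
    using ren_ty[OF is_ren_up[OF is_ren_up[OF is_ren_up[OF is_ren_weak[OF path_ctx_prefix(1)] A] path_ctx_prefix(2)] path_ctx_type] C[unfolded path_ctx_def]]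
    by (simp add: path_ctx_def)
qed

end

text \<open>
  Path induction where the motive is an open term and its instances are substitution instances, not
  applications of a function. This disposes of the beta conversions once and for all.
\<close>

lemma ty_indId_open:
  assumes A: "\<Gamma> \<turnstile> A \<Ztypecolon> U i" and C: "path_ctx A \<Gamma> \<turnstile> C \<Ztypecolon> U j"
    and c: "A # \<Gamma> \<turnstile> c \<Ztypecolon> inst3 (ren (upr (upr (upr (shift 1)))) C) (V 0) (V 0) (rfl (A \<up> 1) (V 0))"
  shows "\<Gamma> \<turnstile> Lam A c \<Ztypecolon> case_refl A (path_motive A C)"
    and "\<Gamma> \<turnstile> x \<Ztypecolon> A \<Longrightarrow> \<Gamma> \<turnstile> y \<Ztypecolon> A \<Longrightarrow> \<Gamma> \<turnstile> p \<Ztypecolon> idT A x y \<Longrightarrow> T = inst3 C x y p \<Longrightarrow>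
      \<Gamma> \<turnstile> Const cIndId \<cdot> A \<cdot> path_motive A C \<cdot> Lam A c \<cdot> x \<cdot> y \<cdot> p \<Ztypecolon> T"
    and "\<Gamma> \<turnstile> x \<Ztypecolon> A \<Longrightarrow> T = inst3 C x x (rfl A x) \<Longrightarrow>
      \<Gamma> \<turnstile> Const cIndId \<cdot> A \<cdot> path_motive A C \<cdot> Lam A c \<cdot> x \<cdot> x \<cdot> rfl A x \<doteq> inst c x \<Ztypecolon> T"
proof -
  note m = path_motive_lift[OF A C]
  note A1 = path_ctx_prefix(2)[OF A] and v = ty_V0[OF A]
  have "A # \<Gamma> \<turnstile> c \<Ztypecolon> path_motive A C \<up> 1 \<cdot> V 0 \<cdot> V 0 \<cdot> rfl (A \<up> 1) (V 0)"
    unfolding m(1) by (rule ty_conv_sym[OF c path_motive_beta[OF A1 m(2) v v ty_rfl[OF A1 v] refl]])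
  then show *: "\<Gamma> \<turnstile> Lam A c \<Ztypecolon> case_refl A (path_motive A C)"
    unfolding case_refl_def by (rule ty_Lam)
  show "\<Gamma> \<turnstile> Const cIndId \<cdot> A \<cdot> path_motive A C \<cdot> Lam A c \<cdot> x \<cdot> y \<cdot> p \<Ztypecolon> T"
    if "\<Gamma> \<turnstile> x \<Ztypecolon> A" "\<Gamma> \<turnstile> y \<Ztypecolon> A" "\<Gamma> \<turnstile> p \<Ztypecolon> idT A x y" "T = inst3 C x y p"
    by (rule ty_conv[OF ty_AppE[OF ty_indId[OF A ty_path_motive[OF A C] * that(1,2)] that(3) refl]])
      (use path_motive_beta[OF A C that] in simp)
  assume x: "\<Gamma> \<turnstile> x \<Ztypecolon> A" and T: "T = inst3 C x x (rfl A x)"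
  have "\<Gamma> \<turnstile> Lam A c \<cdot> x \<doteq> inst c x \<Ztypecolon> path_motive A C \<cdot> x \<cdot> x \<cdot> rfl A x"
    by (rule beta'[OF eq_refl[OF *[unfolded case_refl_def]] _ x])
      (use \<open>A # \<Gamma> \<turnstile> c \<Ztypecolon> path_motive A C \<up> 1 \<cdot> V 0 \<cdot> V 0 \<cdot> rfl (A \<up> 1) (V 0)\<close> in simp_all)
  from eq_conv[OF eq_trans[OF comp_Refl[OF A ty_path_motive[OF A C] * x] this]
     path_motive_beta[OF A C x x ty_rfl[OF A x] T]]
  show "\<Gamma> \<turnstile> Const cIndId \<cdot> A \<cdot> path_motive A C \<cdot> Lam A c \<cdot> x \<cdot> x \<cdot> rfl A x \<doteq> inst c x \<Ztypecolon> T" .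
qed

text \<open>
  To inhabit a type family over paths it is enough to inhabit its diagonal. The two equations are
  closed by computing substitutions.
\<close>

lemma path_induction:
  assumes "\<Gamma> \<turnstile> A \<Ztypecolon> U i" "path_ctx A \<Gamma> \<turnstile> C \<Ztypecolon> U j" "inh (A # \<Gamma>) D"
    "\<Gamma> \<turnstile> x \<Ztypecolon> A" "\<Gamma> \<turnstile> y \<Ztypecolon> A" "\<Gamma> \<turnstile> p \<Ztypecolon> idT A x y"
    "D = inst3 (ren (upr (upr (upr (shift 1)))) C) (V 0) (V 0) (rfl (A \<up> 1) (V 0))" "T = inst3 C x y p"
  shows "inh \<Gamma> T"
  using ty_indId_open(2)[OF assms(1,2) _ assms(4-6,8)] assms(3) unfolding assms(7) inh_def by blast

section \<open>Transport and operations on paths\<close>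

text \<open>
  Transport is an open-motive path induction with motive \<open>P x \<rightarrow> P y\<close>.
\<close>

lemma transp_path_motive: "transp A P x y p u = Const cIndId \<cdot> A \<cdot> path_motive A (arr (P \<up> 3 \<cdot> V 2) (P \<up> 3 \<cdot> V 1))
    \<cdot> Lam A (Lam (P \<up> 1 \<cdot> V 0) (V 0)) \<cdot> x \<cdot> y \<cdot> p \<cdot> u"
  by (simp add: transp_def path_motive_def)

context
  fixes \<Gamma> A i P j x
  assumes A: "\<Gamma> \<turnstile> A \<Ztypecolon> U i" and P: "\<Gamma> \<turnstile> P \<Ztypecolon> arr A (U j)" and x: "\<Gamma> \<turnstile> x \<Ztypecolon> A"
begin

private lemma transp_motive: "path_ctx A \<Gamma> \<turnstile> arr (P \<up> 3 \<cdot> V 2) (P \<up> 3 \<cdot> V 1) \<Ztypecolon> U j"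
proof -
  have "path_ctx A \<Gamma> \<turnstile> P \<up> 3 \<Ztypecolon> arr (A \<up> 3) (U j)" by (rule path_ctx_weak[OF A P]) simp
  from ty_arr[OF ty_arrE[OF this path_ctx_vars(1)[OF A]] ty_arrE[OF this path_ctx_vars(2)[OF A]]]
  show ?thesis .
qed

private lemma transp_base: "A # \<Gamma> \<turnstile> Lam (P \<up> 1 \<cdot> V 0) (V 0) \<Ztypecolon>
  inst3 (ren (upr (upr (upr (shift 1)))) (arr (P \<up> 3 \<cdot> V 2) (P \<up> 3 \<cdot> V 1))) (V 0) (V 0) (rfl (A \<up> 1) (V 0))"
proof -
  have "A # \<Gamma> \<turnstile> P \<up> 1 \<Ztypecolon> arr (A \<up> 1) (U j)" using weak(1)[OF path_ctx_prefix(1)[OF A] P] by simp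
  from ty_arrE[OF this ty_V0[OF A]] have "A # \<Gamma> \<turnstile> P \<up> 1 \<cdot> V 0 \<Ztypecolon> U j" .
  from ty_Lam_arr[OF ty_V0[OF this]] show ?thesis by (simp add: inst3_def)
qed

lemma ty_transp:
  assumes y: "\<Gamma> \<turnstile> y \<Ztypecolon> A" and p: "\<Gamma> \<turnstile> p \<Ztypecolon> idT A x y" and u: "\<Gamma> \<turnstile> u \<Ztypecolon> P \<cdot> x"
  shows "\<Gamma> \<turnstile> transp A P x y p u \<Ztypecolon> P \<cdot> y"
  unfolding transp_path_motive
  by (rule ty_arrE[OF ty_indId_open(2)[OF A transp_motive transp_base x y p] u]) (simp add: inst3_def)

lemma transp_cong:
  assumes y: "\<Gamma> \<turnstile> y \<Ztypecolon> A" and p: "\<Gamma> \<turnstile> p \<doteq> p' \<Ztypecolon> idT A x y" and u: "\<Gamma> \<turnstile> u \<doteq> u' \<Ztypecolon> P \<cdot> x"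
    and p': "\<Gamma> \<turnstile> p \<Ztypecolon> idT A x y"
  shows "\<Gamma> \<turnstile> transp A P x y p u \<doteq> transp A P x y p' u' \<Ztypecolon> P \<cdot> y"
proof -
  let ?C = "arr (P \<up> 3 \<cdot> V 2) (P \<up> 3 \<cdot> V 1)"
  note J = ty_indId[OF A ty_path_motive[OF A transp_motive] ty_indId_open(1)[OF A transp_motive transp_base] x y]
  have "\<Gamma> \<turnstile> path_motive A ?C \<cdot> x \<cdot> y \<cdot> p \<doteq> arr (P \<cdot> x) (P \<cdot> y) \<Ztypecolon> U j"
    by (rule path_motive_beta[OF A transp_motive x y p']) (simp add: inst3_def)
  moreover have "\<Gamma> \<turnstile> Const cIndId \<cdot> A \<cdot> path_motive A ?C \<cdot> Lam A (Lam (P \<up> 1 \<cdot> V 0) (V 0)) \<cdot> x \<cdot> y \<cdot> p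
      \<doteq> Const cIndId \<cdot> A \<cdot> path_motive A ?C \<cdot> Lam A (Lam (P \<up> 1 \<cdot> V 0) (V 0)) \<cdot> x \<cdot> y \<cdot> p' \<Ztypecolon> path_motive A ?C \<cdot> x \<cdot> y \<cdot> p"
    using eq_App[OF eq_refl[OF J] p] by simp
  ultimately show ?thesis unfolding transp_path_motive using eq_conv eq_App_arr u by blast
qed

lemma transp_rfl:
  assumes u: "\<Gamma> \<turnstile> u \<Ztypecolon> P \<cdot> x"
  shows "\<Gamma> \<turnstile> transp A P x x (rfl A x) u \<doteq> u \<Ztypecolon> P \<cdot> x"
proof -
  have "\<Gamma> \<turnstile> Const cIndId \<cdot> A \<cdot> path_motive A (arr (P \<up> 3 \<cdot> V 2) (P \<up> 3 \<cdot> V 1)) \<cdot> Lam A (Lam (P \<up> 1 \<cdot> V 0) (V 0))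
     \<cdot> x \<cdot> x \<cdot> rfl A x \<doteq> Lam (P \<cdot> x) (V 0) \<Ztypecolon> arr (P \<cdot> x) (P \<cdot> x)"
    using ty_indId_open(3)[OF A transp_motive transp_base x refl] by (simp add: inst3_def)
  then show ?thesis unfolding transp_path_motive arr_def
    by (rule beta'[OF _ _ u]) (use ty_V0[OF ty_arrE[OF P x]] in simp_all)
qed

end

lemma inh_PiE: "inh \<Gamma> (Pi A B) \<Longrightarrow> \<Gamma> \<turnstile> a \<Ztypecolon> A \<Longrightarrow> T = inst B a \<Longrightarrow> inh \<Gamma> T"
  unfolding inh_def using ty_App by blast

text \<open>
  The family \<open>y \<mapsto> c = y\<close>. Transport in it is concatenation, which is why path operations are
  expressed by transport: the coherence condition of the colimit is stated with transport as well.
\<close>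

definition paths :: "tm \<Rightarrow> tm \<Rightarrow> tm" where
  "paths X c = Lam X (idT (X \<up> 1) (c \<up> 1) (V 0))"

definition copaths :: "tm \<Rightarrow> tm \<Rightarrow> tm" where
  "copaths X v = Lam X (idT (X \<up> 1) (V 0) (v \<up> 1))"

text \<open>
  From \<open>s : c = u\<close> and \<open>r : u = w\<close> the composite \<open>c = w\<close>.
\<close>

definition trans_path :: "tm \<Rightarrow> tm \<Rightarrow> tm \<Rightarrow> tm \<Rightarrow> tm \<Rightarrow> tm \<Rightarrow> tm" where
  "trans_path X c u w r s = transp X (paths X c) u w r s"

text \<open>
  From \<open>r : u = w\<close> and \<open>s : u = v\<close> the composite \<open>r\<inverse> \<cdot> s : w = v\<close>. For \<open>s\<close> reflexivity this is the inverse
  of \<open>r\<close>.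
\<close>

definition cancel_path :: "tm \<Rightarrow> tm \<Rightarrow> tm \<Rightarrow> tm \<Rightarrow> tm \<Rightarrow> tm \<Rightarrow> tm" where
  "cancel_path X v u w r s = transp X (copaths X v) u w r s"

definition inv_path :: "tm \<Rightarrow> tm \<Rightarrow> tm \<Rightarrow> tm \<Rightarrow> tm" where
  "inv_path X u w r = cancel_path X u u w r (rfl X u)"

lemma sub_paths [simp]:
  "sub r (paths X c) = paths (sub r X) (sub r c)"
  "sub r (copaths X c) = copaths (sub r X) (sub r c)"
  "sub r (trans_path X c u w p s) = trans_path (sub r X) (sub r c) (sub r u) (sub r w) (sub r p) (sub r s)"
  "sub r (cancel_path X c u w p s) = cancel_path (sub r X) (sub r c) (sub r u) (sub r w) (sub r p) (sub r s)"
  "sub r (inv_path X u w p) = inv_path (sub r X) (sub r u) (sub r w) (sub r p)"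
  by (simp_all add: paths_def copaths_def trans_path_def cancel_path_def inv_path_def)

lemmas ren_paths [simp] = sub_paths[of "V \<circ> r" for r, folded ren_eq_sub]

lemmas lift_paths [simp] = ren_paths[of "shift n" for n, unfolded ren_shift]

lemmas inst_paths [simp] = sub_paths[of "single a" for a, unfolded sub_single_inst]

context
  fixes \<Gamma> X i assumes X: "\<Gamma> \<turnstile> X \<Ztypecolon> U i"
begin

lemma ty_paths_open:
  assumes c: "\<Gamma> \<turnstile> c \<Ztypecolon> X"
  shows "X # \<Gamma> \<turnstile> idT (X \<up> 1) (c \<up> 1) (V 0) \<Ztypecolon> U i" "X # \<Gamma> \<turnstile> idT (X \<up> 1) (V 0) (c \<up> 1) \<Ztypecolon> U i"
  using ty_idT[OF path_ctx_prefix(2)[OF X]] weak(1)[OF path_ctx_prefix(1)[OF X] c] ty_V0[OF X] by blast+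

lemma ty_paths:
  assumes c: "\<Gamma> \<turnstile> c \<Ztypecolon> X"
  shows "\<Gamma> \<turnstile> paths X c \<Ztypecolon> arr X (U i)" "\<Gamma> \<turnstile> copaths X c \<Ztypecolon> arr X (U i)"
  unfolding paths_def copaths_def using ty_Lam_fam ty_paths_open[OF c] by blast+

lemma paths_beta:
  assumes c: "\<Gamma> \<turnstile> c \<Ztypecolon> X" and u: "\<Gamma> \<turnstile> u \<Ztypecolon> X"
  shows "\<Gamma> \<turnstile> paths X c \<cdot> u \<doteq> idT X c u \<Ztypecolon> U i" "\<Gamma> \<turnstile> copaths X c \<cdot> u \<doteq> idT X u c \<Ztypecolon> U i"
  unfolding paths_def copaths_def by (rule fam_beta ty_paths_open c u | simp)+

lemma ty_trans_path:
  assumes "\<Gamma> \<turnstile> c \<Ztypecolon> X" "\<Gamma> \<turnstile> u \<Ztypecolon> X" "\<Gamma> \<turnstile> w \<Ztypecolon> X" "\<Gamma> \<turnstile> r \<Ztypecolon> idT X u w" "\<Gamma> \<turnstile> s \<Ztypecolon> idT X c u"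
  shows "\<Gamma> \<turnstile> trans_path X c u w r s \<Ztypecolon> idT X c w"
  unfolding trans_path_def
  by (rule ty_conv[OF ty_transp[OF X ty_paths(1) _ _ _ ty_conv_sym[OF _ paths_beta(1)]] paths_beta(1)])
    (rule assms)+

lemma trans_path_rfl:
  assumes "\<Gamma> \<turnstile> c \<Ztypecolon> X" "\<Gamma> \<turnstile> u \<Ztypecolon> X" "\<Gamma> \<turnstile> s \<Ztypecolon> idT X c u"
  shows "\<Gamma> \<turnstile> trans_path X c u u (rfl X u) s \<doteq> s \<Ztypecolon> idT X c u"
  unfolding trans_path_def
  by (rule eq_conv[OF transp_rfl[OF X ty_paths(1) _ ty_conv_sym[OF _ paths_beta(1)]] paths_beta(1)])
    (rule assms)+

lemma trans_path_cong:
  assumes "\<Gamma> \<turnstile> c \<Ztypecolon> X" "\<Gamma> \<turnstile> u \<Ztypecolon> X" "\<Gamma> \<turnstile> w \<Ztypecolon> X"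
    "\<Gamma> \<turnstile> r \<doteq> r' \<Ztypecolon> idT X u w" "\<Gamma> \<turnstile> s \<doteq> s' \<Ztypecolon> idT X c u" "\<Gamma> \<turnstile> r \<Ztypecolon> idT X u w"
  shows "\<Gamma> \<turnstile> trans_path X c u w r s \<doteq> trans_path X c u w r' s' \<Ztypecolon> idT X c w"
  unfolding trans_path_def
  by (rule eq_conv[OF transp_cong[OF X ty_paths(1) _ _ _ eq_conv[OF _ eq_sym[OF paths_beta(1)]]] paths_beta(1)])
    (rule assms)+

lemma ty_cancel_path:
  assumes "\<Gamma> \<turnstile> v \<Ztypecolon> X" "\<Gamma> \<turnstile> u \<Ztypecolon> X" "\<Gamma> \<turnstile> w \<Ztypecolon> X" "\<Gamma> \<turnstile> r \<Ztypecolon> idT X u w" "\<Gamma> \<turnstile> s \<Ztypecolon> idT X u v"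
  shows "\<Gamma> \<turnstile> cancel_path X v u w r s \<Ztypecolon> idT X w v"
  unfolding cancel_path_def
  by (rule ty_conv[OF ty_transp[OF X ty_paths(2) _ _ _ ty_conv_sym[OF _ paths_beta(2)]] paths_beta(2)])
    (rule assms)+

lemma cancel_path_rfl:
  assumes "\<Gamma> \<turnstile> v \<Ztypecolon> X" "\<Gamma> \<turnstile> u \<Ztypecolon> X" "\<Gamma> \<turnstile> s \<Ztypecolon> idT X u v"
  shows "\<Gamma> \<turnstile> cancel_path X v u u (rfl X u) s \<doteq> s \<Ztypecolon> idT X u v"
  unfolding cancel_path_def
  by (rule eq_conv[OF transp_rfl[OF X ty_paths(2) _ ty_conv_sym[OF _ paths_beta(2)]] paths_beta(2)])
    (rule assms)+

lemma ty_inv_path: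
  assumes "\<Gamma> \<turnstile> u \<Ztypecolon> X" "\<Gamma> \<turnstile> w \<Ztypecolon> X" "\<Gamma> \<turnstile> r \<Ztypecolon> idT X u w"
  shows "\<Gamma> \<turnstile> inv_path X u w r \<Ztypecolon> idT X w u"
  unfolding inv_path_def using assms ty_cancel_path ty_rfl[OF X] by blast

lemma inv_path_rfl:
  assumes "\<Gamma> \<turnstile> u \<Ztypecolon> X"
  shows "\<Gamma> \<turnstile> inv_path X u u (rfl X u) \<doteq> rfl X u \<Ztypecolon> idT X u u"
  unfolding inv_path_def using assms cancel_path_rfl ty_rfl[OF X] by blast

lemma inh_sym:
  assumes "\<Gamma> \<turnstile> u \<Ztypecolon> X" "\<Gamma> \<turnstile> w \<Ztypecolon> X" "inh \<Gamma> (idT X u w)"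
  shows "inh \<Gamma> (idT X w u)"
  using assms ty_inv_path unfolding inh_def by blast

lemma inh_trans:
  assumes "\<Gamma> \<turnstile> u \<Ztypecolon> X" "\<Gamma> \<turnstile> v \<Ztypecolon> X" "\<Gamma> \<turnstile> w \<Ztypecolon> X" "inh \<Gamma> (idT X u v)" "inh \<Gamma> (idT X v w)"
  shows "inh \<Gamma> (idT X u w)"
  using assms ty_trans_path unfolding inh_def by blast

end

text \<open>
  \<open>r\<inverse> \<cdot> r\<close> is reflexivity. Both uses of this composite, the normalisation of weakly constant maps and
  the proof that a contractible type is a set, rest on this equation.
\<close>

lemma cancel_path_self:
  assumes X: "\<Gamma> \<turnstile> X \<Ztypecolon> U i" and "\<Gamma> \<turnstile> u \<Ztypecolon> X" "\<Gamma> \<turnstile> w \<Ztypecolon> X" "\<Gamma> \<turnstile> r \<Ztypecolon> idT X u w"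
  shows "inh \<Gamma> (idT (idT X w w) (cancel_path X w u w r r) (rfl X w))"
proof (rule path_induction[OF X _ _ assms(2-4), where C = "idT (idT (X \<up> 3) (V 1) (V 1))
    (cancel_path (X \<up> 3) (V 1) (V 2) (V 1) (V 0) (V 0)) (rfl (X \<up> 3) (V 1))"])
  have X3: "path_ctx X \<Gamma> \<turnstile> X \<up> 3 \<Ztypecolon> U i" by (rule path_ctx_weak[OF X X]) simp
  show "path_ctx X \<Gamma> \<turnstile> idT (idT (X \<up> 3) (V 1) (V 1))
    (cancel_path (X \<up> 3) (V 1) (V 2) (V 1) (V 0) (V 0)) (rfl (X \<up> 3) (V 1)) \<Ztypecolon> U i"
    by (rule ty_idT path_ctx_vars[OF X] X3 ty_rfl ty_cancel_path[OF X3])+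
  note X1 = path_ctx_prefix(2)[OF X]
  show "inh (X # \<Gamma>) (idT (idT (X \<up> 1) (V 0) (V 0))
      (cancel_path (X \<up> 1) (V 0) (V 0) (V 0) (rfl (X \<up> 1) (V 0)) (rfl (X \<up> 1) (V 0))) (rfl (X \<up> 1) (V 0)))"
    by (rule inh_idT_conv cancel_path_rfl X1 ty_V0[OF X] ty_idT ty_cancel_path ty_rfl)+
qed (simp_all add: inst3_def)

text \<open>
  Composing with \<open>r\<inverse>\<close> and then with \<open>r\<close> changes nothing. The path \<open>d\<close> ends at an endpoint of \<open>r\<close>, so it
  has to be generalised in the motive.
\<close>

lemma trans_path_inv:
  assumes X: "\<Gamma> \<turnstile> X \<Ztypecolon> U i" and c: "\<Gamma> \<turnstile> c \<Ztypecolon> X" and "\<Gamma> \<turnstile> u \<Ztypecolon> X" "\<Gamma> \<turnstile> w \<Ztypecolon> X" "\<Gamma> \<turnstile> r \<Ztypecolon> idT X u w"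
    and d: "\<Gamma> \<turnstile> d \<Ztypecolon> idT X c w"
  shows "inh \<Gamma> (idT (idT X c w) (trans_path X c u w r (trans_path X c w u (inv_path X u w r) d)) d)"
proof -
  let ?C = "Pi (idT (X \<up> 3) (c \<up> 3) (V 1))
    (idT (idT (X \<up> 4) (c \<up> 4) (V 2)) (trans_path (X \<up> 4) (c \<up> 4) (V 3) (V 2) (V 1)
      (trans_path (X \<up> 4) (c \<up> 4) (V 2) (V 3) (inv_path (X \<up> 4) (V 3) (V 2) (V 1)) (V 0))) (V 0))"
  have X3: "path_ctx X \<Gamma> \<turnstile> X \<up> 3 \<Ztypecolon> U i" by (rule path_ctx_weak[OF X X]) simp
  have c3: "path_ctx X \<Gamma> \<turnstile> c \<up> 3 \<Ztypecolon> X \<up> 3" by (rule path_ctx_weak[OF X c]) simp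
  note T = ty_idT[OF X3 c3 path_ctx_vars(2)[OF X]]
  note w4 = weak(1)[OF wf_Cons[OF T]]
  note f4 = w4[OF X3] w4[OF c3] w4[OF path_ctx_vars(1)[OF X]] w4[OF path_ctx_vars(2)[OF X]] w4[OF path_ctx_vars(3)[OF X]] ty_V0[OF T]
  have C: "path_ctx X \<Gamma> \<turnstile> ?C \<Ztypecolon> U i"
    by (rule ty_Pi[OF T], insert f4, simp)
      (intro ty_idT ty_trans_path ty_inv_path; assumption)
  note X1 = path_ctx_prefix(2)[OF X] and v0 = ty_V0[OF X]
  have c1: "X # \<Gamma> \<turnstile> c \<up> 1 \<Ztypecolon> X \<up> 1" using weak(1)[OF path_ctx_prefix(1)[OF X] c] .
  note S = ty_idT[OF X1 c1 v0]
  note w2 = weak(1)[OF wf_Cons[OF S]]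
  let ?\<Gamma> = "idT (X \<up> 1) (c \<up> 1) (V 0) # X # \<Gamma>"
  have X2: "?\<Gamma> \<turnstile> X \<up> 2 \<Ztypecolon> U i" and c2: "?\<Gamma> \<turnstile> c \<up> 2 \<Ztypecolon> X \<up> 2" and v1: "?\<Gamma> \<turnstile> V 1 \<Ztypecolon> X \<up> 2"
    and p: "?\<Gamma> \<turnstile> V 0 \<Ztypecolon> idT (X \<up> 2) (c \<up> 2) (V 1)"
    using w2[OF X1] w2[OF c1] w2[OF v0] ty_V0[OF S] by simp_all
  have "inh ?\<Gamma> (idT (idT (X \<up> 2) (c \<up> 2) (V 1))
     (trans_path (X \<up> 2) (c \<up> 2) (V 1) (V 1) (rfl (X \<up> 2) (V 1))
      (trans_path (X \<up> 2) (c \<up> 2) (V 1) (V 1) (inv_path (X \<up> 2) (V 1) (V 1) (rfl (X \<up> 2) (V 1))) (V 0))) (V 0))"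
  proof (rule inh_idT_conv)
    note r = ty_rfl[OF X2 v1] and ir = inv_path_rfl[OF X2 v1]
    note ti = ty_inv_path[OF X2 v1 v1 r]
    show "?\<Gamma> \<turnstile> trans_path (X \<up> 2) (c \<up> 2) (V 1) (V 1) (rfl (X \<up> 2) (V 1))
      (trans_path (X \<up> 2) (c \<up> 2) (V 1) (V 1) (inv_path (X \<up> 2) (V 1) (V 1) (rfl (X \<up> 2) (V 1))) (V 0)) \<doteq> V 0
      \<Ztypecolon> idT (X \<up> 2) (c \<up> 2) (V 1)"
      by (rule eq_trans[OF trans_path_rfl[OF X2 c2 v1 ty_trans_path[OF X2 c2 v1 v1 ti p]]
         eq_trans[OF trans_path_cong[OF X2 c2 v1 v1 ir eq_refl[OF p] ti] trans_path_rfl[OF X2 c2 v1 p]]])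
    show "?\<Gamma> \<turnstile> trans_path (X \<up> 2) (c \<up> 2) (V 1) (V 1) (rfl (X \<up> 2) (V 1))
      (trans_path (X \<up> 2) (c \<up> 2) (V 1) (V 1) (inv_path (X \<up> 2) (V 1) (V 1) (rfl (X \<up> 2) (V 1))) (V 0))
      \<Ztypecolon> idT (X \<up> 2) (c \<up> 2) (V 1)"
      by (rule ty_trans_path[OF X2 c2 v1 v1 r ty_trans_path[OF X2 c2 v1 v1 ti p]])
  qed (rule ty_idT[OF X2 c2 v1])
  then have J: "inh \<Gamma> (inst3 ?C u w r)"
    by (intro path_induction[OF X C inh_Pi assms(3-5) _ refl]) (simp_all add: inst3_def)
  show ?thesis
    by (rule inh_PiE[OF J[simplified inst3_def, simplified] d]) simp
qed

lemma inh_cong_fun: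
  assumes B: "\<Gamma> \<turnstile> B \<Ztypecolon> U i" and C: "\<Gamma> \<turnstile> C \<Ztypecolon> U j" and f: "\<Gamma> \<turnstile> f \<Ztypecolon> arr B C"
    and "\<Gamma> \<turnstile> x \<Ztypecolon> B" "\<Gamma> \<turnstile> y \<Ztypecolon> B" and p: "inh \<Gamma> (idT B x y)"
  shows "inh \<Gamma> (idT C (f \<cdot> x) (f \<cdot> y))"
proof -
  from p obtain p where p: "\<Gamma> \<turnstile> p \<Ztypecolon> idT B x y" unfolding inh_def by blast
  show ?thesis
  proof (rule path_induction[OF B _ _ assms(4,5) p, where C = "idT (C \<up> 3) (f \<up> 3 \<cdot> V 2) (f \<up> 3 \<cdot> V 1)"])
    have C3: "path_ctx B \<Gamma> \<turnstile> C \<up> 3 \<Ztypecolon> U j" by (rule path_ctx_weak[OF B C]) simp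
    have f3: "path_ctx B \<Gamma> \<turnstile> f \<up> 3 \<Ztypecolon> arr (B \<up> 3) (C \<up> 3)" by (rule path_ctx_weak[OF B f]) simp
    show "path_ctx B \<Gamma> \<turnstile> idT (C \<up> 3) (f \<up> 3 \<cdot> V 2) (f \<up> 3 \<cdot> V 1) \<Ztypecolon> U j"
      by (intro ty_idT C3 ty_arrE[OF f3] path_ctx_vars[OF B])
    have f1: "B # \<Gamma> \<turnstile> f \<up> 1 \<Ztypecolon> arr (B \<up> 1) (C \<up> 1)" using weak(1)[OF path_ctx_prefix(1)[OF B] f] by simp
    show "inh (B # \<Gamma>) (idT (C \<up> 1) (f \<up> 1 \<cdot> V 0) (f \<up> 1 \<cdot> V 0))"
      by (rule inhI[OF ty_rfl[OF weakU[OF C path_ctx_prefix(1)[OF B]] ty_arrE[OF f1 ty_V0[OF B]]]])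
  qed (simp_all add: inst3_def)
qed

text \<open>
  Congruence for an open term, obtained from the version for functions by beta conversion.
\<close>

lemma inh_cong:
  assumes B: "\<Gamma> \<turnstile> B \<Ztypecolon> U i" and C: "\<Gamma> \<turnstile> C \<Ztypecolon> U j" and t: "B # \<Gamma> \<turnstile> t \<Ztypecolon> C \<up> 1"
    and x: "\<Gamma> \<turnstile> x \<Ztypecolon> B" and y: "\<Gamma> \<turnstile> y \<Ztypecolon> B" and p: "inh \<Gamma> (idT B x y)"
    and T: "T = idT C (inst t x) (inst t y)"
  shows "inh \<Gamma> T"
proof -
  have f: "\<Gamma> \<turnstile> Lam B t \<Ztypecolon> Pi B (C \<up> 1)" by (rule ty_Lam[OF t])
  have *: "\<Gamma> \<turnstile> Lam B t \<cdot> a \<doteq> inst t a \<Ztypecolon> C" if "\<Gamma> \<turnstile> a \<Ztypecolon> B" for a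
    using beta[OF t that] by simp
  show ?thesis unfolding T
    by (rule inh_conv[OF inh_cong_fun[OF B C f[folded arr_def] x y p] idT_cong[OF C *[OF x] *[OF y]]])
qed

text \<open>
  Transport along a loop that is merely equal, not judgmentally equal, to reflexivity.
\<close>

lemma transp_loop:
  assumes A: "\<Gamma> \<turnstile> A \<Ztypecolon> U i" and P: "\<Gamma> \<turnstile> P \<Ztypecolon> arr A (U j)" and u: "\<Gamma> \<turnstile> u \<Ztypecolon> A"
    and r: "\<Gamma> \<turnstile> r \<Ztypecolon> idT A u u" and s: "inh \<Gamma> (idT (idT A u u) r (rfl A u))"
    and w: "\<Gamma> \<turnstile> w \<Ztypecolon> P \<cdot> u"
  shows "inh \<Gamma> (idT (P \<cdot> u) (transp A P u u r w) w)"
proof -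
  note I = ty_idT[OF A u u]
  note w1 = weak(1)[OF wf_Cons[OF I]]
  have "idT A u u # \<Gamma> \<turnstile> transp (A \<up> 1) (P \<up> 1) (u \<up> 1) (u \<up> 1) (V 0) (w \<up> 1) \<Ztypecolon> P \<up> 1 \<cdot> u \<up> 1"
    by (rule ty_transp[where i=i and j=j]) (use w1[OF A] w1[OF P] w1[OF u] w1[OF w] ty_V0[OF I] in simp_all)
  then have "inh \<Gamma> (idT (P \<cdot> u) (transp A P u u r w) (transp A P u u (rfl A u) w))"
    by (intro inh_cong[OF I ty_arrE[OF P u] _ r ty_rfl[OF A u] s,
        where t = "transp (A \<up> 1) (P \<up> 1) (u \<up> 1) (u \<up> 1) (V 0) (w \<up> 1)"]) simp_all
  moreover note tr = transp_rfl[OF A P u w]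
  ultimately show ?thesis
    using inh_conv[OF _ idT_cong[OF ty_arrE[OF P u] eq_refl tr]] ty_transp[OF A P u u r w] by blast
qed

section \<open>Moving paths along a weakly constant sequence\<close>

text \<open>
  \<open>\<Pi>(n : N). \<Pi>(a b : F n). f n a = f n b\<close>: all maps of the sequence are weakly constant.
\<close>

definition wconst :: "tm \<Rightarrow> tm \<Rightarrow> tm" where
  "wconst F f = Pi natT (Pi (F \<up> 1 \<cdot> V 0) (Pi (F \<up> 2 \<cdot> V 1)
     (idT (F \<up> 3 \<cdot> succ (V 2)) (f \<up> 3 \<cdot> V 2 \<cdot> V 1) (f \<up> 3 \<cdot> V 2 \<cdot> V 0))))"

text \<open>
  All paths considered start at the fixed point \<open>c\<close> of the colimit, so that they can be carried around
  by transport in their other endpoint.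
\<close>

definition wseq :: "tm list \<Rightarrow> nat \<Rightarrow> tm \<Rightarrow> tm \<Rightarrow> tm \<Rightarrow> tm \<Rightarrow> bool" where
  "wseq \<Gamma> i F f e c \<longleftrightarrow> \<Gamma> \<turnstile> F \<Ztypecolon> arr natT (U i) \<and> \<Gamma> \<turnstile> f \<Ztypecolon> seqmaps F \<and> \<Gamma> \<turnstile> e \<Ztypecolon> wconst F f
     \<and> \<Gamma> \<turnstile> c \<Ztypecolon> colim F f"

text \<open>
  The path \<open>e a a\<inverse> \<cdot> e a b : f a = f b\<close>, chosen such that it is reflexivity for \<open>b = a\<close>.
\<close>

definition enorm :: "tm \<Rightarrow> tm \<Rightarrow> tm \<Rightarrow> tm \<Rightarrow> tm \<Rightarrow> tm \<Rightarrow> tm" where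
  "enorm F f e n a b = cancel_path (F \<cdot> succ n) (f \<cdot> n \<cdot> b) (f \<cdot> n \<cdot> a) (f \<cdot> n \<cdot> a) (e \<cdot> n \<cdot> a \<cdot> a) (e \<cdot> n \<cdot> a \<cdot> b)"

text \<open>
  The family \<open>z \<mapsto> (c = i m z)\<close> over level \<open>m\<close>.
\<close>

definition lvl :: "tm \<Rightarrow> tm \<Rightarrow> tm \<Rightarrow> tm \<Rightarrow> tm" where
  "lvl F f c m = Lam (F \<cdot> m) (idT (colim (F \<up> 1) (f \<up> 1)) (c \<up> 1) (cin (F \<up> 1) (f \<up> 1) (m \<up> 1) (V 0)))"

definition tlv :: "tm \<Rightarrow> tm \<Rightarrow> tm \<Rightarrow> tm \<Rightarrow> tm \<Rightarrow> tm \<Rightarrow> tm \<Rightarrow> tm \<Rightarrow> tm" where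
  "tlv F f c m u v q d = transp (F \<cdot> m) (lvl F f c m) u v q d"

text \<open>
  Paths from \<open>c\<close> are carried along the glue path of \<open>a\<close>, from \<open>i (n+1) (f a)\<close> to \<open>i n a\<close> and back.
\<close>

definition fwd :: "tm \<Rightarrow> tm \<Rightarrow> tm \<Rightarrow> tm \<Rightarrow> tm \<Rightarrow> tm \<Rightarrow> tm" where
  "fwd F f c n a d = trans_path (colim F f) c (cin F f (succ n) (f \<cdot> n \<cdot> a)) (cin F f n a) (glue F f n a) d"

definition bwd :: "tm \<Rightarrow> tm \<Rightarrow> tm \<Rightarrow> tm \<Rightarrow> tm \<Rightarrow> tm \<Rightarrow> tm" where
  "bwd F f c n a d = trans_path (colim F f) c (cin F f n a) (cin F f (succ n) (f \<cdot> n \<cdot> a))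
     (inv_path (colim F f) (cin F f (succ n) (f \<cdot> n \<cdot> a)) (cin F f n a) (glue F f n a)) d"

text \<open>
  From \<open>d : c = i n a\<close> a path \<open>c = i n b\<close>, by a detour through level \<open>n+1\<close>, where \<open>f a = f b\<close>.
\<close>

definition move :: "tm \<Rightarrow> tm \<Rightarrow> tm \<Rightarrow> tm \<Rightarrow> tm \<Rightarrow> tm \<Rightarrow> tm \<Rightarrow> tm \<Rightarrow> tm" where
  "move F f e c n a b d = fwd F f c n b
     (tlv F f c (succ n) (f \<cdot> n \<cdot> a) (f \<cdot> n \<cdot> b) (enorm F f e n a b) (bwd F f c n a d))"

lemma sub_wseq [simp]:
  "sub r (wconst F f) = wconst (sub r F) (sub r f)"
  "sub r (enorm F f e n a b) = enorm (sub r F) (sub r f) (sub r e) (sub r n) (sub r a) (sub r b)"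
  "sub r (lvl F f c n) = lvl (sub r F) (sub r f) (sub r c) (sub r n)"
  "sub r (tlv F f c n u v q d) = tlv (sub r F) (sub r f) (sub r c) (sub r n) (sub r u) (sub r v) (sub r q) (sub r d)"
  "sub r (fwd F f c n a d) = fwd (sub r F) (sub r f) (sub r c) (sub r n) (sub r a) (sub r d)"
  "sub r (bwd F f c n a d) = bwd (sub r F) (sub r f) (sub r c) (sub r n) (sub r a) (sub r d)"
  "sub r (move F f e c n a b d) = move (sub r F) (sub r f) (sub r e) (sub r c) (sub r n) (sub r a) (sub r b) (sub r d)"
  by (simp_all add: wconst_def enorm_def lvl_def tlv_def fwd_def bwd_def move_def)

lemmas ren_wseq [simp] = sub_wseq[of "V \<circ> r" for r, folded ren_eq_sub]

lemmas lift_wseq [simp] = ren_wseq[of "shift n" for n, unfolded ren_shift]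

lemmas inst_wseq [simp] = sub_wseq[of "single a" for a, unfolded sub_single_inst]

lemma wseq_weak: "wseq \<Gamma> i F f e c \<Longrightarrow> wf (B # \<Gamma>) \<Longrightarrow> wseq (B # \<Gamma>) i (F \<up> 1) (f \<up> 1) (e \<up> 1) (c \<up> 1)"
  unfolding wseq_def using weak(1)[of B \<Gamma> F "arr natT (U i)"] weak(1)[of B \<Gamma> f "seqmaps F"]
    weak(1)[of B \<Gamma> e "wconst F f"] weak(1)[of B \<Gamma> c "colim F f"] by simp

lemma wseq_weak_path_ctx:
  assumes "wseq \<Gamma> i F f e c" "\<Gamma> \<turnstile> A \<Ztypecolon> U k"
  shows "wseq (path_ctx A \<Gamma>) i (F \<up> 3) (f \<up> 3) (e \<up> 3) (c \<up> 3)"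
  using wseq_weak[OF wseq_weak[OF wseq_weak[OF assms(1) path_ctx_prefix(1)[OF assms(2)]] path_ctx_prefix(3)[OF assms(2)]]
      wf_path_ctx[OF assms(2), unfolded path_ctx_def]] by (simp add: path_ctx_def)

context
  fixes \<Gamma> i F f e c
  assumes ctx_stable: "wseq \<Gamma> i F f e c"
begin

lemma wseqD:
  shows "\<Gamma> \<turnstile> F \<Ztypecolon> arr natT (U i)" "\<Gamma> \<turnstile> f \<Ztypecolon> seqmaps F" "\<Gamma> \<turnstile> e \<Ztypecolon> wconst F f" "\<Gamma> \<turnstile> c \<Ztypecolon> colim F f"
    "\<Gamma> \<turnstile> colim F f \<Ztypecolon> U i" "wf \<Gamma>"
  using ctx_stable ty_colim typed_wf(1) unfolding wseq_def by blast+

lemma wseq_ty: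
  assumes n: "\<Gamma> \<turnstile> n \<Ztypecolon> natT"
  shows "\<Gamma> \<turnstile> F \<cdot> n \<Ztypecolon> U i" "\<Gamma> \<turnstile> succ n \<Ztypecolon> natT"
    "\<Gamma> \<turnstile> a \<Ztypecolon> F \<cdot> n \<Longrightarrow> \<Gamma> \<turnstile> f \<cdot> n \<cdot> a \<Ztypecolon> F \<cdot> succ n"
    "\<Gamma> \<turnstile> a \<Ztypecolon> F \<cdot> n \<Longrightarrow> \<Gamma> \<turnstile> cin F f n a \<Ztypecolon> colim F f"
    "\<Gamma> \<turnstile> a \<Ztypecolon> F \<cdot> n \<Longrightarrow> \<Gamma> \<turnstile> idT (colim F f) c (cin F f n a) \<Ztypecolon> U i"
    "\<Gamma> \<turnstile> a \<Ztypecolon> F \<cdot> n \<Longrightarrow> \<Gamma> \<turnstile> glue F f n a \<Ztypecolon> idT (colim F f) (cin F f (succ n) (f \<cdot> n \<cdot> a)) (cin F f n a)"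
  using ty_arrE[OF wseqD(1) n] ty_succ[OF n] ty_seqmap[OF wseqD(2) n] ty_cin[OF wseqD(1,2) n]
    ty_idT[OF wseqD(5,4)] ty_glue[OF wseqD(1,2) n] by blast+

lemma ty_e:
  assumes "\<Gamma> \<turnstile> n \<Ztypecolon> natT" "\<Gamma> \<turnstile> a \<Ztypecolon> F \<cdot> n" "\<Gamma> \<turnstile> b \<Ztypecolon> F \<cdot> n"
  shows "\<Gamma> \<turnstile> e \<cdot> n \<cdot> a \<cdot> b \<Ztypecolon> idT (F \<cdot> succ n) (f \<cdot> n \<cdot> a) (f \<cdot> n \<cdot> b)"
proof -
  have "\<Gamma> \<turnstile> e \<cdot> n \<Ztypecolon> Pi (F \<cdot> n) (Pi (F \<up> 1 \<cdot> n \<up> 1)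
     (idT (F \<up> 2 \<cdot> succ (n \<up> 2)) (f \<up> 2 \<cdot> n \<up> 2 \<cdot> V 1) (f \<up> 2 \<cdot> n \<up> 2 \<cdot> V 0)))"
    by (rule ty_AppE[OF wseqD(3)[unfolded wconst_def] assms(1)]) simp
  then have "\<Gamma> \<turnstile> e \<cdot> n \<cdot> a \<Ztypecolon> Pi (F \<cdot> n)
     (idT (F \<up> 1 \<cdot> succ (n \<up> 1)) (f \<up> 1 \<cdot> n \<up> 1 \<cdot> a \<up> 1) (f \<up> 1 \<cdot> n \<up> 1 \<cdot> V 0))"
    by (rule ty_AppE[OF _ assms(2)]) simp
  then show ?thesis by (rule ty_AppE[OF _ assms(3)]) simp
qed

context
  fixes n assumes n: "\<Gamma> \<turnstile> n \<Ztypecolon> natT"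
begin

private lemmas at_n = wseq_ty[OF n]

private lemmas at_succ = wseq_ty[OF at_n(2)]

private lemmas ty_X = wseqD(5) and ty_c = wseqD(4)

lemma ty_enorm:
  assumes "\<Gamma> \<turnstile> a \<Ztypecolon> F \<cdot> n" "\<Gamma> \<turnstile> b \<Ztypecolon> F \<cdot> n"
  shows "\<Gamma> \<turnstile> enorm F f e n a b \<Ztypecolon> idT (F \<cdot> succ n) (f \<cdot> n \<cdot> a) (f \<cdot> n \<cdot> b)"
  unfolding enorm_def by (rule ty_cancel_path[OF at_succ(1)] at_n ty_e n assms)+

lemma enorm_refl:
  assumes a: "\<Gamma> \<turnstile> a \<Ztypecolon> F \<cdot> n"
  shows "inh \<Gamma> (idT (idT (F \<cdot> succ n) (f \<cdot> n \<cdot> a) (f \<cdot> n \<cdot> a)) (enorm F f e n a a) (rfl (F \<cdot> succ n) (f \<cdot> n \<cdot> a)))"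
  unfolding enorm_def by (rule cancel_path_self[OF at_succ(1)] at_n ty_e n assms)+

lemma lvl_open:
  shows "F \<cdot> n # \<Gamma> \<turnstile> idT (colim (F \<up> 1) (f \<up> 1)) (c \<up> 1) (cin (F \<up> 1) (f \<up> 1) (n \<up> 1) (V 0)) \<Ztypecolon> U i"
proof -
  note wk = weak(1)[OF wf_Cons[OF at_n(1)]]
  show ?thesis
    by (rule ty_idT[OF _ _ ty_cin[where i = i]]) (use wk[OF ty_X] wk[OF ty_c] wk[OF wseqD(1)] wk[OF wseqD(2)] wk[OF n] ty_V0[OF at_n(1)] in simp_all)
qed

lemma ty_lvl: "\<Gamma> \<turnstile> lvl F f c n \<Ztypecolon> arr (F \<cdot> n) (U i)"
  unfolding lvl_def by (rule ty_Lam_fam[OF lvl_open])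

lemma lvl_beta:
  "\<Gamma> \<turnstile> a \<Ztypecolon> F \<cdot> n \<Longrightarrow> \<Gamma> \<turnstile> lvl F f c n \<cdot> a \<doteq> idT (colim F f) c (cin F f n a) \<Ztypecolon> U i"
  unfolding lvl_def by (rule fam_beta[OF lvl_open]) simp_all

lemma ty_tlv:
  assumes "\<Gamma> \<turnstile> u \<Ztypecolon> F \<cdot> n" "\<Gamma> \<turnstile> v \<Ztypecolon> F \<cdot> n" "\<Gamma> \<turnstile> q \<Ztypecolon> idT (F \<cdot> n) u v"
    "\<Gamma> \<turnstile> d \<Ztypecolon> idT (colim F f) c (cin F f n u)"
  shows "\<Gamma> \<turnstile> tlv F f c n u v q d \<Ztypecolon> idT (colim F f) c (cin F f n v)"
  unfolding tlv_def
  by (rule ty_conv[OF ty_transp[OF at_n(1) ty_lvl _ _ _ ty_conv_sym[OF _ lvl_beta]] lvl_beta]) (rule assms)+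

lemma tlv_rfl:
  assumes "\<Gamma> \<turnstile> u \<Ztypecolon> F \<cdot> n" "\<Gamma> \<turnstile> d \<Ztypecolon> idT (colim F f) c (cin F f n u)"
  shows "\<Gamma> \<turnstile> tlv F f c n u u (rfl (F \<cdot> n) u) d \<doteq> d \<Ztypecolon> idT (colim F f) c (cin F f n u)"
  unfolding tlv_def
  by (rule eq_conv[OF transp_rfl[OF at_n(1) ty_lvl _ ty_conv_sym[OF _ lvl_beta]] lvl_beta]) (rule assms)+

lemma tlv_loop:
  assumes "\<Gamma> \<turnstile> u \<Ztypecolon> F \<cdot> n" "\<Gamma> \<turnstile> r \<Ztypecolon> idT (F \<cdot> n) u u" "inh \<Gamma> (idT (idT (F \<cdot> n) u u) r (rfl (F \<cdot> n) u))"
    "\<Gamma> \<turnstile> d \<Ztypecolon> idT (colim F f) c (cin F f n u)"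
  shows "inh \<Gamma> (idT (idT (colim F f) c (cin F f n u)) (tlv F f c n u u r d) d)"
proof -
  note d = ty_conv_sym[OF assms(4) lvl_beta[OF assms(1)]]
  note t = transp_loop[OF at_n(1) ty_lvl assms(1-3) d]
  show ?thesis
    by (rule inh_conv[OF t[folded tlv_def] idT_cong_ty[OF lvl_beta[OF assms(1)]]])
      (use d ty_transp[OF at_n(1) ty_lvl assms(1,1,2) d, folded tlv_def] eq_refl in blast)+
qed

lemma ty_fwd:
  "\<Gamma> \<turnstile> a \<Ztypecolon> F \<cdot> n \<Longrightarrow> \<Gamma> \<turnstile> d \<Ztypecolon> idT (colim F f) c (cin F f (succ n) (f \<cdot> n \<cdot> a)) \<Longrightarrow>
    \<Gamma> \<turnstile> fwd F f c n a d \<Ztypecolon> idT (colim F f) c (cin F f n a)"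
  unfolding fwd_def by (rule ty_trans_path[OF ty_X ty_c] at_succ at_n | assumption)+

lemma ty_bwd:
  "\<Gamma> \<turnstile> a \<Ztypecolon> F \<cdot> n \<Longrightarrow> \<Gamma> \<turnstile> d \<Ztypecolon> idT (colim F f) c (cin F f n a) \<Longrightarrow>
    \<Gamma> \<turnstile> bwd F f c n a d \<Ztypecolon> idT (colim F f) c (cin F f (succ n) (f \<cdot> n \<cdot> a))"
  unfolding bwd_def by (rule ty_trans_path[OF ty_X ty_c] ty_inv_path[OF ty_X] at_succ at_n | assumption)+

lemma fwd_bwd:
  "\<Gamma> \<turnstile> a \<Ztypecolon> F \<cdot> n \<Longrightarrow> \<Gamma> \<turnstile> d \<Ztypecolon> idT (colim F f) c (cin F f n a) \<Longrightarrow>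
    inh \<Gamma> (idT (idT (colim F f) c (cin F f n a)) (fwd F f c n a (bwd F f c n a d)) d)"
  unfolding bwd_def fwd_def by (rule trans_path_inv[OF ty_X ty_c] at_succ at_n | assumption)+

lemma fwd_cong:
  assumes a: "\<Gamma> \<turnstile> a \<Ztypecolon> F \<cdot> n" and d: "\<Gamma> \<turnstile> d \<Ztypecolon> idT (colim F f) c (cin F f (succ n) (f \<cdot> n \<cdot> a))"
    and d': "\<Gamma> \<turnstile> d' \<Ztypecolon> idT (colim F f) c (cin F f (succ n) (f \<cdot> n \<cdot> a))"
    and p: "inh \<Gamma> (idT (idT (colim F f) c (cin F f (succ n) (f \<cdot> n \<cdot> a))) d d')"
  shows "inh \<Gamma> (idT (idT (colim F f) c (cin F f n a)) (fwd F f c n a d) (fwd F f c n a d'))"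
proof -
  let ?B = "idT (colim F f) c (cin F f (succ n) (f \<cdot> n \<cdot> a))"
  note B = at_succ(5)[OF at_n(3)[OF a]]
  note wk = weak(1)[OF wf_Cons[OF B]]
  have "?B # \<Gamma> \<turnstile> fwd (F \<up> 1) (f \<up> 1) (c \<up> 1) (n \<up> 1) (a \<up> 1) (V 0) \<Ztypecolon> idT (colim F f) c (cin F f n a) \<up> 1"
    unfolding fwd_def
    using ty_trans_path[OF wk[OF ty_X, simplified]] wk[OF ty_c] wk[OF at_succ(4)[OF at_n(3)[OF a]]] wk[OF at_n(4)[OF a]]
      wk[OF at_n(6)[OF a]] ty_V0[OF B] by simp
  from inh_cong[OF B at_n(5)[OF a] this d d' p] show ?thesis by simp
qed

end

lemma ty_move:
  assumes n: "\<Gamma> \<turnstile> n \<Ztypecolon> natT"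
    and "\<Gamma> \<turnstile> a \<Ztypecolon> F \<cdot> n" "\<Gamma> \<turnstile> b \<Ztypecolon> F \<cdot> n" "\<Gamma> \<turnstile> d \<Ztypecolon> idT (colim F f) c (cin F f n a)"
  shows "\<Gamma> \<turnstile> move F f e c n a b d \<Ztypecolon> idT (colim F f) c (cin F f n b)"
  unfolding move_def
  by (rule ty_fwd ty_tlv ty_enorm ty_bwd wseq_ty assms)+

text \<open>
  For \<open>b = a\<close> the detour crosses a loop equal to reflexivity, and what remains is to go back and
  forth along the same glue path.
\<close>

lemma move_refl:
  assumes n: "\<Gamma> \<turnstile> n \<Ztypecolon> natT"
    and a: "\<Gamma> \<turnstile> a \<Ztypecolon> F \<cdot> n" and d: "\<Gamma> \<turnstile> d \<Ztypecolon> idT (colim F f) c (cin F f n a)"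
  shows "inh \<Gamma> (idT (idT (colim F f) c (cin F f n a)) (move F f e c n a a d) d)"
proof -
  note t = wseq_ty(5)[OF n a] ty_bwd[OF n a d] wseq_ty(2)[OF n] wseq_ty(3)[OF n a]
    ty_enorm[OF n a a] 
  note t2 = ty_tlv[OF t(3,4,4,5,2)]
  show ?thesis
    by (rule inh_trans[OF t(1) _ _ d _ fwd_bwd[OF n a d]])
     (unfold move_def, (rule fwd_cong ty_fwd tlv_loop enorm_refl n a t t2 inh_trans)+)
qed

end

text \<open>
  \<open>move\<close> does not depend on a path between \<open>u\<close> and \<open>v\<close>, yet it agrees with transport along every such
  path: by path induction this reduces to \<open>move_refl\<close>. The path \<open>d\<close> is generalised because its type
  depends on \<open>u\<close>.
\<close>

lemma move_natural:
  assumes ctx_stable: "wseq \<Gamma> i F f e c" and n: "\<Gamma> \<turnstile> n \<Ztypecolon> natT"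
    and u: "\<Gamma> \<turnstile> u \<Ztypecolon> F \<cdot> n" and v: "\<Gamma> \<turnstile> v \<Ztypecolon> F \<cdot> n" and q: "\<Gamma> \<turnstile> q \<Ztypecolon> idT (F \<cdot> n) u v"
    and d: "\<Gamma> \<turnstile> d \<Ztypecolon> idT (colim F f) c (cin F f n u)"
  shows "inh \<Gamma> (idT (idT (colim F f) c (cin F f n v)) (move F f e c n u v d) (tlv F f c n u v q d))"
proof -
  let ?C = "Pi (idT (colim (F \<up> 3) (f \<up> 3)) (c \<up> 3) (cin (F \<up> 3) (f \<up> 3) (n \<up> 3) (V 2)))
    (idT (idT (colim (F \<up> 4) (f \<up> 4)) (c \<up> 4) (cin (F \<up> 4) (f \<up> 4) (n \<up> 4) (V 2)))
      (move (F \<up> 4) (f \<up> 4) (e \<up> 4) (c \<up> 4) (n \<up> 4) (V 3) (V 2) (V 0))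
      (tlv (F \<up> 4) (f \<up> 4) (c \<up> 4) (n \<up> 4) (V 3) (V 2) (V 1) (V 0)))"
  note A = wseq_ty(1)[OF ctx_stable n]
  have C: "path_ctx (F \<cdot> n) \<Gamma> \<turnstile> ?C \<Ztypecolon> U i"
  proof (rule ty_Pi)
    note W3 = wseq_weak_path_ctx[OF ctx_stable A]
    have n3: "path_ctx (F \<cdot> n) \<Gamma> \<turnstile> n \<up> 3 \<Ztypecolon> natT" by (rule path_ctx_weak[OF A n]) simp
    note J = path_ctx_vars[OF A, unfolded lift_simps]
    show T: "path_ctx (F \<cdot> n) \<Gamma> \<turnstile> idT (colim (F \<up> 3) (f \<up> 3)) (c \<up> 3) (cin (F \<up> 3) (f \<up> 3) (n \<up> 3) (V 2)) \<Ztypecolon> U i"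
      by (rule wseq_ty(5)[OF W3 n3 J(1)])
    note wk = weak(1)[OF wf_Cons[OF T]]
    note W4 = wseq_weak[OF W3 wf_Cons[OF T], simplified]
    note f4 = wk[OF n3, simplified] wk[OF J(1), simplified] wk[OF J(2), simplified] wk[OF J(3), simplified] 
      ty_V0[OF T, simplified]
    show "idT (colim (F \<up> 3) (f \<up> 3)) (c \<up> 3) (cin (F \<up> 3) (f \<up> 3) (n \<up> 3) (V 2)) # path_ctx (F \<cdot> n) \<Gamma> \<turnstile>
      idT (idT (colim (F \<up> 4) (f \<up> 4)) (c \<up> 4) (cin (F \<up> 4) (f \<up> 4) (n \<up> 4) (V 2)))
      (move (F \<up> 4) (f \<up> 4) (e \<up> 4) (c \<up> 4) (n \<up> 4) (V 3) (V 2) (V 0))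
      (tlv (F \<up> 4) (f \<up> 4) (c \<up> 4) (n \<up> 4) (V 3) (V 2) (V 1) (V 0)) \<Ztypecolon> U i"
      unfolding numeral_norm One_nat_def
      by (rule wseq_ty(5)[OF W4] ty_move[OF W4] ty_tlv[OF W4] f4 ty_idT)+
  qed
  let ?A = "F \<cdot> n"
  note W1 = wseq_weak[OF ctx_stable path_ctx_prefix(1)[OF A]]
  have n1: "?A # \<Gamma> \<turnstile> n \<up> 1 \<Ztypecolon> natT" using weak(1)[OF path_ctx_prefix(1)[OF A] n] by simp
  have v0: "?A # \<Gamma> \<turnstile> V 0 \<Ztypecolon> F \<up> 1 \<cdot> n \<up> 1" using ty_V0[OF A] by simp
  let ?S = "idT (colim (F \<up> 1) (f \<up> 1)) (c \<up> 1) (cin (F \<up> 1) (f \<up> 1) (n \<up> 1) (V 0))"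
  let ?\<Gamma> = "?S # ?A # \<Gamma>"
  have S: "?A # \<Gamma> \<turnstile> ?S \<Ztypecolon> U i" by (rule wseq_ty(5)[OF W1 n1 v0])
  have W2: "wseq ?\<Gamma> i (F \<up> 2) (f \<up> 2) (e \<up> 2) (c \<up> 2)" using wseq_weak[OF W1 wf_Cons[OF S]] by simp
  have n2: "?\<Gamma> \<turnstile> n \<up> 2 \<Ztypecolon> natT" using weak(1)[OF wf_Cons[OF S] n1] by simp
  have v1: "?\<Gamma> \<turnstile> V 1 \<Ztypecolon> F \<up> 2 \<cdot> n \<up> 2" using weak(1)[OF wf_Cons[OF S] v0] by simp
  have d2: "?\<Gamma> \<turnstile> V 0 \<Ztypecolon> idT (colim (F \<up> 2) (f \<up> 2)) (c \<up> 2) (cin (F \<up> 2) (f \<up> 2) (n \<up> 2) (V 1))"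
    using ty_V0[OF S] by simp
  \<comment> \<open>the diagonal: both sides equal the given path, the right one judgmentally\<close>
  have "inh ?\<Gamma> (idT (idT (colim (F \<up> 2) (f \<up> 2)) (c \<up> 2) (cin (F \<up> 2) (f \<up> 2) (n \<up> 2) (V 1)))
      (move (F \<up> 2) (f \<up> 2) (e \<up> 2) (c \<up> 2) (n \<up> 2) (V 1) (V 1) (V 0))
      (tlv (F \<up> 2) (f \<up> 2) (c \<up> 2) (n \<up> 2) (V 1) (V 1) (rfl (F \<up> 2 \<cdot> n \<up> 2) (V 1)) (V 0)))"
    by (rule inh_conv[OF move_refl[OF W2 n2 v1 d2] idT_cong[OF wseq_ty(5)[OF W2 n2 v1]
          eq_refl[OF ty_move[OF W2 n2 v1 v1 d2]] eq_sym[OF tlv_rfl[OF W2 n2 v1 d2]]]])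
  then have J: "inh \<Gamma> (inst3 ?C u v q)"
    by (intro path_induction[OF A C inh_Pi u v q _ refl]) (simp_all add: inst3_def)
  show ?thesis
    by (rule inh_PiE[OF J[simplified inst3_def, simplified] d]) simp
qed

text \<open>
  The coherence condition in disguise. By naturality at level \<open>n+1\<close>, for the normalised path from
  \<open>f a\<close> to \<open>f b\<close>, moving the path carried back to level \<open>n+1\<close> is transport along that path; carried
  forward, this is by definition \<open>move\<close> at level \<open>n\<close>.
\<close>

lemma move_step:
  assumes ctx_stable: "wseq \<Gamma> i F f e c" and n: "\<Gamma> \<turnstile> n \<Ztypecolon> natT"
    and a: "\<Gamma> \<turnstile> a \<Ztypecolon> F \<cdot> n" and b: "\<Gamma> \<turnstile> b \<Ztypecolon> F \<cdot> n"
    and d: "\<Gamma> \<turnstile> d \<Ztypecolon> idT (colim F f) c (cin F f n a)"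
  shows "inh \<Gamma> (idT (idT (colim F f) c (cin F f n b))
    (fwd F f c n b (move F f e c (succ n) (f \<cdot> n \<cdot> a) (f \<cdot> n \<cdot> b) (bwd F f c n a d))) (move F f e c n a b d))"
  unfolding move_def[of F f e c n]
  by (rule fwd_cong[OF ctx_stable] move_natural[OF ctx_stable] ty_move[OF ctx_stable] ty_tlv[OF ctx_stable] wseq_ty[OF ctx_stable] ty_enorm[OF ctx_stable] ty_bwd[OF ctx_stable] n a b d)+

section \<open>Contractibility of a pointed sequential colimit\<close>

lemma beta_two:
  assumes B: "A # \<Gamma> \<turnstile> B \<Ztypecolon> U l" and t: "B # A # \<Gamma> \<turnstile> t \<Ztypecolon> T"
    and a: "\<Gamma> \<turnstile> a \<Ztypecolon> A" and b: "\<Gamma> \<turnstile> b \<Ztypecolon> inst B a"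
    and s: "s = inst (sub (up (single a)) t) b" and S: "S = inst (sub (up (single a)) T) b"
  shows "\<Gamma> \<turnstile> Lam A (Lam B t) \<cdot> a \<cdot> b \<doteq> s \<Ztypecolon> S"
proof (rule beta'[OF _ _ b s S])
  show "\<Gamma> \<turnstile> Lam A (Lam B t) \<cdot> a \<doteq> Lam (inst B a) (sub (up (single a)) t) \<Ztypecolon> Pi (inst B a) (sub (up (single a)) T)"
    by (rule beta'[OF eq_refl[OF ty_Lam[OF ty_Lam[OF t]]] ty_Lam[OF t] a]) simp_all
  show "inst B a # \<Gamma> \<turnstile> sub (up (single a)) t \<Ztypecolon> sub (up (single a)) T"
    using sub_ty[OF is_sub_up[OF is_sub_single[OF a] B] t] by simp
qed

text \<open>
  Instances of an open term at judgmentally equal arguments are judgmentally equal. The second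
  variable may depend on the first, so both have to be replaced at once; abstracting over both
  reduces this to congruence of application.
\<close>

lemma subst_cong2:
  assumes B: "A # \<Gamma> \<turnstile> B \<Ztypecolon> U l" and t: "B # A # \<Gamma> \<turnstile> t \<Ztypecolon> T \<up> 2"
    and a: "\<Gamma> \<turnstile> a \<Ztypecolon> A" and a': "\<Gamma> \<turnstile> a' \<Ztypecolon> A" and b: "\<Gamma> \<turnstile> b \<Ztypecolon> inst B a" and b': "\<Gamma> \<turnstile> b' \<Ztypecolon> inst B a'"
    and aa': "\<Gamma> \<turnstile> a \<doteq> a' \<Ztypecolon> A" and bb': "\<Gamma> \<turnstile> b \<doteq> b' \<Ztypecolon> inst B a"
    and s: "s = inst (sub (up (single a)) t) b" and s': "s' = inst (sub (up (single a')) t) b'"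
  shows "\<Gamma> \<turnstile> s \<doteq> s' \<Ztypecolon> T"
proof -
  \<comment> \<open>\<open>T\<close> does not depend on the two variables, so no conversion of types is involved\<close>
  let ?L = "Lam A (Lam B t)"
  have L: "\<Gamma> \<turnstile> ?L \<Ztypecolon> Pi A (Pi B (T \<up> 2))" by (intro ty_Lam t)
  have "\<Gamma> \<turnstile> ?L \<cdot> a \<cdot> b \<doteq> ?L \<cdot> a' \<cdot> b' \<Ztypecolon> T"
    using eq_App[OF eq_App[OF eq_refl[OF L] aa', simplified] bb'] by simp
  moreover have "\<Gamma> \<turnstile> ?L \<cdot> a \<cdot> b \<doteq> s \<Ztypecolon> T" by (rule beta_two[OF B t a b s]) simp
  moreover have "\<Gamma> \<turnstile> ?L \<cdot> a' \<cdot> b' \<doteq> s' \<Ztypecolon> T" by (rule beta_two[OF B t a' b' s']) simp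
  ultimately show ?thesis using eq_sym eq_trans by blast
qed

lemma ty_indNat_const:
  assumes C: "\<Gamma> \<turnstile> C \<Ztypecolon> arr natT (U j)" and z: "\<Gamma> \<turnstile> z \<Ztypecolon> C \<cdot> zero" and s: "\<Gamma> \<turnstile> s \<Ztypecolon> case_succ C"
  shows "\<Gamma> \<turnstile> Const cIndNat \<cdot> C \<cdot> z \<cdot> s \<Ztypecolon> piF natT C"
proof -
  have "\<Gamma> \<turnstile> Const cIndNat \<cdot> C \<Ztypecolon> arr (C \<cdot> zero) (arr (case_succ C) (piF natT C))"
    by (rule ty_AppE[OF ty_Const[where c=cIndNat and i=0 and j=j, simplified] C]) (use C typed_wf in simp_all)
  then show ?thesis using ty_arrE z s by blast
qed

text \<open>
  The images of \<open>a\<close> at all levels. The maps of the sequence have the type of the successor case of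
  recursion on natural numbers, so they serve as the recursion step unchanged, and the successor
  equation \<open>base_pt_succ\<close> is judgmental.
\<close>

definition base_pt :: "tm \<Rightarrow> tm \<Rightarrow> tm \<Rightarrow> tm" where
  "base_pt F f a = Const cIndNat \<cdot> F \<cdot> a \<cdot> f"

text \<open>
  The type of the path from \<open>c\<close> to the base point of level \<open>n\<close>, as a family over \<open>n\<close>.
\<close>

definition base_fam :: "tm \<Rightarrow> tm \<Rightarrow> tm \<Rightarrow> tm \<Rightarrow> tm" where
  "base_fam F f c a = Lam natT (idT (colim (F \<up> 1) (f \<up> 1)) (c \<up> 1)
     (cin (F \<up> 1) (f \<up> 1) (V 0) (base_pt (F \<up> 1) (f \<up> 1) (a \<up> 1) \<cdot> V 0)))"

definition base_step :: "tm \<Rightarrow> tm \<Rightarrow> tm \<Rightarrow> tm \<Rightarrow> tm" where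
  "base_step F f c a = Lam natT (Lam (base_fam (F \<up> 1) (f \<up> 1) (c \<up> 1) (a \<up> 1) \<cdot> V 0)
     (bwd (F \<up> 2) (f \<up> 2) (c \<up> 2) (V 1) (base_pt (F \<up> 2) (f \<up> 2) (a \<up> 2) \<cdot> V 1) (V 0)))"

text \<open>
  The recursion starts with reflexivity and goes back along one glue path at each step.
\<close>

definition base_path :: "tm \<Rightarrow> tm \<Rightarrow> tm \<Rightarrow> tm \<Rightarrow> tm" where
  "base_path F f c a = Const cIndNat \<cdot> base_fam F f c a \<cdot> rfl (colim F f) c \<cdot> base_step F f c a"

lemma sub_pts [simp]:
  "sub r (base_pt F f a) = base_pt (sub r F) (sub r f) (sub r a)"
  "sub r (base_fam F f c a) = base_fam (sub r F) (sub r f) (sub r c) (sub r a)"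
  "sub r (base_step F f c a) = base_step (sub r F) (sub r f) (sub r c) (sub r a)"
  "sub r (base_path F f c a) = base_path (sub r F) (sub r f) (sub r c) (sub r a)"
  by (simp_all add: base_pt_def base_fam_def base_step_def base_path_def)

lemmas ren_pts [simp] = sub_pts[of "V \<circ> r" for r, folded ren_eq_sub]

lemmas lift_pts [simp] = ren_pts[of "shift n" for n, unfolded ren_shift]

lemmas inst_pts [simp] = sub_pts[of "single a" for a, unfolded sub_single_inst]

text \<open>
  Since \<open>c\<close> is the image of the base point, the paths from \<open>c\<close> to the base points can start with
  reflexivity.
\<close>

definition pseq :: "tm list \<Rightarrow> nat \<Rightarrow> tm \<Rightarrow> tm \<Rightarrow> tm \<Rightarrow> tm \<Rightarrow> tm \<Rightarrow> bool" where
  "pseq \<Gamma> i F f e c a \<longleftrightarrow> wseq \<Gamma> i F f e c \<and> \<Gamma> \<turnstile> a \<Ztypecolon> F \<cdot> zero \<and> c = cin F f zero a"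

lemma pseq_weak: "pseq \<Gamma> i F f e c a \<Longrightarrow> wf (B # \<Gamma>) \<Longrightarrow> pseq (B # \<Gamma>) i (F \<up> 1) (f \<up> 1) (e \<up> 1) (c \<up> 1) (a \<up> 1)"
  unfolding pseq_def using wseq_weak[of \<Gamma> i F f e c B] weak(1)[of B \<Gamma> a "F \<cdot> zero"] by auto

lemma cin_cong:
  assumes "\<Gamma> \<turnstile> F \<Ztypecolon> arr natT (U i)" "\<Gamma> \<turnstile> f \<Ztypecolon> seqmaps F" "\<Gamma> \<turnstile> n \<Ztypecolon> natT" "\<Gamma> \<turnstile> a \<doteq> b \<Ztypecolon> F \<cdot> n"
  shows "\<Gamma> \<turnstile> cin F f n a \<doteq> cin F f n b \<Ztypecolon> colim F f"
  unfolding cin_def by (rule eq_App_arr[OF eq_refl[OF ty_cin_const[OF assms(1-3)]] assms(4)])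

context
  fixes \<Gamma> i F f e c a
  assumes P: "pseq \<Gamma> i F f e c a"
begin

lemma pseqD: "wseq \<Gamma> i F f e c" "\<Gamma> \<turnstile> a \<Ztypecolon> F \<cdot> zero" "c = cin F f zero a" "wf \<Gamma>" "\<Gamma> \<turnstile> natT \<Ztypecolon> U i"
  using P typed_wf ty_natT unfolding pseq_def by blast+

lemmas pseqW = wseqD[OF pseqD(1)]

lemma base_pt_case: "\<Gamma> \<turnstile> f \<Ztypecolon> case_succ F" using pseqW(2) unfolding seqmaps_def case_succ_def .

lemma ty_base_pt: "\<Gamma> \<turnstile> base_pt F f a \<Ztypecolon> piF natT F"
  unfolding base_pt_def by (rule ty_indNat_const[OF pseqW(1) pseqD(2) base_pt_case])

lemma ty_base_pt_app: "\<Gamma> \<turnstile> n \<Ztypecolon> natT \<Longrightarrow> \<Gamma> \<turnstile> base_pt F f a \<cdot> n \<Ztypecolon> F \<cdot> n"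
  by (rule ty_piFE[OF ty_base_pt])

lemma base_pt_zero: "\<Gamma> \<turnstile> base_pt F f a \<cdot> zero \<doteq> a \<Ztypecolon> F \<cdot> zero"
  unfolding base_pt_def by (rule comp_Zero[OF pseqW(1) pseqD(2) base_pt_case])

lemma base_pt_succ: "\<Gamma> \<turnstile> n \<Ztypecolon> natT \<Longrightarrow> \<Gamma> \<turnstile> base_pt F f a \<cdot> succ n \<doteq> f \<cdot> n \<cdot> (base_pt F f a \<cdot> n) \<Ztypecolon> F \<cdot> succ n"
  unfolding base_pt_def by (rule comp_Succ[OF pseqW(1) pseqD(2) base_pt_case])

end

context
  fixes \<Gamma> i F f e c a
  assumes P: "pseq \<Gamma> i F f e c a"
begin

lemma base_fam_open: "natT # \<Gamma> \<turnstile> idT (colim (F \<up> 1) (f \<up> 1)) (c \<up> 1)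
     (cin (F \<up> 1) (f \<up> 1) (V 0) (base_pt (F \<up> 1) (f \<up> 1) (a \<up> 1) \<cdot> V 0)) \<Ztypecolon> U i"
proof -
  have wf: "wf (natT # \<Gamma>)" using pseqD(5)[OF P] wf_Cons by blast
  note P1 = pseq_weak[OF P wf]
  have "natT # \<Gamma> \<turnstile> V 0 \<Ztypecolon> natT" using ty_V0[OF pseqD(5)[OF P]] by simp
  then show ?thesis using wseq_ty(5)[OF pseqD(1)[OF P1]] ty_base_pt_app[OF P1] by blast
qed

lemma ty_base_fam: "\<Gamma> \<turnstile> base_fam F f c a \<Ztypecolon> arr natT (U i)"
  unfolding base_fam_def by (rule ty_Lam_fam[OF base_fam_open])

lemma base_fam_beta: "\<Gamma> \<turnstile> n \<Ztypecolon> natT \<Longrightarrow>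
  \<Gamma> \<turnstile> base_fam F f c a \<cdot> n \<doteq> idT (colim F f) c (cin F f n (base_pt F f a \<cdot> n)) \<Ztypecolon> U i"
  unfolding base_fam_def by (rule fam_beta[OF base_fam_open]) simp_all

text \<open>
  The type that \<open>bwd\<close> produces, up to the judgmental successor equation of the base points.
\<close>

lemma base_fam_succ:
  assumes n: "\<Gamma> \<turnstile> n \<Ztypecolon> natT"
  shows "\<Gamma> \<turnstile> base_fam F f c a \<cdot> succ n \<doteq> idT (colim F f) c (cin F f (succ n) (f \<cdot> n \<cdot> (base_pt F f a \<cdot> n))) \<Ztypecolon> U i"
  by (rule eq_trans[OF base_fam_beta[OF ty_succ[OF n]]
        idT_cong[OF pseqW(5)[OF P] eq_refl[OF pseqW(4)[OF P]] cin_cong[OF pseqW(1,2)[OF P] ty_succ[OF n] base_pt_succ[OF P n]]]])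

lemma base_fam_zero: "\<Gamma> \<turnstile> base_fam F f c a \<cdot> zero \<doteq> idT (colim F f) c c \<Ztypecolon> U i"
  using eq_trans[OF base_fam_beta[OF ty_zero[OF pseqD(4)[OF P]]]
        idT_cong[OF pseqW(5)[OF P] eq_refl[OF pseqW(4)[OF P]] cin_cong[OF pseqW(1,2)[OF P] ty_zero[OF pseqD(4)[OF P]] base_pt_zero[OF P]]]]
  unfolding pseqD(3)[OF P, symmetric] .

lemma ty_bwd_base_pt:
  assumes n: "\<Gamma> \<turnstile> n \<Ztypecolon> natT" and d: "\<Gamma> \<turnstile> d \<Ztypecolon> base_fam F f c a \<cdot> n"
  shows "\<Gamma> \<turnstile> bwd F f c n (base_pt F f a \<cdot> n) d \<Ztypecolon> base_fam F f c a \<cdot> succ n"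
  by (rule ty_conv_sym[OF ty_bwd[OF pseqD(1)[OF P] n ty_base_pt_app[OF P n] ty_conv[OF d base_fam_beta[OF n]]] base_fam_succ[OF n]])

end

context
  fixes \<Gamma> i F f e c a
  assumes P: "pseq \<Gamma> i F f e c a"
begin

lemma base_step_open:
  shows "wf (natT # \<Gamma>)" "natT # \<Gamma> \<turnstile> base_fam (F \<up> 1) (f \<up> 1) (c \<up> 1) (a \<up> 1) \<cdot> V 0 \<Ztypecolon> U i"
    "base_fam (F \<up> 1) (f \<up> 1) (c \<up> 1) (a \<up> 1) \<cdot> V 0 # natT # \<Gamma> \<turnstile>
      bwd (F \<up> 2) (f \<up> 2) (c \<up> 2) (V 1) (base_pt (F \<up> 2) (f \<up> 2) (a \<up> 2) \<cdot> V 1) (V 0)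
      \<Ztypecolon> base_fam (F \<up> 2) (f \<up> 2) (c \<up> 2) (a \<up> 2) \<cdot> succ (V 1)"
proof -
  show wf: "wf (natT # \<Gamma>)" using pseqD(5)[OF P] wf_Cons by blast
  note P1 = pseq_weak[OF P wf]
  have v0: "natT # \<Gamma> \<turnstile> V 0 \<Ztypecolon> natT" using ty_V0[OF pseqD(5)[OF P]] by simp
  show T: "natT # \<Gamma> \<turnstile> base_fam (F \<up> 1) (f \<up> 1) (c \<up> 1) (a \<up> 1) \<cdot> V 0 \<Ztypecolon> U i"
    by (rule ty_arrE[OF ty_base_fam[OF P1] v0])
  note P2 = pseq_weak[OF P1 wf_Cons[OF T]]
  show "base_fam (F \<up> 1) (f \<up> 1) (c \<up> 1) (a \<up> 1) \<cdot> V 0 # natT # \<Gamma> \<turnstile>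
      bwd (F \<up> 2) (f \<up> 2) (c \<up> 2) (V 1) (base_pt (F \<up> 2) (f \<up> 2) (a \<up> 2) \<cdot> V 1) (V 0)
      \<Ztypecolon> base_fam (F \<up> 2) (f \<up> 2) (c \<up> 2) (a \<up> 2) \<cdot> succ (V 1)"
    using ty_bwd_base_pt[OF P2, of "V 1" "V 0"] weak(1)[OF wf_Cons[OF T] v0] ty_V0[OF T] by simp
qed

lemma ty_base_step: "\<Gamma> \<turnstile> base_step F f c a \<Ztypecolon> case_succ (base_fam F f c a)"
  unfolding base_step_def case_succ_def
  using ty_Lam[OF ty_Lam_arr, of _ natT \<Gamma>] base_step_open(3) by simp

lemma base_step_beta:
  assumes n: "\<Gamma> \<turnstile> n \<Ztypecolon> natT" and d: "\<Gamma> \<turnstile> d \<Ztypecolon> base_fam F f c a \<cdot> n"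
  shows "\<Gamma> \<turnstile> base_step F f c a \<cdot> n \<cdot> d \<doteq> bwd F f c n (base_pt F f a \<cdot> n) d \<Ztypecolon> base_fam F f c a \<cdot> succ n"
  unfolding base_step_def by (rule beta_two[OF base_step_open(2,3) n]) (simp_all add: d)

lemma ty_base_path: "\<Gamma> \<turnstile> base_path F f c a \<Ztypecolon> piF natT (base_fam F f c a)"
  unfolding base_path_def
  by (rule ty_indNat_const[OF ty_base_fam[OF P] ty_conv_sym[OF ty_rfl[OF pseqW(5,4)[OF P]] base_fam_zero[OF P]] ty_base_step])

lemma ty_base_path_app:
  assumes n: "\<Gamma> \<turnstile> n \<Ztypecolon> natT"
  shows "\<Gamma> \<turnstile> base_path F f c a \<cdot> n \<Ztypecolon> idT (colim F f) c (cin F f n (base_pt F f a \<cdot> n))"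
  by (rule ty_conv[OF ty_piFE[OF ty_base_path n] base_fam_beta[OF P n]])

lemma base_path_succ:
  assumes n: "\<Gamma> \<turnstile> n \<Ztypecolon> natT"
  shows "\<Gamma> \<turnstile> base_path F f c a \<cdot> succ n \<doteq> bwd F f c n (base_pt F f a \<cdot> n) (base_path F f c a \<cdot> n) \<Ztypecolon> base_fam F f c a \<cdot> succ n"
  unfolding base_path_def
  by (rule eq_trans[OF comp_Succ[OF ty_base_fam[OF P] ty_conv_sym[OF ty_rfl[OF pseqW(5,4)[OF P]] base_fam_zero[OF P]] ty_base_step n]
     base_step_beta[OF n ty_piFE[OF ty_base_path[unfolded base_path_def] n]]])

end

lemma ty_indColim:
  assumes F: "\<Gamma> \<turnstile> F \<Ztypecolon> arr natT (U i)" and f: "\<Gamma> \<turnstile> f \<Ztypecolon> seqmaps F"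
    and P: "\<Gamma> \<turnstile> P \<Ztypecolon> arr (colim F f) (U j)" and h: "\<Gamma> \<turnstile> h \<Ztypecolon> case_cin F f P" and q: "\<Gamma> \<turnstile> q \<Ztypecolon> case_glue F f P h"
  shows "\<Gamma> \<turnstile> Const cIndColim \<cdot> F \<cdot> f \<cdot> P \<cdot> h \<cdot> q \<Ztypecolon> piF (colim F f) P"
proof -
  have "\<Gamma> \<turnstile> Const cIndColim \<cdot> F \<Ztypecolon> Pi (seqmaps F) (Pi (arr (colim (F \<up> 1) (V 0)) (U j))
     (Pi (case_cin (F \<up> 2) (V 1) (V 0)) (arr (case_glue (F \<up> 3) (V 2) (V 1) (V 0))
        (piF (colim (F \<up> 3) (V 2)) (V 1)))))"
    by (rule ty_AppE[OF ty_Const[where c=cIndColim and i=i and j=j, simplified] F]) (use F typed_wf in simp_all)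
  then have "\<Gamma> \<turnstile> Const cIndColim \<cdot> F \<cdot> f \<Ztypecolon> Pi (arr (colim F f) (U j))
     (Pi (case_cin (F \<up> 1) (f \<up> 1) (V 0)) (arr (case_glue (F \<up> 2) (f \<up> 2) (V 1) (V 0))
        (piF (colim (F \<up> 2) (f \<up> 2)) (V 1))))"
    by (rule ty_AppE[OF _ f]) simp
  then have "\<Gamma> \<turnstile> Const cIndColim \<cdot> F \<cdot> f \<cdot> P \<Ztypecolon>
     Pi (case_cin F f P) (arr (case_glue (F \<up> 1) (f \<up> 1) (P \<up> 1) (V 0)) (piF (colim (F \<up> 1) (f \<up> 1)) (P \<up> 1)))"
    by (rule ty_AppE[OF _ P]) simp
  then have "\<Gamma> \<turnstile> Const cIndColim \<cdot> F \<cdot> f \<cdot> P \<cdot> h \<Ztypecolon> arr (case_glue F f P h) (piF (colim F f) P)"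
    by (rule ty_AppE[OF _ h]) simp
  then show ?thesis by (rule ty_arrE[OF _ q])
qed

text \<open>
  The base point and the base path of level \<open>n+1\<close> unfold judgmentally; this carries the unfolding
  into \<open>move\<close>.
\<close>

lemma move_cong:
  assumes ctx_stable: "wseq \<Gamma> i F f e c" and n: "\<Gamma> \<turnstile> n \<Ztypecolon> natT" and b: "\<Gamma> \<turnstile> b \<Ztypecolon> F \<cdot> n"
    and a: "\<Gamma> \<turnstile> a \<Ztypecolon> F \<cdot> n" and a': "\<Gamma> \<turnstile> a' \<Ztypecolon> F \<cdot> n"
    and d: "\<Gamma> \<turnstile> d \<Ztypecolon> idT (colim F f) c (cin F f n a)" and d': "\<Gamma> \<turnstile> d' \<Ztypecolon> idT (colim F f) c (cin F f n a')"
    and aa': "\<Gamma> \<turnstile> a \<doteq> a' \<Ztypecolon> F \<cdot> n" and dd': "\<Gamma> \<turnstile> d \<doteq> d' \<Ztypecolon> idT (colim F f) c (cin F f n a)"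
  shows "\<Gamma> \<turnstile> move F f e c n a b d \<doteq> move F f e c n a' b d' \<Ztypecolon> idT (colim F f) c (cin F f n b)"
proof -
  let ?A = "F \<cdot> n" and ?B = "idT (colim (F \<up> 1) (f \<up> 1)) (c \<up> 1) (cin (F \<up> 1) (f \<up> 1) (n \<up> 1) (V 0))"
  let ?\<Gamma> = "?B # ?A # \<Gamma>"
  note A = wseq_ty(1)[OF ctx_stable n]
  note w1 = weak(1)[OF wf_Cons[OF A]] and W1 = wseq_weak[OF ctx_stable wf_Cons[OF A]]
  have n1: "?A # \<Gamma> \<turnstile> n \<up> 1 \<Ztypecolon> natT" and v0: "?A # \<Gamma> \<turnstile> V 0 \<Ztypecolon> F \<up> 1 \<cdot> n \<up> 1" and b1: "?A # \<Gamma> \<turnstile> b \<up> 1 \<Ztypecolon> F \<up> 1 \<cdot> n \<up> 1"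
    using w1[OF n] ty_V0[OF A] w1[OF b] by simp_all
  have B: "?A # \<Gamma> \<turnstile> ?B \<Ztypecolon> U i" by (rule wseq_ty(5)[OF W1 n1 v0])
  note w2 = weak(1)[OF wf_Cons[OF B]]
  have W2: "wseq ?\<Gamma> i (F \<up> 2) (f \<up> 2) (e \<up> 2) (c \<up> 2)" using wseq_weak[OF W1 wf_Cons[OF B]] by simp
  have "?\<Gamma> \<turnstile> n \<up> 2 \<Ztypecolon> natT" "?\<Gamma> \<turnstile> V 1 \<Ztypecolon> F \<up> 2 \<cdot> n \<up> 2" "?\<Gamma> \<turnstile> b \<up> 2 \<Ztypecolon> F \<up> 2 \<cdot> n \<up> 2"
    "?\<Gamma> \<turnstile> V 0 \<Ztypecolon> idT (colim (F \<up> 2) (f \<up> 2)) (c \<up> 2) (cin (F \<up> 2) (f \<up> 2) (n \<up> 2) (V 1))"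
    using w2[OF n1] w2[OF v0] w2[OF b1] ty_V0[OF B] by simp_all
  then have t: "?\<Gamma> \<turnstile> move (F \<up> 2) (f \<up> 2) (e \<up> 2) (c \<up> 2) (n \<up> 2) (V 1) (b \<up> 2) (V 0)
      \<Ztypecolon> idT (colim F f) c (cin F f n b) \<up> 2"
    using ty_move[OF W2] by simp
  show ?thesis
    by (rule subst_cong2[OF B t a a' _ _ aa']) (use d d' dd' in simp_all)
qed

text \<open>
  The paths \<open>p n b\<close> from \<open>c\<close> to all points of the colimit, as the point case of colimit induction.
\<close>

definition level_contr :: "tm \<Rightarrow> tm \<Rightarrow> tm \<Rightarrow> tm \<Rightarrow> tm \<Rightarrow> tm" where
  "level_contr F f e c a = Lam natT (Lam (F \<up> 1 \<cdot> V 0) (move (F \<up> 2) (f \<up> 2) (e \<up> 2) (c \<up> 2) (V 1)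
     (base_pt (F \<up> 2) (f \<up> 2) (a \<up> 2) \<cdot> V 1) (V 0) (base_path (F \<up> 2) (f \<up> 2) (c \<up> 2) (a \<up> 2) \<cdot> V 1)))"

lemma lift_level_contr [simp]: "level_contr F f e c a \<up> n = level_contr (F \<up> n) (f \<up> n) (e \<up> n) (c \<up> n) (a \<up> n)"
  by (simp add: level_contr_def add.commute)

context
  fixes \<Gamma> i F f e c a
  assumes P: "pseq \<Gamma> i F f e c a"
begin

lemma ty_level_contr_body:
  assumes n: "\<Gamma> \<turnstile> n \<Ztypecolon> natT" and b: "\<Gamma> \<turnstile> b \<Ztypecolon> F \<cdot> n"
  shows "\<Gamma> \<turnstile> move F f e c n (base_pt F f a \<cdot> n) b (base_path F f c a \<cdot> n) \<Ztypecolon> idT (colim F f) c (cin F f n b)"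
  by (rule ty_move[OF pseqD(1)[OF P] n ty_base_pt_app[OF P n] b ty_base_path_app[OF P n]])

text \<open>
  The context \<open>n : N, b : F n\<close> of both cases of colimit induction.
\<close>

lemma nat_fam_ctx:
  shows "natT # \<Gamma> \<turnstile> F \<up> 1 \<cdot> V 0 \<Ztypecolon> U i"
    and "pseq (F \<up> 1 \<cdot> V 0 # natT # \<Gamma>) i (F \<up> 2) (f \<up> 2) (e \<up> 2) (c \<up> 2) (a \<up> 2)"
    and "F \<up> 1 \<cdot> V 0 # natT # \<Gamma> \<turnstile> V 1 \<Ztypecolon> natT" "F \<up> 1 \<cdot> V 0 # natT # \<Gamma> \<turnstile> V 0 \<Ztypecolon> F \<up> 2 \<cdot> V 1"
proof -
  note N = pseqD(5)[OF P]
  note P1 = pseq_weak[OF P wf_Cons[OF N]]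
  have v: "natT # \<Gamma> \<turnstile> V 0 \<Ztypecolon> natT" using ty_V0[OF N] by simp
  show A: "natT # \<Gamma> \<turnstile> F \<up> 1 \<cdot> V 0 \<Ztypecolon> U i" by (rule wseq_ty(1)[OF pseqD(1)[OF P1] v])
  show "pseq (F \<up> 1 \<cdot> V 0 # natT # \<Gamma>) i (F \<up> 2) (f \<up> 2) (e \<up> 2) (c \<up> 2) (a \<up> 2)"
    "F \<up> 1 \<cdot> V 0 # natT # \<Gamma> \<turnstile> V 1 \<Ztypecolon> natT" "F \<up> 1 \<cdot> V 0 # natT # \<Gamma> \<turnstile> V 0 \<Ztypecolon> F \<up> 2 \<cdot> V 1"
    using pseq_weak[OF P1 wf_Cons[OF A]] weak(1)[OF wf_Cons[OF A] v] ty_V0[OF A] by simp_all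
qed

end

lemma ty_level_contr_open:
  assumes P: "pseq \<Gamma> i F f e c a"
  shows "F \<up> 1 \<cdot> V 0 # natT # \<Gamma> \<turnstile> move (F \<up> 2) (f \<up> 2) (e \<up> 2) (c \<up> 2) (V 1)
     (base_pt (F \<up> 2) (f \<up> 2) (a \<up> 2) \<cdot> V 1) (V 0) (base_path (F \<up> 2) (f \<up> 2) (c \<up> 2) (a \<up> 2) \<cdot> V 1)
     \<Ztypecolon> idT (colim (F \<up> 2) (f \<up> 2)) (c \<up> 2) (cin (F \<up> 2) (f \<up> 2) (V 1) (V 0))"
  by (rule ty_level_contr_body[OF nat_fam_ctx(2-4)[OF P]])

lemma ty_level_contr:
  assumes P: "pseq \<Gamma> i F f e c a"
  shows "\<Gamma> \<turnstile> level_contr F f e c a \<Ztypecolon> case_cin F f (paths (colim F f) c)"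
proof -
  note n = nat_fam_ctx[OF P]
  note ctx_stable = pseqW[OF n(2)]
  show ?thesis unfolding level_contr_def case_cin_def
    using ty_Lam[OF ty_Lam[OF ty_conv_sym[OF ty_level_contr_open[OF P]
        paths_beta(1)[OF ctx_stable(5,4) ty_cin[OF ctx_stable(1,2) n(3,4)]]]]] by simp
qed

context
  fixes \<Gamma> i F f e c a
  assumes P: "pseq \<Gamma> i F f e c a"
begin

lemma level_contr_beta:
  assumes n: "\<Gamma> \<turnstile> n \<Ztypecolon> natT" and b: "\<Gamma> \<turnstile> b \<Ztypecolon> F \<cdot> n"
  shows "\<Gamma> \<turnstile> level_contr F f e c a \<cdot> n \<cdot> b \<doteq> move F f e c n (base_pt F f a \<cdot> n) b (base_path F f c a \<cdot> n)
    \<Ztypecolon> idT (colim F f) c (cin F f n b)"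
  unfolding level_contr_def
  by (rule beta_two[OF nat_fam_ctx(1)[OF P] ty_level_contr_open[OF P] n]) (simp_all add: b)

text \<open>
  The path case: at \<open>f b\<close> the path of level \<open>n+1\<close> unfolds to the left-hand side of \<open>move_step\<close>.
\<close>

lemma level_contr_coherent:
  assumes n: "\<Gamma> \<turnstile> n \<Ztypecolon> natT" and b: "\<Gamma> \<turnstile> b \<Ztypecolon> F \<cdot> n"
  shows "inh \<Gamma> (idT (paths (colim F f) c \<cdot> cin F f n b)
     (transp (colim F f) (paths (colim F f) c) (cin F f (succ n) (f \<cdot> n \<cdot> b)) (cin F f n b) (glue F f n b)
       (level_contr F f e c a \<cdot> succ n \<cdot> (f \<cdot> n \<cdot> b))) (level_contr F f e c a \<cdot> n \<cdot> b))"
proof -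
  note ctx_stable = pseqD(1)[OF P] and w = pseqW[OF P]
  note at_n = wseq_ty[OF ctx_stable n] and at_succ = wseq_ty[OF ctx_stable ty_succ[OF n]]
  let ?a = "base_pt F f a \<cdot> n" and ?d = "base_path F f c a \<cdot> n"
  let ?m = "move F f e c (succ n) (f \<cdot> n \<cdot> ?a) (f \<cdot> n \<cdot> b) (bwd F f c n ?a ?d)"
  note a = ty_base_pt_app[OF P n] and d = ty_base_path_app[OF P n]
  note fb = at_n(3)[OF b] and fa = at_n(3)[OF a]
  note bw = ty_bwd[OF ctx_stable n a d]
  \<comment> \<open>the arguments of \<open>move\<close> are the base point and base path of level \<open>n+1\<close>, unfolded one step\<close>
  have m: "\<Gamma> \<turnstile> level_contr F f e c a \<cdot> succ n \<cdot> (f \<cdot> n \<cdot> b) \<doteq> ?m \<Ztypecolon> idT (colim F f) c (cin F f (succ n) (f \<cdot> n \<cdot> b))"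
    by (rule eq_trans[OF level_contr_beta[OF at_n(2) fb] move_cong[OF ctx_stable at_n(2) fb ty_base_pt_app[OF P at_n(2)] fa
          ty_base_path_app[OF P at_n(2)] bw base_pt_succ[OF P n] eq_conv[OF base_path_succ[OF P n] base_fam_beta[OF P at_n(2)]]]])
  have "\<Gamma> \<turnstile> fwd F f c n b ?m \<doteq> fwd F f c n b (level_contr F f e c a \<cdot> succ n \<cdot> (f \<cdot> n \<cdot> b)) \<Ztypecolon> idT (colim F f) c (cin F f n b)"
    unfolding fwd_def
    by (rule trans_path_cong[OF w(5,4) at_succ(4)[OF fb] at_n(4)[OF b] eq_refl[OF at_n(6)[OF b]] eq_sym[OF m] at_n(6)[OF b]])
  from inh_conv[OF move_step[OF ctx_stable n a b d] idT_cong_ty[OF eq_sym[OF paths_beta(1)[OF w(5,4) at_n(4)[OF b]]] this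
        eq_sym[OF level_contr_beta[OF n b]]]]
  show ?thesis unfolding fwd_def trans_path_def .
qed

end

text \<open>
  Only weak constancy and the base point enter: by \<open>level_contr_coherent\<close> the paths from \<open>c\<close> to the
  points of the levels are compatible with glue, and colimit induction assembles them.
\<close>

theorem colim_contractible:
  assumes P: "pseq \<Gamma> i F f e c a"
  shows "inh \<Gamma> (piF (colim F f) (paths (colim F f) c))"
proof -
  note ctx_stable = pseqW[OF P] and n = nat_fam_ctx[OF P]
  have "inh \<Gamma> (case_glue F f (paths (colim F f) c) (level_contr F f e c a))"
    unfolding case_glue_def using inh_Pi[OF inh_Pi[OF level_contr_coherent[OF n(2-4)]]] by simp
  then show ?thesis
    using ty_indColim[OF ctx_stable(1,2) ty_paths(1)[OF ctx_stable(5,4)] ty_level_contr[OF P]] unfolding inh_def by blast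
qed

section \<open>Propositions, dependent sums and function extensionality\<close>

lemma inh_arrE: "inh \<Gamma> (arr A B) \<Longrightarrow> inh \<Gamma> A \<Longrightarrow> inh \<Gamma> B"
  unfolding inh_def using ty_arrE by blast

lemma ty_isprop:
  assumes A: "\<Gamma> \<turnstile> A \<Ztypecolon> U i" shows "\<Gamma> \<turnstile> isprop A \<Ztypecolon> U i"
  unfolding isprop_def
proof (intro ty_Pi A)
  show "A # \<Gamma> \<turnstile> A \<up> 1 \<Ztypecolon> U i" by (rule path_ctx_prefix(2)[OF A])
  show "A \<up> 1 # A # \<Gamma> \<turnstile> idT (A \<up> 2) (V 1) (V 0) \<Ztypecolon> U i" by (rule path_ctx_type[OF A])
qed

lemma isprop_app:
  assumes w: "\<Gamma> \<turnstile> w \<Ztypecolon> isprop A" and x: "\<Gamma> \<turnstile> x \<Ztypecolon> A" and y: "\<Gamma> \<turnstile> y \<Ztypecolon> A"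
  shows "\<Gamma> \<turnstile> w \<cdot> x \<cdot> y \<Ztypecolon> idT A x y"
proof -
  have "\<Gamma> \<turnstile> w \<cdot> x \<Ztypecolon> Pi A (idT (A \<up> 1) (x \<up> 1) (V 0))"
    by (rule ty_AppE[OF w[unfolded isprop_def] x]) simp
  then show ?thesis by (rule ty_AppE[OF _ y]) simp
qed

lemma isprop_cong:
  assumes A: "\<Gamma> \<turnstile> A \<Ztypecolon> U i" and e: "\<Gamma> \<turnstile> A \<doteq> B \<Ztypecolon> U i"
  shows "\<Gamma> \<turnstile> isprop A \<doteq> isprop B \<Ztypecolon> U i"
  unfolding isprop_def
proof (intro eq_Pi e)
  have e1: "A # \<Gamma> \<turnstile> A \<up> 1 \<doteq> B \<up> 1 \<Ztypecolon> U i" using weak(2)[OF path_ctx_prefix(1)[OF A] e] by simp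
  then show "A # \<Gamma> \<turnstile> A \<up> 1 \<doteq> B \<up> 1 \<Ztypecolon> U i" .
  have e2: "A \<up> 1 # A # \<Gamma> \<turnstile> A \<up> 2 \<doteq> B \<up> 2 \<Ztypecolon> U i" using weak(2)[OF path_ctx_prefix(3)[OF A] e1] by simp
  have "A \<up> 1 # A # \<Gamma> \<turnstile> V 1 \<Ztypecolon> A \<up> 2" "A \<up> 1 # A # \<Gamma> \<turnstile> V 0 \<Ztypecolon> A \<up> 2"
    using path_ctx_prefix(3)[OF A] by (auto intro!: ty_V')
  with e2 show "A \<up> 1 # A # \<Gamma> \<turnstile> idT (A \<up> 2) (V 1) (V 0) \<doteq> idT (B \<up> 2) (V 1) (V 0) \<Ztypecolon> U i"
    using idT_cong_ty eq_refl by blast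
qed

text \<open>
  With \<open>k\<close> contracting \<open>X\<close> to \<open>x\<close>, every path \<open>u = v\<close> equals \<open>k u\<inverse> \<cdot> k v\<close>: by path induction it is enough to
  treat reflexivity, where the composite cancels. Hence any two paths are equal.
\<close>

lemma contr_set:
  assumes X: "\<Gamma> \<turnstile> X \<Ztypecolon> U i" and x: "\<Gamma> \<turnstile> x \<Ztypecolon> X" and k: "\<Gamma> \<turnstile> k \<Ztypecolon> piF X (paths X x)"
    and u: "\<Gamma> \<turnstile> u \<Ztypecolon> X" and v: "\<Gamma> \<turnstile> v \<Ztypecolon> X" and p: "\<Gamma> \<turnstile> p \<Ztypecolon> idT X u v" and q: "\<Gamma> \<turnstile> q \<Ztypecolon> idT X u v"
  shows "inh \<Gamma> (idT (idT X u v) p q)"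
proof -
  have app: "\<Delta> \<turnstile> k' \<cdot> w \<Ztypecolon> idT Y y w"
    if "\<Delta> \<turnstile> Y \<Ztypecolon> U i" "\<Delta> \<turnstile> y \<Ztypecolon> Y" "\<Delta> \<turnstile> k' \<Ztypecolon> piF Y (paths Y y)" "\<Delta> \<turnstile> w \<Ztypecolon> Y" for \<Delta> Y y k' w
    by (rule ty_conv[OF ty_piFE[OF that(3,4)] paths_beta(1)[OF that(1,2,4)]])
  \<comment> \<open>\<open>k u\<inverse> \<cdot> k v\<close>\<close>
  let ?r = "cancel_path X v x u (k \<cdot> u) (k \<cdot> v)"
  let ?C = "idT (idT (X \<up> 3) (V 2) (V 1)) (V 0) (cancel_path (X \<up> 3) (V 1) (x \<up> 3) (V 2) (k \<up> 3 \<cdot> V 2) (k \<up> 3 \<cdot> V 1))"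
  have C: "path_ctx X \<Gamma> \<turnstile> ?C \<Ztypecolon> U i"
  proof -
    have X3: "path_ctx X \<Gamma> \<turnstile> X \<up> 3 \<Ztypecolon> U i" by (rule path_ctx_weak[OF X X]) simp
    have x3: "path_ctx X \<Gamma> \<turnstile> x \<up> 3 \<Ztypecolon> X \<up> 3" by (rule path_ctx_weak[OF X x]) simp
    have k3: "path_ctx X \<Gamma> \<turnstile> k \<up> 3 \<Ztypecolon> piF (X \<up> 3) (paths (X \<up> 3) (x \<up> 3))" by (rule path_ctx_weak[OF X k]) simp
    show ?thesis by (rule ty_idT X3 path_ctx_vars[OF X] ty_cancel_path[OF X3] x3 app[OF X3 x3 k3])+
  qed
  have D: "inh (X # \<Gamma>) (idT (idT (X \<up> 1) (V 0) (V 0)) (rfl (X \<up> 1) (V 0))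
      (cancel_path (X \<up> 1) (V 0) (x \<up> 1) (V 0) (k \<up> 1 \<cdot> V 0) (k \<up> 1 \<cdot> V 0)))"
  proof -
    note X1 = path_ctx_prefix(2)[OF X] and v0 = ty_V0[OF X] and w = weak(1)[OF path_ctx_prefix(1)[OF X]]
    have k1: "X # \<Gamma> \<turnstile> k \<up> 1 \<Ztypecolon> piF (X \<up> 1) (paths (X \<up> 1) (x \<up> 1))" using w[OF k] by simp
    note kv = app[OF X1 w[OF x] k1 v0]
    show ?thesis
      by (rule inh_sym[OF ty_idT[OF X1 v0 v0] ty_cancel_path[OF X1 v0 w[OF x] v0 kv kv] ty_rfl[OF X1 v0]
         cancel_path_self[OF X1 w[OF x] v0 kv]])
  qed
  have *: "inh \<Gamma> (idT (idT X u v) s ?r)" if s: "\<Gamma> \<turnstile> s \<Ztypecolon> idT X u v" for s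
    by (rule path_induction[OF X C D u v s]) (simp_all add: inst3_def)
  note I = ty_idT[OF X u v] and r = ty_cancel_path[OF X v x u app[OF X x k u] app[OF X x k v]]
  show ?thesis by (rule inh_trans[OF I p r q *[OF p] inh_sym[OF I q r *[OF q]]])
qed

lemma ty_sig:
  assumes A: "\<Gamma> \<turnstile> A \<Ztypecolon> U i" and B: "\<Gamma> \<turnstile> B \<Ztypecolon> arr A (U i)"
  shows "\<Gamma> \<turnstile> sig A B \<Ztypecolon> U i"
proof -
  have "\<Gamma> \<turnstile> Const cSigma \<cdot> A \<Ztypecolon> arr (arr A (U i)) (U i)"
    by (rule ty_AppE[OF ty_Const[where c=cSigma and i=i and j=0, simplified] A]) (use A typed_wf in simp_all)
  then show ?thesis unfolding sig_def by (rule ty_arrE[OF _ B])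
qed

lemma ty_indSigma:
  assumes A: "\<Gamma> \<turnstile> A \<Ztypecolon> U i" and B: "\<Gamma> \<turnstile> B \<Ztypecolon> arr A (U i)" and C: "\<Gamma> \<turnstile> C \<Ztypecolon> arr (sig A B) (U j)"
    and g: "\<Gamma> \<turnstile> g \<Ztypecolon> case_sig A B C" and p: "\<Gamma> \<turnstile> p \<Ztypecolon> sig A B"
  shows "\<Gamma> \<turnstile> Const cIndSigma \<cdot> A \<cdot> B \<cdot> C \<cdot> g \<cdot> p \<Ztypecolon> C \<cdot> p"
proof -
  have "\<Gamma> \<turnstile> Const cIndSigma \<cdot> A \<Ztypecolon> Pi (arr A (U i)) (Pi (arr (sig (A \<up> 1) (V 0)) (U j))
     (arr (case_sig (A \<up> 2) (V 1) (V 0)) (piF (sig (A \<up> 2) (V 1)) (V 0))))"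
    by (rule ty_AppE[OF ty_Const[where c=cIndSigma and i=i and j=j, simplified] A]) (use A typed_wf in simp_all)
  then have "\<Gamma> \<turnstile> Const cIndSigma \<cdot> A \<cdot> B \<Ztypecolon> Pi (arr (sig A B) (U j))
     (arr (case_sig (A \<up> 1) (B \<up> 1) (V 0)) (piF (sig (A \<up> 1) (B \<up> 1)) (V 0)))"
    by (rule ty_AppE[OF _ B]) simp
  then have "\<Gamma> \<turnstile> Const cIndSigma \<cdot> A \<cdot> B \<cdot> C \<Ztypecolon> arr (case_sig A B C) (piF (sig A B) C)"
    by (rule ty_AppE[OF _ C]) simp
  then show ?thesis using ty_arrE[OF _ g] ty_piFE[OF _ p] by blast
qed

context
  fixes \<Gamma> A B i
  assumes A: "\<Gamma> \<turnstile> A \<Ztypecolon> U i" and B: "\<Gamma> \<turnstile> B \<Ztypecolon> arr A (U i)"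
begin

text \<open>
  The context \<open>a : A, b : B a\<close> of the case of an induction over pairs.
\<close>

lemma sig_ctx:
  shows "A # \<Gamma> \<turnstile> B \<up> 1 \<cdot> V 0 \<Ztypecolon> U i"
    "\<And>t T. \<Gamma> \<turnstile> t \<Ztypecolon> T \<Longrightarrow> B \<up> 1 \<cdot> V 0 # A # \<Gamma> \<turnstile> t \<up> 2 \<Ztypecolon> T \<up> 2"
    "B \<up> 1 \<cdot> V 0 # A # \<Gamma> \<turnstile> V 1 \<Ztypecolon> A \<up> 2" "B \<up> 1 \<cdot> V 0 # A # \<Gamma> \<turnstile> V 0 \<Ztypecolon> B \<up> 2 \<cdot> V 1"
    "B \<up> 1 \<cdot> V 0 # A # \<Gamma> \<turnstile> pair (A \<up> 2) (B \<up> 2) (V 1) (V 0) \<Ztypecolon> sig (A \<up> 2) (B \<up> 2)"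
proof -
  note w = weak(1)[OF path_ctx_prefix(1)[OF A]]
  have "A # \<Gamma> \<turnstile> B \<up> 1 \<Ztypecolon> arr (A \<up> 1) (U i)" using w[OF B] by simp
  from ty_arrE[OF this ty_V0[OF A]] show T: "A # \<Gamma> \<turnstile> B \<up> 1 \<cdot> V 0 \<Ztypecolon> U i" .
  note w2 = weak(1)[OF wf_Cons[OF T]]
  show w3: "\<And>t T. \<Gamma> \<turnstile> t \<Ztypecolon> T \<Longrightarrow> B \<up> 1 \<cdot> V 0 # A # \<Gamma> \<turnstile> t \<up> 2 \<Ztypecolon> T \<up> 2" using w2[OF w] by simp
  show v1: "B \<up> 1 \<cdot> V 0 # A # \<Gamma> \<turnstile> V 1 \<Ztypecolon> A \<up> 2" using w2[OF ty_V0[OF A]] by simp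
  show v0: "B \<up> 1 \<cdot> V 0 # A # \<Gamma> \<turnstile> V 0 \<Ztypecolon> B \<up> 2 \<cdot> V 1" using ty_V0[OF T] by simp
  have *: "\<Delta> \<turnstile> pair A B a b \<Ztypecolon> sig A B" if A: "\<Delta> \<turnstile> A \<Ztypecolon> U i" and B: "\<Delta> \<turnstile> B \<Ztypecolon> arr A (U i)"
    and a: "\<Delta> \<turnstile> a \<Ztypecolon> A" and b: "\<Delta> \<turnstile> b \<Ztypecolon> B \<cdot> a" for \<Delta> A B a b
  proof -
    have "\<Delta> \<turnstile> Const cPair \<cdot> A \<Ztypecolon> Pi (arr A (U i)) (Pi (A \<up> 1) (arr (V 1 \<cdot> V 0) (sig (A \<up> 2) (V 1))))"
      by (rule ty_AppE[OF ty_Const[where c=cPair and i=i and j=0, simplified] A]) (use A typed_wf in simp_all)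
    then have "\<Delta> \<turnstile> Const cPair \<cdot> A \<cdot> B \<Ztypecolon> Pi A (arr (B \<up> 1 \<cdot> V 0) (sig (A \<up> 1) (B \<up> 1)))"
      by (rule ty_AppE[OF _ B]) simp
    then have "\<Delta> \<turnstile> Const cPair \<cdot> A \<cdot> B \<cdot> a \<Ztypecolon> arr (B \<cdot> a) (sig A B)"
      by (rule ty_AppE[OF _ a]) simp
    then show ?thesis unfolding pair_def by (rule ty_arrE[OF _ b])
  qed
  show "B \<up> 1 \<cdot> V 0 # A # \<Gamma> \<turnstile> pair (A \<up> 2) (B \<up> 2) (V 1) (V 0) \<Ztypecolon> sig (A \<up> 2) (B \<up> 2)"
    by (rule *[OF _ _ v1 v0]) (use w3[OF A] w3[OF B] in simp_all)
qed

text \<open>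
  A family over pairs, weakened to the context of the pair case and applied to the pair.
\<close>

lemma sig_fam_beta:
  assumes D: "sig A B # \<Gamma> \<turnstile> D \<Ztypecolon> U j"
  shows "B \<up> 1 \<cdot> V 0 # A # \<Gamma> \<turnstile> Lam (sig A B) D \<up> 2 \<cdot> pair (A \<up> 2) (B \<up> 2) (V 1) (V 0)
     \<doteq> inst (ren (upr (shift 2)) D) (pair (A \<up> 2) (B \<up> 2) (V 1) (V 0)) \<Ztypecolon> U j"
proof -
  have r: "is_ren (B \<up> 1 \<cdot> V 0 # A # \<Gamma>) (V \<circ> shift 2) \<Gamma>"
    unfolding is_ren_def using wf_Cons[OF sig_ctx(1)] by (intro conjI exI[of _ "shift 2"]) auto
  have "sig (A \<up> 2) (B \<up> 2) # B \<up> 1 \<cdot> V 0 # A # \<Gamma> \<turnstile> ren (upr (shift 2)) D \<Ztypecolon> U j"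
    using ren_ty[OF is_ren_up[OF r ty_sig[OF A B]] D] by simp
  from fam_beta[OF this sig_ctx(5) refl] show ?thesis by (simp add: numeral_2_eq_2)
qed

lemma proj1_case:
  "\<Gamma> \<turnstile> Lam (sig A B) (A \<up> 1) \<Ztypecolon> arr (sig A B) (U i)"
  "\<Gamma> \<turnstile> Lam A (Lam (B \<up> 1 \<cdot> V 0) (V 1)) \<Ztypecolon> case_sig A B (Lam (sig A B) (A \<up> 1))"
  "\<Gamma> \<turnstile> p \<Ztypecolon> sig A B \<Longrightarrow> \<Gamma> \<turnstile> Lam (sig A B) (A \<up> 1) \<cdot> p \<doteq> A \<Ztypecolon> U i"
proof -
  note wA = weakU[OF A wf_Cons[OF ty_sig[OF A B]]]
  show "\<Gamma> \<turnstile> Lam (sig A B) (A \<up> 1) \<Ztypecolon> arr (sig A B) (U i)"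
    by (rule ty_Lam_fam[OF wA])
  show "\<Gamma> \<turnstile> p \<Ztypecolon> sig A B \<Longrightarrow> \<Gamma> \<turnstile> Lam (sig A B) (A \<up> 1) \<cdot> p \<doteq> A \<Ztypecolon> U i"
    by (rule fam_beta[OF wA]) simp_all
  have "B \<up> 1 \<cdot> V 0 # A # \<Gamma> \<turnstile> V 1 \<Ztypecolon> Lam (sig A B) (A \<up> 1) \<up> 2 \<cdot> pair (A \<up> 2) (B \<up> 2) (V 1) (V 0)"
    by (rule ty_conv_sym[OF _ sig_fam_beta[OF wA]]) (use sig_ctx(3) in simp)
  then show "\<Gamma> \<turnstile> Lam A (Lam (B \<up> 1 \<cdot> V 0) (V 1)) \<Ztypecolon> case_sig A B (Lam (sig A B) (A \<up> 1))"
    unfolding case_sig_def by (intro ty_Lam)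
qed

lemma ty_proj1: "\<Gamma> \<turnstile> p \<Ztypecolon> sig A B \<Longrightarrow> \<Gamma> \<turnstile> proj1 A B p \<Ztypecolon> A"
  unfolding proj1_def
  by (rule ty_conv[OF ty_indSigma[OF A B proj1_case(1,2)] proj1_case(3)])

lemma proj1_pair:
  assumes a: "\<Gamma> \<turnstile> a \<Ztypecolon> A" and b: "\<Gamma> \<turnstile> b \<Ztypecolon> B \<cdot> a" and p: "\<Gamma> \<turnstile> pair A B a b \<Ztypecolon> sig A B"
  shows "\<Gamma> \<turnstile> proj1 A B (pair A B a b) \<doteq> a \<Ztypecolon> A"
proof -
  have "\<Gamma> \<turnstile> Lam A (Lam (B \<up> 1 \<cdot> V 0) (V 1)) \<cdot> a \<cdot> b \<doteq> a \<Ztypecolon> A"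
    by (rule beta_two[OF sig_ctx(1,3) a]) (simp_all add: b)
  then show ?thesis unfolding proj1_def
    using eq_trans[OF eq_conv[OF comp_Sigma[OF A B proj1_case(1,2) a b] proj1_case(3)[OF p]]] by blast
qed

end

lemma ty_htpy:
  assumes A: "\<Gamma> \<turnstile> A \<Ztypecolon> U i" and B: "\<Gamma> \<turnstile> B \<Ztypecolon> arr A (U i)"
    and f: "\<Gamma> \<turnstile> f \<Ztypecolon> piF A B" and g: "\<Gamma> \<turnstile> g \<Ztypecolon> piF A B"
  shows "\<Gamma> \<turnstile> htpy A B f g \<Ztypecolon> U i"
  unfolding htpy_def
proof (rule ty_Pi[OF A])
  note w = weak(1)[OF path_ctx_prefix(1)[OF A]] and v = ty_V0[OF A]
  show "A # \<Gamma> \<turnstile> idT (B \<up> 1 \<cdot> V 0) (f \<up> 1 \<cdot> V 0) (g \<up> 1 \<cdot> V 0) \<Ztypecolon> U i"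
    by (intro ty_idT ty_arrE[OF w[OF B, unfolded lift_defs lift_simps] v]
        ty_piFE[OF w[OF f, unfolded lift_defs lift_simps] v] ty_piFE[OF w[OF g, unfolded lift_defs lift_simps] v])
qed

text \<open>
  The type of the function extensionality constant mentions \<open>happly\<close>, so using the constant requires
  \<open>happly\<close> to be typed.
\<close>

lemma ty_happly:
  assumes A: "\<Gamma> \<turnstile> A \<Ztypecolon> U i" and B: "\<Gamma> \<turnstile> B \<Ztypecolon> arr A (U i)"
    and f: "\<Gamma> \<turnstile> f \<Ztypecolon> piF A B" and g: "\<Gamma> \<turnstile> g \<Ztypecolon> piF A B" and p: "\<Gamma> \<turnstile> p \<Ztypecolon> idT (piF A B) f g"
  shows "\<Gamma> \<turnstile> happly A B f g p \<Ztypecolon> htpy A B f g"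
proof -
  let ?P = "piF A B"
  have P: "\<Gamma> \<turnstile> ?P \<Ztypecolon> U i" by (rule ty_piF[OF A B]) simp_all
  have C: "path_ctx ?P \<Gamma> \<turnstile> htpy (A \<up> 3) (B \<up> 3) (V 2) (V 1) \<Ztypecolon> U i"
    by (rule ty_htpy) (use path_ctx_weak[OF P A] path_ctx_weak[OF P B] path_ctx_vars[OF P] in simp_all)
  note w = weak(1)[OF path_ctx_prefix(1)[OF P]]
  have A1: "?P # \<Gamma> \<turnstile> A \<up> 1 \<Ztypecolon> U i" and B1: "?P # \<Gamma> \<turnstile> B \<up> 1 \<Ztypecolon> arr (A \<up> 1) (U i)"
    and v0: "?P # \<Gamma> \<turnstile> V 0 \<Ztypecolon> piF (A \<up> 1) (B \<up> 1)"
    using w[OF A] w[OF B] ty_V0[OF P] by simp_all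
  note w2 = weak(1)[OF path_ctx_prefix(1)[OF A1]]
  let ?\<Gamma> = "A \<up> 1 # ?P # \<Gamma>"
  have B2: "?\<Gamma> \<turnstile> B \<up> 2 \<Ztypecolon> arr (A \<up> 2) (U i)" and v1: "?\<Gamma> \<turnstile> V 1 \<Ztypecolon> piF (A \<up> 2) (B \<up> 2)" and x: "?\<Gamma> \<turnstile> V 0 \<Ztypecolon> A \<up> 2"
    using w2[OF B1] w2[OF v0] ty_V0[OF A1] by simp_all
  have "?P # \<Gamma> \<turnstile> Lam (A \<up> 1) (rfl (B \<up> 2 \<cdot> V 0) (V 1 \<cdot> V 0)) \<Ztypecolon> htpy (A \<up> 1) (B \<up> 1) (V 0) (V 0)"
    using ty_Lam[OF ty_rfl[OF ty_arrE[OF B2 x] ty_piFE[OF v1 x]]] by (simp add: htpy_def)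
  then have "?P # \<Gamma> \<turnstile> Lam (A \<up> 1) (rfl (B \<up> 2 \<cdot> V 0) (V 1 \<cdot> V 0)) \<Ztypecolon>
     inst3 (ren (upr (upr (upr (shift 1)))) (htpy (A \<up> 3) (B \<up> 3) (V 2) (V 1))) (V 0) (V 0) (rfl (?P \<up> 1) (V 0))"
    by (simp add: inst3_def)
  from ty_indId_open(2)[OF P C this f g p refl]
  show ?thesis by (simp add: happly_def path_motive_def inst3_def)
qed

text \<open>
  An equivalence has an inverse map: two first projections. The typing of the projections requires
  that of both components of \<open>isequiv\<close>.
\<close>

lemma isequiv_inverse:
  assumes I: "\<Gamma> \<turnstile> I \<Ztypecolon> U i" and H: "\<Gamma> \<turnstile> H \<Ztypecolon> U i" and h: "\<Gamma> \<turnstile> h \<Ztypecolon> arr I H"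
    and q: "\<Gamma> \<turnstile> q \<Ztypecolon> isequiv I H h"
  shows "inh \<Gamma> (arr H I)"
proof -
  let ?G = "arr H I"
  note G = ty_arr[OF H I]
  have S: "\<Gamma> \<turnstile> sig ?G (Lam ?G (Pi (K \<up> 1) t)) \<Ztypecolon> U i" "\<Gamma> \<turnstile> Lam ?G (Pi (K \<up> 1) t) \<Ztypecolon> arr ?G (U i)"
    if "\<Gamma> \<turnstile> K \<Ztypecolon> U i" "K \<up> 1 # ?G # \<Gamma> \<turnstile> t \<Ztypecolon> U i" for K t
    using ty_sig[OF G] ty_Lam_fam[OF ty_Pi[OF weakU[OF that(1) path_ctx_prefix(1)[OF G]] that(2)]] by blast+
  have ctx: "K \<up> 1 # ?G # \<Gamma> \<turnstile> I \<up> 2 \<Ztypecolon> U i" "K \<up> 1 # ?G # \<Gamma> \<turnstile> H \<up> 2 \<Ztypecolon> U i"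
    "K \<up> 1 # ?G # \<Gamma> \<turnstile> h \<up> 2 \<Ztypecolon> arr (I \<up> 2) (H \<up> 2)"
    "K \<up> 1 # ?G # \<Gamma> \<turnstile> V 1 \<Ztypecolon> arr (H \<up> 2) (I \<up> 2)" "K \<up> 1 # ?G # \<Gamma> \<turnstile> V 0 \<Ztypecolon> K \<up> 2"
    if K: "\<Gamma> \<turnstile> K \<Ztypecolon> U i" for K
  proof -
    note w = weak(1)[OF path_ctx_prefix(1)[OF G]] and K1 = weakU[OF K path_ctx_prefix(1)[OF G]]
    note w2 = weak(1)[OF path_ctx_prefix(1)[OF K1]]
    show "K \<up> 1 # ?G # \<Gamma> \<turnstile> I \<up> 2 \<Ztypecolon> U i" "K \<up> 1 # ?G # \<Gamma> \<turnstile> H \<up> 2 \<Ztypecolon> U i"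
      "K \<up> 1 # ?G # \<Gamma> \<turnstile> h \<up> 2 \<Ztypecolon> arr (I \<up> 2) (H \<up> 2)"
      "K \<up> 1 # ?G # \<Gamma> \<turnstile> V 1 \<Ztypecolon> arr (H \<up> 2) (I \<up> 2)" "K \<up> 1 # ?G # \<Gamma> \<turnstile> V 0 \<Ztypecolon> K \<up> 2"
      using w2[OF w[OF I]] w2[OF w[OF H]] w2[OF w[OF h]] w2[OF ty_V0[OF G]] ty_V0[OF K1] by simp_all
  qed
  have "H \<up> 1 # ?G # \<Gamma> \<turnstile> idT (H \<up> 2) (h \<up> 2 \<cdot> (V 1 \<cdot> V 0)) (V 0) \<Ztypecolon> U i"
    by (rule ty_idT[OF ctx(2)[OF H] ty_arrE[OF ctx(3)[OF H] ty_arrE[OF ctx(4,5)[OF H]]] ctx(5)[OF H]])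
  note S1 = S[OF H this]
  have "I \<up> 1 # ?G # \<Gamma> \<turnstile> idT (I \<up> 2) (V 1 \<cdot> (h \<up> 2 \<cdot> V 0)) (V 0) \<Ztypecolon> U i"
    by (rule ty_idT[OF ctx(1)[OF I] ty_arrE[OF ctx(4)[OF I] ty_arrE[OF ctx(3,5)[OF I]]] ctx(5)[OF I]])
  note S2 = S(1)[OF I this]
  show ?thesis
    by (rule inhI[OF ty_proj1[OF G S1(2) ty_proj1[OF S1(1) ty_Lam_fam[OF weakU[OF S2 path_ctx_prefix(1)[OF S1(1)]]]
        q[unfolded isequiv_def prodT_def]]]])
qed

lemma funext:
  assumes A: "\<Gamma> \<turnstile> A \<Ztypecolon> U i" and B: "\<Gamma> \<turnstile> B \<Ztypecolon> arr A (U i)"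
    and f: "\<Gamma> \<turnstile> f \<Ztypecolon> piF A B" and g: "\<Gamma> \<turnstile> g \<Ztypecolon> piF A B" and h: "inh \<Gamma> (htpy A B f g)"
  shows "inh \<Gamma> (idT (piF A B) f g)"
proof -
  let ?P = "piF A B"
  let ?h = "Lam (idT ?P f g) (happly (A \<up> 1) (B \<up> 1) (f \<up> 1) (g \<up> 1) (V 0))"
  have "\<Gamma> \<turnstile> Const cFunext \<cdot> A \<Ztypecolon> Pi (arr A (U i)) (Pi (piF (A \<up> 1) (V 0)) (Pi (piF (A \<up> 2) (V 1))
     (isequiv (idT (piF (A \<up> 3) (V 2)) (V 1) (V 0)) (htpy (A \<up> 3) (V 2) (V 1) (V 0))
        (Lam (idT (piF (A \<up> 3) (V 2)) (V 1) (V 0)) (happly (A \<up> 4) (V 3) (V 2) (V 1) (V 0))))))"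
    by (rule ty_AppE[OF ty_Const[where c=cFunext and i=i and j=0, simplified] A]) (use A typed_wf in simp_all)
  then have "\<Gamma> \<turnstile> Const cFunext \<cdot> A \<cdot> B \<Ztypecolon> Pi ?P (Pi (?P \<up> 1)
     (isequiv (idT (?P \<up> 2) (V 1) (V 0)) (htpy (A \<up> 2) (B \<up> 2) (V 1) (V 0))
        (Lam (idT (?P \<up> 2) (V 1) (V 0)) (happly (A \<up> 3) (B \<up> 3) (V 2) (V 1) (V 0)))))"
    by (rule ty_AppE[OF _ B]) simp
  then have "\<Gamma> \<turnstile> Const cFunext \<cdot> A \<cdot> B \<cdot> f \<Ztypecolon> Pi ?P
     (isequiv (idT (?P \<up> 1) (f \<up> 1) (V 0)) (htpy (A \<up> 1) (B \<up> 1) (f \<up> 1) (V 0))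
        (Lam (idT (?P \<up> 1) (f \<up> 1) (V 0)) (happly (A \<up> 2) (B \<up> 2) (f \<up> 2) (V 1) (V 0))))"
    by (rule ty_AppE[OF _ f]) simp
  then have q: "\<Gamma> \<turnstile> Const cFunext \<cdot> A \<cdot> B \<cdot> f \<cdot> g \<Ztypecolon> isequiv (idT ?P f g) (htpy A B f g) ?h"
    by (rule ty_AppE[OF _ g]) simp
  have P: "\<Gamma> \<turnstile> ?P \<Ztypecolon> U i" by (rule ty_piF[OF A B]) simp_all
  note I = ty_idT[OF P f g] and H = ty_htpy[OF A B f g]
  note w = weak(1)[OF path_ctx_prefix(1)[OF I]]
  have "idT ?P f g # \<Gamma> \<turnstile> happly (A \<up> 1) (B \<up> 1) (f \<up> 1) (g \<up> 1) (V 0) \<Ztypecolon> htpy A B f g \<up> 1"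
    using ty_happly[of _ "A \<up> 1" i "B \<up> 1" "f \<up> 1" "g \<up> 1" "V 0"] w[OF A] w[OF B] w[OF f] w[OF g] ty_V0[OF I] by simp
  from inh_arrE[OF isequiv_inverse[OF I H ty_Lam_arr[OF this] q] h] show ?thesis .
qed

text \<open>
  Being contracted to \<open>x\<close> is a proposition: if it holds then \<open>X\<close> is a set, so two contractions agree
  pointwise, and function extensionality identifies them.
\<close>

lemma isprop_contraction:
  assumes X: "\<Gamma> \<turnstile> X \<Ztypecolon> U i" and x: "\<Gamma> \<turnstile> x \<Ztypecolon> X"
  shows "inh \<Gamma> (isprop (piF X (paths X x)))"
proof -
  have eq: "inh \<Delta> (idT (piF Y (paths Y y)) k k')"
    if Y: "\<Delta> \<turnstile> Y \<Ztypecolon> U i" and y: "\<Delta> \<turnstile> y \<Ztypecolon> Y" and k: "\<Delta> \<turnstile> k \<Ztypecolon> piF Y (paths Y y)"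
      and k': "\<Delta> \<turnstile> k' \<Ztypecolon> piF Y (paths Y y)" for \<Delta> Y y k k'
  proof (rule funext[OF Y ty_paths(1)[OF Y y] k k'])
    note w = weak(1)[OF path_ctx_prefix(1)[OF Y]]
    let ?\<Gamma> = "Y # \<Delta>"
    have Y1: "?\<Gamma> \<turnstile> Y \<up> 1 \<Ztypecolon> U i" and y1: "?\<Gamma> \<turnstile> y \<up> 1 \<Ztypecolon> Y \<up> 1" and v: "?\<Gamma> \<turnstile> V 0 \<Ztypecolon> Y \<up> 1"
      and k1: "?\<Gamma> \<turnstile> k \<up> 1 \<Ztypecolon> piF (Y \<up> 1) (paths (Y \<up> 1) (y \<up> 1))"
      and k1': "?\<Gamma> \<turnstile> k' \<up> 1 \<Ztypecolon> piF (Y \<up> 1) (paths (Y \<up> 1) (y \<up> 1))"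
      using w[OF Y] w[OF y] w[OF k] w[OF k'] ty_V0[OF Y] by simp_all
    note b = paths_beta(1)[OF Y1 y1 v]
    note a = ty_piFE[OF k1 v] and a' = ty_piFE[OF k1' v]
    note c = contr_set[OF Y1 y1 k1 y1 v ty_conv[OF a b] ty_conv[OF a' b]]
    from inh_conv[OF c idT_cong_ty[OF eq_sym[OF b] eq_refl[OF ty_conv[OF a b]] eq_refl[OF ty_conv[OF a' b]]]]
    show "inh \<Delta> (htpy Y (paths Y y) k k')" unfolding htpy_def by (intro inh_Pi) simp
  qed
  let ?Q = "piF X (paths X x)"
  have Q: "\<Gamma> \<turnstile> ?Q \<Ztypecolon> U i" by (rule ty_piF[OF X ty_paths(1)[OF X x]]) simp_all
  note w = weak(1)[OF path_ctx_prefix(1)[OF Q]] and w2 = weak(1)[OF path_ctx_prefix(3)[OF Q]]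
  let ?\<Gamma> = "?Q \<up> 1 # ?Q # \<Gamma>"
  have "?\<Gamma> \<turnstile> X \<up> 2 \<Ztypecolon> U i" "?\<Gamma> \<turnstile> x \<up> 2 \<Ztypecolon> X \<up> 2" "?\<Gamma> \<turnstile> V 1 \<Ztypecolon> piF (X \<up> 2) (paths (X \<up> 2) (x \<up> 2))"
    "?\<Gamma> \<turnstile> V 0 \<Ztypecolon> piF (X \<up> 2) (paths (X \<up> 2) (x \<up> 2))"
    using w2[OF w[OF X]] w2[OF w[OF x]] w2[OF ty_V0[OF Q]] ty_V0[OF path_ctx_prefix(2)[OF Q]] by simp_all
  from eq[OF this] show ?thesis unfolding isprop_def by (intro inh_Pi) simp
qed

section \<open>Elimination of the one-step truncation into propositions\<close>

lemma ty_indTr: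
  assumes A: "\<Gamma> \<turnstile> A \<Ztypecolon> U i" and P: "\<Gamma> \<turnstile> P \<Ztypecolon> arr (tr A) (U j)"
    and h: "\<Gamma> \<turnstile> h \<Ztypecolon> case_trpt A P" and q: "\<Gamma> \<turnstile> q \<Ztypecolon> case_trpath A P h"
  shows "\<Gamma> \<turnstile> Const cIndTr \<cdot> A \<cdot> P \<cdot> h \<cdot> q \<Ztypecolon> piF (tr A) P"
proof -
  have "\<Gamma> \<turnstile> Const cIndTr \<cdot> A \<Ztypecolon> Pi (arr (tr A) (U j)) (Pi (case_trpt (A \<up> 1) (V 0))
     (arr (case_trpath (A \<up> 2) (V 1) (V 0)) (piF (tr (A \<up> 2)) (V 1))))"
    by (rule ty_AppE[OF ty_Const[where c=cIndTr and i=i and j=j, simplified] A]) (use A typed_wf in simp_all)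
  then have "\<Gamma> \<turnstile> Const cIndTr \<cdot> A \<cdot> P \<Ztypecolon> Pi (case_trpt A P)
     (arr (case_trpath (A \<up> 1) (P \<up> 1) (V 0)) (piF (tr (A \<up> 1)) (P \<up> 1)))"
    by (rule ty_AppE[OF _ P]) simp
  then have "\<Gamma> \<turnstile> Const cIndTr \<cdot> A \<cdot> P \<cdot> h \<Ztypecolon> arr (case_trpath A P h) (piF (tr A) P)"
    by (rule ty_AppE[OF _ h]) simp
  then show ?thesis by (rule ty_arrE[OF _ q])
qed

text \<open>
  A family given by an open term, applied to the generic variable, is that term again.
\<close>

lemma fam_beta_V0: "A # \<Gamma> \<turnstile> B \<Ztypecolon> U j \<Longrightarrow> \<Gamma> \<turnstile> A \<Ztypecolon> U i \<Longrightarrow> A # \<Gamma> \<turnstile> Lam A B \<up> 1 \<cdot> V 0 \<doteq> B \<Ztypecolon> U j"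
proof -
  assume B: "A # \<Gamma> \<turnstile> B \<Ztypecolon> U j" and A: "\<Gamma> \<turnstile> A \<Ztypecolon> U i"
  have r: "is_ren (A \<up> 1 # A # \<Gamma>) (V \<circ> upr (shift 1)) (A # \<Gamma>)"
    using is_ren_up[OF is_ren_weak[OF path_ctx_prefix(1)[OF A]] A] by simp
  have B': "A \<up> 1 # A # \<Gamma> \<turnstile> ren (upr (shift 1)) B \<Ztypecolon> U j" using ren_ty[OF r B] by simp
  have "single (V 0) \<circ> upr (shift 1) = V"
    by (rule ext, rename_tac n, case_tac n; simp)
  then have "inst (ren (upr (shift 1)) B) (V 0) = B"
    unfolding inst_single sub_ren by (simp add: sub_V)
  with fam_beta[OF B' ty_V0[OF A] refl] show ?thesis by simp
qed

lemma prop_eq: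
  assumes "inh \<Gamma> (isprop T)" "\<Gamma> \<turnstile> x \<Ztypecolon> T" "\<Gamma> \<turnstile> y \<Ztypecolon> T"
  shows "inh \<Gamma> (idT T x y)"
  using assms isprop_app unfolding inh_def by blast

lemma inh_isprop_fam:
  assumes P: "\<Gamma> \<turnstile> P \<Ztypecolon> arr A (U j)" and w: "inh \<Gamma> (Pi A (isprop (P \<up> 1 \<cdot> V 0)))" and x: "\<Gamma> \<turnstile> x \<Ztypecolon> A"
  shows "inh \<Gamma> (isprop (P \<cdot> x))"
  by (rule inh_PiE[OF w x]) simp

lemma inh_weak: "inh \<Gamma> T \<Longrightarrow> wf (B # \<Gamma>) \<Longrightarrow> T' = T \<up> 1 \<Longrightarrow> inh (B # \<Gamma>) T'"
  unfolding inh_def using weak by blast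

text \<open>
  For families of propositions the path case of the one-step truncation comes for free.
\<close>

lemma tr_prop_elim:
  assumes A: "\<Gamma> \<turnstile> A \<Ztypecolon> U i" and P: "\<Gamma> \<turnstile> P \<Ztypecolon> arr (tr A) (U j)"
    and w: "inh \<Gamma> (Pi (tr A) (isprop (P \<up> 1 \<cdot> V 0)))" and h: "inh \<Gamma> (case_trpt A P)"
  shows "inh \<Gamma> (piF (tr A) P)"
proof -
  from h obtain h where h: "\<Gamma> \<turnstile> h \<Ztypecolon> case_trpt A P" unfolding inh_def by blast
  note w1 = weak(1)[OF path_ctx_prefix(1)[OF A]] and w2 = weak(1)[OF path_ctx_prefix(3)[OF A]]
  let ?\<Gamma> = "A \<up> 1 # A # \<Gamma>"
  have A2: "?\<Gamma> \<turnstile> A \<up> 2 \<Ztypecolon> U i" and P2: "?\<Gamma> \<turnstile> P \<up> 2 \<Ztypecolon> arr (tr (A \<up> 2)) (U j)"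
    and h2: "?\<Gamma> \<turnstile> h \<up> 2 \<Ztypecolon> Pi (A \<up> 2) (P \<up> 3 \<cdot> trpt (A \<up> 3) (V 0))"
    and v1: "?\<Gamma> \<turnstile> V 1 \<Ztypecolon> A \<up> 2" and v0: "?\<Gamma> \<turnstile> V 0 \<Ztypecolon> A \<up> 2"
    using w2[OF w1[OF A]] w2[OF w1[OF P]] w2[OF w1[OF h]] w2[OF ty_V0[OF A]] ty_V0[OF path_ctx_prefix(2)[OF A]]
    by (simp_all add: case_trpt_def)
  have ww: "inh ?\<Gamma> (Pi (tr (A \<up> 2)) (isprop (P \<up> 2 \<up> 1 \<cdot> V 0)))"
    by (rule inh_weak[OF inh_weak[OF w path_ctx_prefix(1)[OF A] refl] path_ctx_prefix(3)[OF A]]) simp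
  have hv: "?\<Gamma> \<turnstile> h \<up> 2 \<cdot> x \<Ztypecolon> P \<up> 2 \<cdot> trpt (A \<up> 2) x" if x: "?\<Gamma> \<turnstile> x \<Ztypecolon> A \<up> 2" for x
    by (rule ty_AppE[OF h2 x]) simp
  note T = ty_trpt[OF A2 v1] ty_trpt[OF A2 v0]
  have "inh \<Gamma> (case_trpath A P h)"
    unfolding case_trpath_def
    by (intro inh_Pi prop_eq[OF inh_isprop_fam[OF P2 ww T(2)] ty_transp[OF ty_tr[OF A2] P2 T ty_trpath[OF A2 v1 v0] hv[OF v1]] hv[OF v0]])
  then show ?thesis using ty_indTr[OF A P h] unfolding inh_def by blast
qed

section \<open>The sequence of iterated one-step truncations\<close>

lemma sub_iter_tr [simp]: "sub r (iter_tr i A) = iter_tr i (sub r A)"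
  by (simp add: iter_tr_def)

lemmas ren_iter_tr [simp] = sub_iter_tr[of "V \<circ> r" for r, folded ren_eq_sub]

lemmas lift_iter_tr [simp] = ren_iter_tr[of "shift n" for n, unfolded ren_shift]

lemma sub_iter [simp]:
  "sub r (iter_map i A) = iter_map i (sub r A)"
  "sub r (tr_inf i A) = tr_inf i (sub r A)"
  "sub r (i0 i A) = i0 i (sub r A)"
  by (simp_all add: iter_map_def tr_inf_def i0_def)

lemmas ren_iter [simp] = sub_iter[of "V \<circ> r" for r, folded ren_eq_sub]

lemmas lift_iter [simp] = ren_iter[of "shift n" for n, unfolded ren_shift]

lemmas inst_iter [simp] = sub_iter_tr[of "single a" for a, unfolded sub_single_inst]
  sub_iter[of "single a" for a, unfolded sub_single_inst]

text \<open>
  The motive and the step of the recursion that defines the sequence. The motive takes values in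
  \<open>U (Suc i)\<close>, being the constant family \<open>U i\<close>.
\<close>

definition univ_fam :: "nat \<Rightarrow> tm" where "univ_fam i = Lam natT (U i)"

definition tr_step :: "nat \<Rightarrow> tm" where "tr_step i = Lam natT (Lam (U i) (tr (V 0)))"

lemma univ_fam_simps [simp]:
  "ren r (univ_fam i) = univ_fam i" "sub s (univ_fam i) = univ_fam i" "univ_fam i \<up> n = univ_fam i" "inst (univ_fam i) a = univ_fam i"
  "ren r (tr_step i) = tr_step i" "sub s (tr_step i) = tr_step i" "tr_step i \<up> n = tr_step i" "inst (tr_step i) a = tr_step i"
  by (simp_all add: univ_fam_def tr_step_def)

lemma univ_fam_facts:
  assumes wf: "wf \<Gamma>"
  shows "\<Gamma> \<turnstile> univ_fam i \<Ztypecolon> arr natT (U (Suc i))"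
    "\<Gamma> \<turnstile> n \<Ztypecolon> natT \<Longrightarrow> \<Gamma> \<turnstile> univ_fam i \<cdot> n \<doteq> U i \<Ztypecolon> U (Suc i)"
    "\<Gamma> \<turnstile> tr_step i \<Ztypecolon> case_succ (univ_fam i)"
    "\<Gamma> \<turnstile> n \<Ztypecolon> natT \<Longrightarrow> \<Gamma> \<turnstile> X \<Ztypecolon> U i \<Longrightarrow> \<Gamma> \<turnstile> tr_step i \<cdot> n \<cdot> X \<doteq> tr X \<Ztypecolon> U i"
proof -
  have f: "\<Delta> \<turnstile> univ_fam i \<Ztypecolon> arr natT (U (Suc i))" "\<Delta> \<turnstile> n \<Ztypecolon> natT \<Longrightarrow> \<Delta> \<turnstile> univ_fam i \<cdot> n \<doteq> U i \<Ztypecolon> U (Suc i)"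
    if "wf \<Delta>" for \<Delta> n
  proof -
    have "natT # \<Delta> \<turnstile> U i \<Ztypecolon> U (Suc i)" using ty_natT[OF that] ty_U wf_Cons by blast
    then show "\<Delta> \<turnstile> univ_fam i \<Ztypecolon> arr natT (U (Suc i))" "\<Delta> \<turnstile> n \<Ztypecolon> natT \<Longrightarrow> \<Delta> \<turnstile> univ_fam i \<cdot> n \<doteq> U i \<Ztypecolon> U (Suc i)"
      unfolding univ_fam_def by (rule ty_Lam_fam fam_beta | assumption | simp)+
  qed
  show "\<Gamma> \<turnstile> univ_fam i \<Ztypecolon> arr natT (U (Suc i))" "\<Gamma> \<turnstile> n \<Ztypecolon> natT \<Longrightarrow> \<Gamma> \<turnstile> univ_fam i \<cdot> n \<doteq> U i \<Ztypecolon> U (Suc i)"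
    using f wf by blast+
  have N: "wf (natT # \<Gamma>)" using ty_natT[OF wf] wf_Cons by blast
  have v: "natT # \<Gamma> \<turnstile> V 0 \<Ztypecolon> natT" using ty_V0[OF ty_natT[OF wf]] by simp
  note Ui = ty_U[OF N, of i]
  have N2: "wf (U i # natT # \<Gamma>)" using wf_Cons[OF Ui] .
  have t: "U i # natT # \<Gamma> \<turnstile> tr (V 0) \<Ztypecolon> U i" using ty_tr ty_V0[OF Ui] by simp
  show "\<Gamma> \<turnstile> n \<Ztypecolon> natT \<Longrightarrow> \<Gamma> \<turnstile> X \<Ztypecolon> U i \<Longrightarrow> \<Gamma> \<turnstile> tr_step i \<cdot> n \<cdot> X \<doteq> tr X \<Ztypecolon> U i"
    unfolding tr_step_def by (rule beta_two[OF Ui t]) simp_all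
  have v1: "U i # natT # \<Gamma> \<turnstile> V 1 \<Ztypecolon> natT" using weak(1)[OF N2 v] by simp
  have "natT # \<Gamma> \<turnstile> Pi (U i) (U i) \<doteq> Pi (univ_fam i \<cdot> V 0) (univ_fam i \<cdot> succ (V 1)) \<Ztypecolon> U (Suc i)"
    by (intro eq_Pi eq_sym[OF f(2)] N N2 v ty_succ[OF v1])
  from ty_Lam[OF ty_conv[OF ty_Lam[OF t] this]]
  show "\<Gamma> \<turnstile> tr_step i \<Ztypecolon> case_succ (univ_fam i)"
    by (simp add: tr_step_def case_succ_def arr_def)
qed

lemma iter_tr_alt: "iter_tr i A = Lam natT (Const cIndNat \<cdot> univ_fam i \<cdot> A \<up> 1 \<cdot> tr_step i \<cdot> V 0)"
  by (simp add: iter_tr_def univ_fam_def tr_step_def)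

context
  fixes \<Gamma> A i
  assumes A: "\<Gamma> \<turnstile> A \<Ztypecolon> U i"
begin

lemma iter_rec:
  "\<Gamma> \<turnstile> A \<Ztypecolon> univ_fam i \<cdot> zero"
  "\<Gamma> \<turnstile> n \<Ztypecolon> natT \<Longrightarrow> \<Gamma> \<turnstile> Const cIndNat \<cdot> univ_fam i \<cdot> A \<cdot> tr_step i \<cdot> n \<Ztypecolon> U i"
proof -
  have wf: "wf \<Gamma>" using typed_wf A by blast
  note u = univ_fam_facts[OF wf]
  show z: "\<Gamma> \<turnstile> A \<Ztypecolon> univ_fam i \<cdot> zero" by (rule ty_conv_sym[OF A u(2)[OF ty_zero[OF wf]]])
  show "\<Gamma> \<turnstile> n \<Ztypecolon> natT \<Longrightarrow> \<Gamma> \<turnstile> Const cIndNat \<cdot> univ_fam i \<cdot> A \<cdot> tr_step i \<cdot> n \<Ztypecolon> U i"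
    by (rule ty_conv[OF ty_piFE[OF ty_indNat_const[OF u(1) z u(3)]] u(2)])
qed

end

context
  fixes \<Gamma> A i
  assumes A: "\<Gamma> \<turnstile> A \<Ztypecolon> U i"
begin

lemma iter_open: "natT # \<Gamma> \<turnstile> Const cIndNat \<cdot> univ_fam i \<cdot> A \<up> 1 \<cdot> tr_step i \<cdot> V 0 \<Ztypecolon> U i"
proof -
  have wf: "wf \<Gamma>" using typed_wf A by blast
  have N: "wf (natT # \<Gamma>)" using ty_natT[OF wf] wf_Cons by blast
  show ?thesis using iter_rec(2)[OF weakU[OF A N]] ty_V0[OF ty_natT[OF wf]] by simp
qed

lemma ty_iter: "\<Gamma> \<turnstile> iter_tr i A \<Ztypecolon> arr natT (U i)"
  unfolding iter_tr_alt by (rule ty_Lam_fam[OF iter_open])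

lemma iter_beta:
  "\<Gamma> \<turnstile> n \<Ztypecolon> natT \<Longrightarrow> \<Gamma> \<turnstile> iter_tr i A \<cdot> n \<doteq> Const cIndNat \<cdot> univ_fam i \<cdot> A \<cdot> tr_step i \<cdot> n \<Ztypecolon> U i"
  unfolding iter_tr_alt by (rule fam_beta[OF iter_open]) simp_all

lemma iter_zero: "\<Gamma> \<turnstile> iter_tr i A \<cdot> zero \<doteq> A \<Ztypecolon> U i"
proof -
  have wf: "wf \<Gamma>" using typed_wf A by blast
  note u = univ_fam_facts[OF wf] and z = ty_zero[OF wf]
  show ?thesis
    by (rule eq_trans[OF iter_beta[OF z] eq_conv[OF comp_Zero[OF u(1) iter_rec(1)[OF A] u(3)] u(2)[OF z]]])
qed

text \<open>
  The recursion computes, so level \<open>n+1\<close> is judgmentally the one-step truncation of level \<open>n\<close>.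
\<close>

lemma iter_succ:
  assumes n: "\<Gamma> \<turnstile> n \<Ztypecolon> natT"
  shows "\<Gamma> \<turnstile> iter_tr i A \<cdot> succ n \<doteq> tr (iter_tr i A \<cdot> n) \<Ztypecolon> U i"
proof -
  have wf: "wf \<Gamma>" using typed_wf A by blast
  note u = univ_fam_facts[OF wf] and s = ty_succ[OF n]
  let ?r = "Const cIndNat \<cdot> univ_fam i \<cdot> A \<cdot> tr_step i \<cdot> n"
  have "\<Gamma> \<turnstile> Const cTr \<Ztypecolon> arr (U i) (U i)" using ty_Const[OF wf, of cTr i 0] by simp
  from eq_App_arr[OF eq_refl[OF this] eq_sym[OF iter_beta[OF n]]]
  have "\<Gamma> \<turnstile> tr ?r \<doteq> tr (iter_tr i A \<cdot> n) \<Ztypecolon> U i" unfolding tr_def .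
  then show ?thesis
    by (rule eq_trans[OF iter_beta[OF s] eq_trans[OF eq_conv[OF comp_Succ[OF u(1) iter_rec(1)[OF A] u(3) n] u(2)[OF s]]
          eq_trans[OF u(4)[OF n iter_rec(2)[OF A n]]]]])
qed

lemma ty_iter_app: "\<Gamma> \<turnstile> n \<Ztypecolon> natT \<Longrightarrow> \<Gamma> \<turnstile> iter_tr i A \<cdot> n \<Ztypecolon> U i"
  by (rule ty_arrE[OF ty_iter])

lemma ty_trpt_iter:
  assumes n: "\<Gamma> \<turnstile> n \<Ztypecolon> natT" and a: "\<Gamma> \<turnstile> a \<Ztypecolon> iter_tr i A \<cdot> n"
  shows "\<Gamma> \<turnstile> trpt (iter_tr i A \<cdot> n) a \<Ztypecolon> iter_tr i A \<cdot> succ n"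
  by (rule ty_conv_sym[OF ty_trpt[OF ty_iter_app[OF n] a] iter_succ[OF n]])

end

lemma iter_ctx:
  assumes A: "\<Gamma> \<turnstile> A \<Ztypecolon> U i"
  shows "natT # \<Gamma> \<turnstile> iter_tr i A \<up> 1 \<cdot> V 0 \<Ztypecolon> U i"
    "iter_tr i A \<up> 1 \<cdot> V 0 # natT # \<Gamma> \<turnstile> A \<up> 2 \<Ztypecolon> U i"
    "iter_tr i A \<up> 1 \<cdot> V 0 # natT # \<Gamma> \<turnstile> V 1 \<Ztypecolon> natT"
    "iter_tr i A \<up> 1 \<cdot> V 0 # natT # \<Gamma> \<turnstile> V 0 \<Ztypecolon> iter_tr i A \<up> 2 \<cdot> V 1"
    "\<And>t T. \<Gamma> \<turnstile> t \<Ztypecolon> T \<Longrightarrow> iter_tr i A \<up> 1 \<cdot> V 0 # natT # \<Gamma> \<turnstile> t \<up> 2 \<Ztypecolon> T \<up> 2"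
    "wf (natT # \<Gamma>)"
proof -
  have wf: "wf \<Gamma>" using typed_wf A by blast
  show N: "wf (natT # \<Gamma>)" using ty_natT[OF wf] wf_Cons by blast
  have v: "natT # \<Gamma> \<turnstile> V 0 \<Ztypecolon> natT" using ty_V0[OF ty_natT[OF wf]] by simp
  show T: "natT # \<Gamma> \<turnstile> iter_tr i A \<up> 1 \<cdot> V 0 \<Ztypecolon> U i"
    using ty_iter_app[OF weakU[OF A N] v] by simp
  note w = weak(1)[OF wf_Cons[OF T]]
  show ww: "\<And>t T. \<Gamma> \<turnstile> t \<Ztypecolon> T \<Longrightarrow> iter_tr i A \<up> 1 \<cdot> V 0 # natT # \<Gamma> \<turnstile> t \<up> 2 \<Ztypecolon> T \<up> 2"
    using w[OF weak(1)[OF N]] by simp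
  show "iter_tr i A \<up> 1 \<cdot> V 0 # natT # \<Gamma> \<turnstile> A \<up> 2 \<Ztypecolon> U i"
    "iter_tr i A \<up> 1 \<cdot> V 0 # natT # \<Gamma> \<turnstile> V 1 \<Ztypecolon> natT"
    "iter_tr i A \<up> 1 \<cdot> V 0 # natT # \<Gamma> \<turnstile> V 0 \<Ztypecolon> iter_tr i A \<up> 2 \<cdot> V 1"
    using ww[OF A] w[OF v] ty_V0[OF T] by simp_all
qed

lemma ty_iter_map:
  assumes A: "\<Gamma> \<turnstile> A \<Ztypecolon> U i"
  shows "\<Gamma> \<turnstile> iter_map i A \<Ztypecolon> seqmaps (iter_tr i A)"
proof -
  note c = iter_ctx[OF A]
  have "iter_tr i A \<up> 1 \<cdot> V 0 # natT # \<Gamma> \<turnstile> trpt (iter_tr i A \<up> 2 \<cdot> V 1) (V 0) \<Ztypecolon> iter_tr i A \<up> 2 \<cdot> succ (V 1)"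
    using ty_trpt_iter[OF c(2,3), of "V 0"] c(4) by simp
  from ty_Lam[OF ty_Lam[OF this]] show ?thesis by (simp add: iter_map_def seqmaps_def arr_def)
qed

lemma iter_map_beta:
  assumes A: "\<Gamma> \<turnstile> A \<Ztypecolon> U i" and n: "\<Gamma> \<turnstile> n \<Ztypecolon> natT" and a: "\<Gamma> \<turnstile> a \<Ztypecolon> iter_tr i A \<cdot> n"
  shows "\<Gamma> \<turnstile> iter_map i A \<cdot> n \<cdot> a \<doteq> trpt (iter_tr i A \<cdot> n) a \<Ztypecolon> iter_tr i A \<cdot> succ n"
proof -
  note c = iter_ctx[OF A]
  have "iter_tr i A \<up> 1 \<cdot> V 0 # natT # \<Gamma> \<turnstile> trpt (iter_tr i A \<up> 2 \<cdot> V 1) (V 0) \<Ztypecolon> iter_tr i A \<up> 2 \<cdot> succ (V 1)"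
    using ty_trpt_iter[OF c(2,3), of "V 0"] c(4) by simp
  from beta_two[OF c(1) this n _ refl refl] a show ?thesis by (simp add: iter_map_def)
qed

text \<open>
  The maps of the sequence are point constructors, hence weakly constant by the path constructors.
\<close>

lemma iter_map_wconst:
  assumes A: "\<Gamma> \<turnstile> A \<Ztypecolon> U i"
  shows "inh \<Gamma> (wconst (iter_tr i A) (iter_map i A))"
proof -
  have eq: "inh \<Delta> (idT (iter_tr i B \<cdot> succ n) (iter_map i B \<cdot> n \<cdot> a) (iter_map i B \<cdot> n \<cdot> b))"
    if B: "\<Delta> \<turnstile> B \<Ztypecolon> U i" and n: "\<Delta> \<turnstile> n \<Ztypecolon> natT" and a: "\<Delta> \<turnstile> a \<Ztypecolon> iter_tr i B \<cdot> n"
      and b: "\<Delta> \<turnstile> b \<Ztypecolon> iter_tr i B \<cdot> n" for \<Delta> B n a b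
  proof -
    note s = iter_succ[OF B n]
    note m = eq_conv[OF eq_sym[OF iter_map_beta[OF B n]] s]
    show ?thesis
      by (rule inh_conv[OF inhI[OF ty_trpath[OF ty_iter_app[OF B n] a b]] idT_cong_ty[OF eq_sym[OF s] m[OF a] m[OF b]]])
  qed
  note c = iter_ctx[OF A]
  let ?G = "iter_tr i A \<up> 1 \<cdot> V 0 # natT # \<Gamma>"
  have T: "?G \<turnstile> iter_tr i A \<up> 2 \<cdot> V 1 \<Ztypecolon> U i" using ty_iter_app[OF c(2,3)] by simp
  note w = weak(1)[OF wf_Cons[OF T]]
  have "iter_tr i A \<up> 2 \<cdot> V 1 # ?G \<turnstile> A \<up> 3 \<Ztypecolon> U i" "iter_tr i A \<up> 2 \<cdot> V 1 # ?G \<turnstile> V 2 \<Ztypecolon> natT"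
    "iter_tr i A \<up> 2 \<cdot> V 1 # ?G \<turnstile> V 1 \<Ztypecolon> iter_tr i (A \<up> 3) \<cdot> V 2"
    "iter_tr i A \<up> 2 \<cdot> V 1 # ?G \<turnstile> V 0 \<Ztypecolon> iter_tr i (A \<up> 3) \<cdot> V 2"
    using w[OF c(2)] w[OF c(3)] w[OF c(4)] ty_V0[OF T] by simp_all
  from eq[OF this] show ?thesis unfolding wconst_def by (intro inh_Pi) simp
qed

lemma ty_tr_inf: "\<Gamma> \<turnstile> A \<Ztypecolon> U i \<Longrightarrow> \<Gamma> \<turnstile> tr_inf i A \<Ztypecolon> U i"
  unfolding tr_inf_def by (rule ty_colim[OF ty_iter ty_iter_map])

lemma arr_cong1:
  assumes "\<Gamma> \<turnstile> A \<Ztypecolon> U i" "\<Gamma> \<turnstile> A \<doteq> A' \<Ztypecolon> U i" "\<Gamma> \<turnstile> B \<Ztypecolon> U i"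
  shows "\<Gamma> \<turnstile> arr A B \<doteq> arr A' B \<Ztypecolon> U i"
  unfolding arr_def by (rule eq_Pi[OF assms(2) eq_refl[OF weakU[OF assms(3) wf_Cons[OF assms(1)]]]])

lemma ty_i0:
  assumes A: "\<Gamma> \<turnstile> A \<Ztypecolon> U i"
  shows "\<Gamma> \<turnstile> i0 i A \<Ztypecolon> arr A (tr_inf i A)"
proof -
  have wf: "wf \<Gamma>" using typed_wf A by blast
  show ?thesis unfolding i0_def tr_inf_def
    by (rule ty_conv[OF ty_cin_const[OF ty_iter[OF A] ty_iter_map[OF A] ty_zero[OF wf]]
      arr_cong1[OF ty_iter_app[OF A ty_zero[OF wf]] iter_zero[OF A] ty_colim[OF ty_iter[OF A] ty_iter_map[OF A]]]])
qed

section \<open>Elimination of the colimit into propositions\<close>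

abbreviation tr_in :: "nat \<Rightarrow> tm \<Rightarrow> tm \<Rightarrow> tm \<Rightarrow> tm" where
  "tr_in i A n a \<equiv> cin (iter_tr i A) (iter_map i A) n a"

text \<open>
  That \<open>Q\<close> consists of propositions is recorded as mere inhabitation, because no judgmental equation
  involves the proof of it.
\<close>

definition elim_ctx :: "tm list \<Rightarrow> nat \<Rightarrow> nat \<Rightarrow> tm \<Rightarrow> tm \<Rightarrow> bool" where
  "elim_ctx \<Gamma> i j A Q \<longleftrightarrow> \<Gamma> \<turnstile> A \<Ztypecolon> U i \<and> \<Gamma> \<turnstile> Q \<Ztypecolon> arr (tr_inf i A) (U j)
     \<and> inh \<Gamma> (Pi (tr_inf i A) (isprop (Q \<up> 1 \<cdot> V 0)))"

lemma elim_ctx_weak: "elim_ctx \<Gamma> i j A Q \<Longrightarrow> wf (B # \<Gamma>) \<Longrightarrow> elim_ctx (B # \<Gamma>) i j (A \<up> 1) (Q \<up> 1)"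
  unfolding elim_ctx_def using weak(1)[of B \<Gamma> A "U i"] weak(1)[of B \<Gamma> Q "arr (tr_inf i A) (U j)"]
    inh_weak[of \<Gamma> "Pi (tr_inf i A) (isprop (Q \<up> 1 \<cdot> V 0))" B] by simp

lemma eq_cumul_le: "\<Gamma> \<turnstile> A \<doteq> B \<Ztypecolon> U i \<Longrightarrow> i \<le> j \<Longrightarrow> \<Gamma> \<turnstile> A \<doteq> B \<Ztypecolon> U j"
  by (rotate_tac, induction rule: dec_induct) (auto intro: eq_cumul)

text \<open>
  The motives for passing from level \<open>n\<close> to level \<open>n+1\<close>, over the one-step truncation of \<open>F n\<close>, and
  for the recursion on \<open>n\<close>: \<open>z \<mapsto> Q (i (n+1) z)\<close> and \<open>n \<mapsto> \<Pi>(z : F n). Q (i n z)\<close>.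
\<close>

definition step_fam :: "nat \<Rightarrow> tm \<Rightarrow> tm \<Rightarrow> tm \<Rightarrow> tm" where
  "step_fam i A Q n = Lam (tr (iter_tr i A \<cdot> n)) (Q \<up> 1 \<cdot> tr_in i (A \<up> 1) (succ (n \<up> 1)) (V 0))"

definition elim_fam :: "nat \<Rightarrow> tm \<Rightarrow> tm \<Rightarrow> tm" where
  "elim_fam i A Q = Lam natT (Pi (iter_tr i (A \<up> 1) \<cdot> V 0) (Q \<up> 2 \<cdot> tr_in i (A \<up> 2) (V 1) (V 0)))"

lemma lift_fams [simp]:
  "step_fam i A Q n \<up> k = step_fam i (A \<up> k) (Q \<up> k) (n \<up> k)"
  "elim_fam i A Q \<up> k = elim_fam i (A \<up> k) (Q \<up> k)"
  by (simp_all add: step_fam_def elim_fam_def add.commute)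

context
  fixes \<Gamma> i j A Q
  assumes E: "elim_ctx \<Gamma> i j A Q"
begin

lemma elim_ctxD:
  "\<Gamma> \<turnstile> A \<Ztypecolon> U i" "\<Gamma> \<turnstile> Q \<Ztypecolon> arr (tr_inf i A) (U j)"
  "inh \<Gamma> (Pi (tr_inf i A) (isprop (Q \<up> 1 \<cdot> V 0)))"
  "\<Gamma> \<turnstile> iter_tr i A \<Ztypecolon> arr natT (U i)" "\<Gamma> \<turnstile> iter_map i A \<Ztypecolon> seqmaps (iter_tr i A)"
  "\<Gamma> \<turnstile> tr_inf i A \<Ztypecolon> U i" "wf \<Gamma>"
  using E ty_iter ty_iter_map ty_tr_inf typed_wf unfolding elim_ctx_def by blast+

lemma ty_tr_in: "\<Gamma> \<turnstile> n \<Ztypecolon> natT \<Longrightarrow> \<Gamma> \<turnstile> a \<Ztypecolon> iter_tr i A \<cdot> n \<Longrightarrow> \<Gamma> \<turnstile> tr_in i A n a \<Ztypecolon> tr_inf i A"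
  unfolding tr_inf_def by (rule ty_cin[OF elim_ctxD(4,5)])

lemma ty_Q: "\<Gamma> \<turnstile> n \<Ztypecolon> natT \<Longrightarrow> \<Gamma> \<turnstile> a \<Ztypecolon> iter_tr i A \<cdot> n \<Longrightarrow> \<Gamma> \<turnstile> Q \<cdot> tr_in i A n a \<Ztypecolon> U j"
  by (rule ty_arrE[OF elim_ctxD(2) ty_tr_in])

lemma Q_prop: "\<Gamma> \<turnstile> n \<Ztypecolon> natT \<Longrightarrow> \<Gamma> \<turnstile> a \<Ztypecolon> iter_tr i A \<cdot> n \<Longrightarrow> inh \<Gamma> (isprop (Q \<cdot> tr_in i A n a))"
  by (rule inh_isprop_fam[OF elim_ctxD(2,3) ty_tr_in])

text \<open>
  The product lives in the larger of the two universes of \<open>A\<close> and \<open>Q\<close>. The level of a motive is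
  unconstrained, so this does not affect the levels in the statement.
\<close>

lemma ty_elim_fam_level:
  assumes n: "\<Gamma> \<turnstile> n \<Ztypecolon> natT"
  shows "\<Gamma> \<turnstile> Pi (iter_tr i A \<cdot> n) (Q \<up> 1 \<cdot> tr_in i (A \<up> 1) (n \<up> 1) (V 0)) \<Ztypecolon> U (max i j)"
proof -
  note T = ty_iter_app[OF elim_ctxD(1) n]
  note w = weak(1)[OF wf_Cons[OF T]]
  have Q1: "iter_tr i A \<cdot> n # \<Gamma> \<turnstile> Q \<up> 1 \<Ztypecolon> arr (tr_inf i (A \<up> 1)) (U j)" using w[OF elim_ctxD(2)] by simp
  have "iter_tr i A \<cdot> n # \<Gamma> \<turnstile> tr_in i (A \<up> 1) (n \<up> 1) (V 0) \<Ztypecolon> tr_inf i (A \<up> 1)"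
    unfolding tr_inf_def
    by (rule ty_cin[where i = i]) (use w[OF elim_ctxD(4)] w[OF elim_ctxD(5)] w[OF n] ty_V0[OF T] in simp_all)
  from ty_Pi_le[OF T ty_arrE[OF Q1 this]] show ?thesis by simp
qed

end

lemma step_fam_open:
  assumes E: "elim_ctx \<Gamma> i j A Q" and n: "\<Gamma> \<turnstile> n \<Ztypecolon> natT"
  shows "tr (iter_tr i A \<cdot> n) # \<Gamma> \<turnstile> Q \<up> 1 \<cdot> tr_in i (A \<up> 1) (succ (n \<up> 1)) (V 0) \<Ztypecolon> U j"
    and "tr (iter_tr i A \<cdot> n) # \<Gamma> \<turnstile> V 0 \<Ztypecolon> iter_tr i (A \<up> 1) \<cdot> succ (n \<up> 1)"
    and "tr (iter_tr i A \<cdot> n) # \<Gamma> \<turnstile> n \<up> 1 \<Ztypecolon> natT"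
    and "elim_ctx (tr (iter_tr i A \<cdot> n) # \<Gamma>) i j (A \<up> 1) (Q \<up> 1)"
proof -
  note T = ty_tr[OF ty_iter_app[OF elim_ctxD(1)[OF E] n]]
  note w = weak(1)[OF wf_Cons[OF T]]
  show E1: "elim_ctx (tr (iter_tr i A \<cdot> n) # \<Gamma>) i j (A \<up> 1) (Q \<up> 1)" by (rule elim_ctx_weak[OF E wf_Cons[OF T]])
  show n1: "tr (iter_tr i A \<cdot> n) # \<Gamma> \<turnstile> n \<up> 1 \<Ztypecolon> natT" using w[OF n] by simp
  show v: "tr (iter_tr i A \<cdot> n) # \<Gamma> \<turnstile> V 0 \<Ztypecolon> iter_tr i (A \<up> 1) \<cdot> succ (n \<up> 1)"
    by (rule ty_conv_sym[OF _ iter_succ[OF elim_ctxD(1)[OF E1] n1]]) (use ty_V0[OF T] in simp)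
  show "tr (iter_tr i A \<cdot> n) # \<Gamma> \<turnstile> Q \<up> 1 \<cdot> tr_in i (A \<up> 1) (succ (n \<up> 1)) (V 0) \<Ztypecolon> U j"
    by (rule ty_Q[OF E1 ty_succ[OF n1] v])
qed

lemma ty_step_fam:
  assumes E: "elim_ctx \<Gamma> i j A Q" and n: "\<Gamma> \<turnstile> n \<Ztypecolon> natT"
  shows "\<Gamma> \<turnstile> step_fam i A Q n \<Ztypecolon> arr (tr (iter_tr i A \<cdot> n)) (U j)"
  unfolding step_fam_def by (rule ty_Lam_fam[OF step_fam_open(1)[OF E n]])

lemma step_fam_beta:
  assumes E: "elim_ctx \<Gamma> i j A Q" and n: "\<Gamma> \<turnstile> n \<Ztypecolon> natT" and z: "\<Gamma> \<turnstile> z \<Ztypecolon> tr (iter_tr i A \<cdot> n)"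
  shows "\<Gamma> \<turnstile> step_fam i A Q n \<cdot> z \<doteq> Q \<cdot> tr_in i A (succ n) z \<Ztypecolon> U j"
  unfolding step_fam_def by (rule fam_beta[OF step_fam_open(1)[OF E n] z]) simp

text \<open>
  Transport backwards along glue moves an element over \<open>i n a\<close> to one over \<open>i (n+1) (f a)\<close>.
\<close>

lemma elim_point:
  assumes E: "elim_ctx \<Gamma> i j A Q" and n: "\<Gamma> \<turnstile> n \<Ztypecolon> natT" and a: "\<Gamma> \<turnstile> a \<Ztypecolon> iter_tr i A \<cdot> n"
    and u: "inh \<Gamma> (Q \<cdot> tr_in i A n a)"
  shows "inh \<Gamma> (step_fam i A Q n \<cdot> trpt (iter_tr i A \<cdot> n) a)"
proof -
  from u obtain u where u: "\<Gamma> \<turnstile> u \<Ztypecolon> Q \<cdot> tr_in i A n a" unfolding inh_def by blast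
  note e = elim_ctxD[OF E]
  note X = e(6)[unfolded tr_inf_def] and Q = e(2)[unfolded tr_inf_def]
  note fa = ty_seqmap[OF e(5) n a]
  note s = ty_succ[OF n]
  note x = ty_cin[OF e(4,5) n a] and y = ty_cin[OF e(4,5) s fa]
  have 1: "inh \<Gamma> (Q \<cdot> tr_in i A (succ n) (iter_map i A \<cdot> n \<cdot> a))"
    by (rule inhI[OF ty_transp[OF X Q x y ty_inv_path[OF X y x ty_glue[OF e(4,5) n a]] u]])
  have t: "\<Gamma> \<turnstile> trpt (iter_tr i A \<cdot> n) a \<Ztypecolon> tr (iter_tr i A \<cdot> n)"
    by (rule ty_trpt[OF ty_iter_app[OF e(1) n] a])
  have "\<Gamma> \<turnstile> Q \<cdot> tr_in i A (succ n) (iter_map i A \<cdot> n \<cdot> a) \<doteq> Q \<cdot> tr_in i A (succ n) (trpt (iter_tr i A \<cdot> n) a) \<Ztypecolon> U j"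
    by (rule eq_App_arr[OF eq_refl[OF Q] cin_cong[OF e(4,5) s iter_map_beta[OF e(1) n a]]])
  from inh_conv[OF inh_conv[OF 1 this] eq_sym[OF step_fam_beta[OF E n t]]] show ?thesis .
qed

lemma elim_step:
  assumes E: "elim_ctx \<Gamma> i j A Q" and n: "\<Gamma> \<turnstile> n \<Ztypecolon> natT"
    and ih: "\<Gamma> \<turnstile> ih \<Ztypecolon> Pi (iter_tr i A \<cdot> n) (Q \<up> 1 \<cdot> tr_in i (A \<up> 1) (n \<up> 1) (V 0))"
  shows "inh \<Gamma> (Pi (iter_tr i A \<cdot> succ n) (Q \<up> 1 \<cdot> tr_in i (A \<up> 1) (succ (n \<up> 1)) (V 0)))"
proof -
  note e = elim_ctxD[OF E]
  note Fn = ty_iter_app[OF e(1) n] and o = step_fam_open[OF E n]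
  have v: "tr (iter_tr i A \<cdot> n) # \<Gamma> \<turnstile> V 0 \<Ztypecolon> tr (iter_tr i (A \<up> 1) \<cdot> n \<up> 1)" using ty_V0[OF ty_tr[OF Fn]] by simp
  note b = step_fam_beta[OF o(4,3) v]
  \<comment> \<open>the motive consists of propositions because \<open>Q\<close> does\<close>
  have w: "inh \<Gamma> (Pi (tr (iter_tr i A \<cdot> n)) (isprop (step_fam i A Q n \<up> 1 \<cdot> V 0)))"
    using inh_Pi[OF inh_conv[OF Q_prop[OF o(4) ty_succ[OF o(3)] o(2)] isprop_cong[OF o(1) eq_sym[OF b]]]] by simp
  have p: "inh \<Gamma> (case_trpt (iter_tr i A \<cdot> n) (step_fam i A Q n))"
  proof -
    note wk = weak(1)[OF wf_Cons[OF Fn]]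
    let ?G = "iter_tr i A \<cdot> n # \<Gamma>"
    note E1 = elim_ctx_weak[OF E wf_Cons[OF Fn]]
    have n1: "?G \<turnstile> n \<up> 1 \<Ztypecolon> natT" and v1: "?G \<turnstile> V 0 \<Ztypecolon> iter_tr i (A \<up> 1) \<cdot> n \<up> 1"
      using wk[OF n] ty_V0[OF Fn] by simp_all
    have "?G \<turnstile> ih \<up> 1 \<Ztypecolon> Pi (iter_tr i (A \<up> 1) \<cdot> n \<up> 1) (Q \<up> 2 \<cdot> tr_in i (A \<up> 2) (n \<up> 2) (V 0))"
      using wk[OF ih] by simp
    then have "?G \<turnstile> ih \<up> 1 \<cdot> V 0 \<Ztypecolon> Q \<up> 1 \<cdot> tr_in i (A \<up> 1) (n \<up> 1) (V 0)"
      by (rule ty_AppE[OF _ v1]) simp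
    from inh_Pi[OF elim_point[OF E1 n1 v1 inhI[OF this]]] show ?thesis unfolding case_trpt_def by simp
  qed
  have "\<Gamma> \<turnstile> piF (tr (iter_tr i A \<cdot> n)) (step_fam i A Q n) \<doteq>
     Pi (iter_tr i A \<cdot> succ n) (Q \<up> 1 \<cdot> tr_in i (A \<up> 1) (succ (n \<up> 1)) (V 0)) \<Ztypecolon> U (max i j)"
    unfolding piF_def
  proof (rule eq_Pi)
    show "\<Gamma> \<turnstile> tr (iter_tr i A \<cdot> n) \<doteq> iter_tr i A \<cdot> succ n \<Ztypecolon> U (max i j)"
      using eq_cumul_le[OF eq_sym[OF iter_succ[OF e(1) n]]] by simp
    show "tr (iter_tr i A \<cdot> n) # \<Gamma> \<turnstile> step_fam i A Q n \<up> 1 \<cdot> V 0 \<doteq>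
       Q \<up> 1 \<cdot> tr_in i (A \<up> 1) (succ (n \<up> 1)) (V 0) \<Ztypecolon> U (max i j)"
      using eq_cumul_le[OF b] by simp
  qed
  from inh_conv[OF tr_prop_elim[OF Fn ty_step_fam[OF E n] w p] this] show ?thesis .
qed

lemma elim_fam_open:
  assumes E: "elim_ctx \<Gamma> i j A Q"
  shows "natT # \<Gamma> \<turnstile> Pi (iter_tr i (A \<up> 1) \<cdot> V 0) (Q \<up> 2 \<cdot> tr_in i (A \<up> 2) (V 1) (V 0)) \<Ztypecolon> U (max i j)"
    "elim_ctx (natT # \<Gamma>) i j (A \<up> 1) (Q \<up> 1)" "natT # \<Gamma> \<turnstile> V 0 \<Ztypecolon> natT"
proof -
  note N = ty_natT[OF elim_ctxD(7)[OF E]]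
  show E1: "elim_ctx (natT # \<Gamma>) i j (A \<up> 1) (Q \<up> 1)" by (rule elim_ctx_weak[OF E wf_Cons[OF N]])
  show v: "natT # \<Gamma> \<turnstile> V 0 \<Ztypecolon> natT" using ty_V0[OF N] by simp
  show "natT # \<Gamma> \<turnstile> Pi (iter_tr i (A \<up> 1) \<cdot> V 0) (Q \<up> 2 \<cdot> tr_in i (A \<up> 2) (V 1) (V 0)) \<Ztypecolon> U (max i j)"
    using ty_elim_fam_level[OF E1 v] by simp
qed

lemma ty_elim_fam: "elim_ctx \<Gamma> i j A Q \<Longrightarrow> \<Gamma> \<turnstile> elim_fam i A Q \<Ztypecolon> arr natT (U (max i j))"
  unfolding elim_fam_def by (rule ty_Lam_fam[OF elim_fam_open(1)])

lemma elim_fam_beta: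
  "elim_ctx \<Gamma> i j A Q \<Longrightarrow> \<Gamma> \<turnstile> n \<Ztypecolon> natT \<Longrightarrow>
   \<Gamma> \<turnstile> elim_fam i A Q \<cdot> n \<doteq> Pi (iter_tr i A \<cdot> n) (Q \<up> 1 \<cdot> tr_in i (A \<up> 1) (n \<up> 1) (V 0)) \<Ztypecolon> U (max i j)"
  unfolding elim_fam_def by (rule fam_beta[OF elim_fam_open(1)]) simp_all

lemma elim_case_succ:
  assumes E: "elim_ctx \<Gamma> i j A Q"
  shows "inh \<Gamma> (case_succ (elim_fam i A Q))"
proof -
  note o = elim_fam_open(2,3)[OF E]
  have T: "natT # \<Gamma> \<turnstile> elim_fam i (A \<up> 1) (Q \<up> 1) \<cdot> V 0 \<Ztypecolon> U (max i j)"
    by (rule ty_arrE[OF ty_elim_fam[OF o(1)] o(2)])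
  let ?G = "elim_fam i (A \<up> 1) (Q \<up> 1) \<cdot> V 0 # natT # \<Gamma>"
  have E2: "elim_ctx ?G i j (A \<up> 2) (Q \<up> 2)" using elim_ctx_weak[OF o(1) wf_Cons[OF T]] by simp
  have v1: "?G \<turnstile> V 1 \<Ztypecolon> natT" and v0: "?G \<turnstile> V 0 \<Ztypecolon> elim_fam i (A \<up> 2) (Q \<up> 2) \<cdot> V 1"
    using weak(1)[OF wf_Cons[OF T] o(2)] ty_V0[OF T] by simp_all
  have "inh ?G (elim_fam i (A \<up> 2) (Q \<up> 2) \<cdot> succ (V 1))"
    by (rule inh_conv[OF elim_step[OF E2 v1 ty_conv[OF v0 elim_fam_beta[OF E2 v1]]]
        eq_sym]) (use elim_fam_beta[OF E2 ty_succ[OF v1]] in simp)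
  from inh_Pi[OF inh_Pi[OF this]] show ?thesis unfolding case_succ_def arr_def by simp
qed

text \<open>
  The path case of colimit induction holds for any choice of point case.
\<close>

lemma elim_coherent:
  assumes E: "elim_ctx \<Gamma> i j A Q" and n: "\<Gamma> \<turnstile> n \<Ztypecolon> natT" and a: "\<Gamma> \<turnstile> a \<Ztypecolon> iter_tr i A \<cdot> n"
    and H: "\<Gamma> \<turnstile> H \<Ztypecolon> case_cin (iter_tr i A) (iter_map i A) Q"
  shows "inh \<Gamma> (idT (Q \<cdot> tr_in i A n a) (transp (tr_inf i A) Q (tr_in i A (succ n) (iter_map i A \<cdot> n \<cdot> a)) (tr_in i A n a)
    (glue (iter_tr i A) (iter_map i A) n a) (H \<cdot> succ n \<cdot> (iter_map i A \<cdot> n \<cdot> a))) (H \<cdot> n \<cdot> a))"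
proof -
  have H: "\<Gamma> \<turnstile> H \<cdot> m \<cdot> b \<Ztypecolon> Q \<cdot> tr_in i A m b" if m: "\<Gamma> \<turnstile> m \<Ztypecolon> natT" and b: "\<Gamma> \<turnstile> b \<Ztypecolon> iter_tr i A \<cdot> m" for m b
  proof -
    have "\<Gamma> \<turnstile> H \<cdot> m \<Ztypecolon> Pi (iter_tr i A \<cdot> m) (Q \<up> 1 \<cdot> tr_in i (A \<up> 1) (m \<up> 1) (V 0))"
      by (rule ty_AppE[OF H[unfolded case_cin_def] m]) simp
    then show ?thesis by (rule ty_AppE[OF _ b]) simp
  qed
  note e = elim_ctxD[OF E] and s = ty_succ[OF n]
  note fa = ty_seqmap[OF e(5) n a]
  show ?thesis
    by (rule prop_eq[OF Q_prop[OF E n a] ty_transp[OF e(6,2) ty_tr_in[OF E s fa] ty_tr_in[OF E n a]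
          ty_glue[OF e(4,5) n a, folded tr_inf_def] H[OF s fa]] H[OF n a]])
qed

text \<open>
  The point case is a recursion on \<open>n\<close> that starts with \<open>h\<close> itself. Only the other arguments of the
  two induction principles are left abstract, so the equation at \<open>i 0 a\<close> follows by computing the
  colimit induction at a point and the recursion at zero.
\<close>

theorem tr_inf_elim:
  assumes E: "elim_ctx \<Gamma> i j A Q" and h: "\<Gamma> \<turnstile> h \<Ztypecolon> Pi A (Q \<up> 1 \<cdot> (i0 i A \<up> 1 \<cdot> V 0))"
  obtains k where "\<Gamma> \<turnstile> k \<Ztypecolon> piF (tr_inf i A) Q"
    "A # \<Gamma> \<turnstile> k \<up> 1 \<cdot> (i0 i A \<up> 1 \<cdot> V 0) \<doteq> h \<up> 1 \<cdot> V 0 \<Ztypecolon> Q \<up> 1 \<cdot> (i0 i A \<up> 1 \<cdot> V 0)"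
proof -
  note e = elim_ctxD[OF E]
  let ?F = "iter_tr i A" and ?f = "iter_map i A" and ?C = "elim_fam i A Q" and ?m = "max i j"
  have i0: "i0 i B \<cdot> x = tr_in i B zero x" for B x by (simp add: i0_def cin_def)
  note z = ty_zero[OF e(7)]
  note iz = iter_zero[OF e(1)] and Fz = ty_iter_app[OF e(1) z]
  have hz: "\<Gamma> \<turnstile> Pi (?F \<cdot> zero) (Q \<up> 1 \<cdot> tr_in i (A \<up> 1) zero (V 0)) \<doteq> Pi A (Q \<up> 1 \<cdot> (i0 i A \<up> 1 \<cdot> V 0)) \<Ztypecolon> U ?m"
  proof (rule eq_Pi)
    show "\<Gamma> \<turnstile> ?F \<cdot> zero \<doteq> A \<Ztypecolon> U ?m" using eq_cumul_le[OF iz] by simp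
    note w = wf_Cons[OF Fz]
    note E1 = elim_ctx_weak[OF E w]
    have "?F \<cdot> zero # \<Gamma> \<turnstile> Q \<up> 1 \<cdot> tr_in i (A \<up> 1) zero (V 0) \<Ztypecolon> U j"
      by (rule ty_Q[OF E1 ty_zero[OF w]]) (use ty_V0[OF Fz] in simp)
    then show "?F \<cdot> zero # \<Gamma> \<turnstile> Q \<up> 1 \<cdot> tr_in i (A \<up> 1) zero (V 0) \<doteq> Q \<up> 1 \<cdot> (i0 i A \<up> 1 \<cdot> V 0) \<Ztypecolon> U ?m"
      using eq_cumul_le[OF eq_refl] by (simp add: i0)
  qed
  have Cz: "\<Gamma> \<turnstile> ?C \<cdot> zero \<doteq> Pi A (Q \<up> 1 \<cdot> (i0 i A \<up> 1 \<cdot> V 0)) \<Ztypecolon> U ?m"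
    by (rule eq_trans[OF _ hz]) (use elim_fam_beta[OF E z] in simp)
  note h' = ty_conv_sym[OF h Cz]
  \<comment> \<open>the recursion step is needed only up to existence: the equation concerns level zero\<close>
  obtain s where s: "\<Gamma> \<turnstile> s \<Ztypecolon> case_succ ?C" using elim_case_succ[OF E] unfolding inh_def by blast
  let ?H = "Const cIndNat \<cdot> ?C \<cdot> h \<cdot> s"
  have "\<Gamma> \<turnstile> piF natT ?C \<doteq> case_cin ?F ?f Q \<Ztypecolon> U ?m"
    unfolding piF_def case_cin_def
    by (rule eq_Pi[OF eq_refl[OF ty_natT[OF e(7)]]]) (use elim_fam_beta[OF elim_fam_open(2,3)[OF E]] in simp)
  from ty_conv[OF ty_indNat_const[OF ty_elim_fam[OF E] h' s] this]
  have H: "\<Gamma> \<turnstile> ?H \<Ztypecolon> case_cin ?F ?f Q" .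
  have "inh \<Gamma> (case_glue ?F ?f Q ?H)"
  proof -
    note c = iter_ctx[OF e(1)]
    let ?G = "?F \<up> 1 \<cdot> V 0 # natT # \<Gamma>"
    have E2: "elim_ctx ?G i j (A \<up> 2) (Q \<up> 2)"
      using elim_ctx_weak[OF elim_fam_open(2)[OF E] wf_Cons[OF c(1)]] by simp
    have v: "?G \<turnstile> V 0 \<Ztypecolon> iter_tr i (A \<up> 2) \<cdot> V 1" using c(4) by simp
    have "?G \<turnstile> ?H \<up> 2 \<Ztypecolon> case_cin (iter_tr i (A \<up> 2)) (iter_map i (A \<up> 2)) (Q \<up> 2)" using c(5)[OF H] by simp
    from elim_coherent[OF E2 c(3) v this] show ?thesis
      unfolding case_glue_def tr_inf_def by (intro inh_Pi) simp
  qed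
  then obtain q where q: "\<Gamma> \<turnstile> q \<Ztypecolon> case_glue ?F ?f Q ?H" unfolding inh_def by blast
  let ?k = "Const cIndColim \<cdot> ?F \<cdot> ?f \<cdot> Q \<cdot> ?H \<cdot> q"
  have k: "\<Gamma> \<turnstile> ?k \<Ztypecolon> piF (tr_inf i A) Q"
    unfolding tr_inf_def by (rule ty_indColim[OF e(4,5) e(2)[unfolded tr_inf_def] H q])
  note wA = wf_Cons[OF e(1)]
  note w = weak(1)[OF wA] and w' = weak(2)[OF wA]
  have v: "A # \<Gamma> \<turnstile> V 0 \<Ztypecolon> ?F \<up> 1 \<cdot> zero"
    using ty_conv_sym[OF ty_V0[OF e(1)] w'[OF iz, unfolded lift_simps]] by simp
  have "A # \<Gamma> \<turnstile> ?k \<up> 1 \<cdot> cin (?F \<up> 1) (?f \<up> 1) zero (V 0) \<doteq> ?H \<up> 1 \<cdot> zero \<cdot> V 0 \<Ztypecolon> Q \<up> 1 \<cdot> cin (?F \<up> 1) (?f \<up> 1) zero (V 0)"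
    using comp_ColimIn[of "A # \<Gamma>" "?F \<up> 1" i "?f \<up> 1" "Q \<up> 1" j "?H \<up> 1" "q \<up> 1" zero "V 0"]
      w[OF e(4)] w[OF e(5)] w[OF e(2)] w[OF H] w[OF q] ty_zero[OF wA] v by (simp add: tr_inf_def)
  moreover have "\<Gamma> \<turnstile> ?H \<cdot> zero \<doteq> h \<Ztypecolon> Pi A (Q \<up> 1 \<cdot> (i0 i A \<up> 1 \<cdot> V 0))"
    by (rule eq_conv[OF comp_Zero[OF ty_elim_fam[OF E] h' s] Cz])
  from eq_App[OF w'[OF this, unfolded lift_simps] eq_refl[OF ty_V0[OF e(1)]]]
  have "A # \<Gamma> \<turnstile> ?H \<up> 1 \<cdot> zero \<cdot> V 0 \<doteq> h \<up> 1 \<cdot> V 0 \<Ztypecolon> Q \<up> 1 \<cdot> cin (?F \<up> 1) (?f \<up> 1) zero (V 0)"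
    by (simp add: i0)
  ultimately have "A # \<Gamma> \<turnstile> ?k \<up> 1 \<cdot> (i0 i A \<up> 1 \<cdot> V 0) \<doteq> h \<up> 1 \<cdot> V 0 \<Ztypecolon> Q \<up> 1 \<cdot> (i0 i A \<up> 1 \<cdot> V 0)"
    using eq_trans by (simp add: i0)
  with k show thesis by (rule that)
qed

section \<open>The colimit is a proposition\<close>

text \<open>
  The family \<open>x \<mapsto> \<Pi>(y : X). x = y\<close>.
\<close>

definition contr_fam :: "nat \<Rightarrow> tm \<Rightarrow> tm" where
  "contr_fam i A = Lam (tr_inf i A) (piF (tr_inf i (A \<up> 1)) (paths (tr_inf i (A \<up> 1)) (V 0)))"

lemma lift_contr_fam [simp]: "contr_fam i A \<up> k = contr_fam i (A \<up> k)"
  by (simp add: contr_fam_def add.commute)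

lemma contr_fam_open:
  assumes A: "\<Gamma> \<turnstile> A \<Ztypecolon> U i"
  shows "tr_inf i A # \<Gamma> \<turnstile> piF (tr_inf i (A \<up> 1)) (paths (tr_inf i (A \<up> 1)) (V 0)) \<Ztypecolon> U i"
    "tr_inf i A # \<Gamma> \<turnstile> tr_inf i (A \<up> 1) \<Ztypecolon> U i" "tr_inf i A # \<Gamma> \<turnstile> V 0 \<Ztypecolon> tr_inf i (A \<up> 1)"
proof -
  note X = ty_tr_inf[OF A]
  show 1: "tr_inf i A # \<Gamma> \<turnstile> tr_inf i (A \<up> 1) \<Ztypecolon> U i" "tr_inf i A # \<Gamma> \<turnstile> V 0 \<Ztypecolon> tr_inf i (A \<up> 1)"
    using path_ctx_prefix(2)[OF X] ty_V0[OF X] by simp_all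
  show "tr_inf i A # \<Gamma> \<turnstile> piF (tr_inf i (A \<up> 1)) (paths (tr_inf i (A \<up> 1)) (V 0)) \<Ztypecolon> U i"
    by (rule ty_piF[OF 1(1) ty_paths(1)[OF 1]]) simp_all
qed

lemma contr_fam_beta:
  assumes A: "\<Gamma> \<turnstile> A \<Ztypecolon> U i" and x: "\<Gamma> \<turnstile> x \<Ztypecolon> tr_inf i A"
  shows "\<Gamma> \<turnstile> contr_fam i A \<cdot> x \<doteq> piF (tr_inf i A) (paths (tr_inf i A) x) \<Ztypecolon> U i"
  unfolding contr_fam_def by (rule fam_beta[OF contr_fam_open(1)[OF A] x]) simp

lemma contr_fam_elim_ctx:
  assumes A: "\<Gamma> \<turnstile> A \<Ztypecolon> U i"
  shows "elim_ctx \<Gamma> i i A (contr_fam i A)"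
proof -
  note X = ty_tr_inf[OF A] and o = contr_fam_open[OF A]
  note b = fam_beta_V0[OF o(1) X, folded contr_fam_def]
  show ?thesis unfolding elim_ctx_def
    using A ty_Lam_fam[OF o(1), folded contr_fam_def]
      inh_Pi[OF inh_conv[OF isprop_contraction[OF o(2,3)] isprop_cong[OF o(1) eq_sym[OF b]]]] by blast
qed

text \<open>
  Over a point of \<open>A\<close>, the family is inhabited by contractibility of the pointed colimit.
\<close>

lemma contr_fam_point:
  assumes A: "\<Gamma> \<turnstile> A \<Ztypecolon> U i"
  shows "inh \<Gamma> (Pi A (contr_fam i A \<up> 1 \<cdot> (i0 i A \<up> 1 \<cdot> V 0)))"
proof -
  have pt: "inh \<Delta> (contr_fam i B \<cdot> (i0 i B \<cdot> a))" if B: "\<Delta> \<turnstile> B \<Ztypecolon> U i" and a: "\<Delta> \<turnstile> a \<Ztypecolon> B" for \<Delta> B a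
  proof -
    obtain e where e: "\<Delta> \<turnstile> e \<Ztypecolon> wconst (iter_tr i B) (iter_map i B)"
      using iter_map_wconst[OF B] unfolding inh_def by blast
    have az: "\<Delta> \<turnstile> a \<Ztypecolon> iter_tr i B \<cdot> zero" by (rule ty_conv_sym[OF a iter_zero[OF B]])
    note c = ty_cin[OF ty_iter[OF B] ty_iter_map[OF B] ty_zero[OF typed_wf(1)[OF B]] az]
    have "pseq \<Delta> i (iter_tr i B) (iter_map i B) e (tr_in i B zero a) a"
      unfolding pseq_def wseq_def using ty_iter[OF B] ty_iter_map[OF B] e c az by blast
    from colim_contractible[OF this]
    have "inh \<Delta> (piF (tr_inf i B) (paths (tr_inf i B) (tr_in i B zero a)))" unfolding tr_inf_def .
    from inh_conv[OF this eq_sym[OF contr_fam_beta[OF B c[folded tr_inf_def]]]]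
    show ?thesis by (simp add: i0_def cin_def)
  qed
  show ?thesis
    using inh_Pi[OF pt[OF path_ctx_prefix(2)[OF A] ty_V0[OF A]]] by simp
qed

text \<open>
  The eliminated function sends \<open>x\<close> and \<open>y\<close> to a path between them.
\<close>

theorem tr_inf_isprop:
  assumes A: "\<Gamma> \<turnstile> A \<Ztypecolon> U i"
  shows "inh \<Gamma> (isprop (tr_inf i A))"
proof -
  let ?X = "tr_inf i A"
  note X = ty_tr_inf[OF A]
  obtain h where h: "\<Gamma> \<turnstile> h \<Ztypecolon> Pi A (contr_fam i A \<up> 1 \<cdot> (i0 i A \<up> 1 \<cdot> V 0))"
    using contr_fam_point[OF A] unfolding inh_def by blast
  from tr_inf_elim[OF contr_fam_elim_ctx[OF A] h] obtain k where k: "\<Gamma> \<turnstile> k \<Ztypecolon> piF ?X (contr_fam i A)" by blast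
  let ?G = "?X \<up> 1 # ?X # \<Gamma>"
  note w = weak(1)[OF path_ctx_prefix(1)[OF X]] and w2 = weak(1)[OF path_ctx_prefix(3)[OF X]]
  have A2: "?G \<turnstile> A \<up> 2 \<Ztypecolon> U i" and k2: "?G \<turnstile> k \<up> 2 \<Ztypecolon> piF (tr_inf i (A \<up> 2)) (contr_fam i (A \<up> 2))"
    and v1: "?G \<turnstile> V 1 \<Ztypecolon> tr_inf i (A \<up> 2)" and v0: "?G \<turnstile> V 0 \<Ztypecolon> tr_inf i (A \<up> 2)"
    using w2[OF w[OF A]] w2[OF w[OF k]] w2[OF ty_V0[OF X]] ty_V0[OF path_ctx_prefix(2)[OF X]] by simp_all
  \<comment> \<open>\<open>k x y\<close> in the context \<open>x, y : X\<close>\<close>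
  have "?G \<turnstile> k \<up> 2 \<cdot> V 1 \<cdot> V 0 \<Ztypecolon> idT (tr_inf i (A \<up> 2)) (V 1) (V 0)"
    by (rule ty_conv[OF ty_piFE[OF ty_conv[OF ty_piFE[OF k2 v1] contr_fam_beta[OF A2 v1]] v0]
       paths_beta(1)[OF ty_tr_inf[OF A2] v1 v0]])
  from inh_Pi[OF inh_Pi[OF inhI[OF this]]] show ?thesis unfolding isprop_def by simp
qed

section \<open>Families of elements of Prop\<close>

text \<open>
  \<open>Prop\<close> is the sum of this family over \<open>U j\<close>, and hence a type of level \<open>Suc j\<close>.
\<close>

definition isprop_fam :: "nat \<Rightarrow> tm" where "isprop_fam j = Lam (U j) (isprop (V 0))"

lemma isprop_fam_simps [simp]:
  "ren r (isprop_fam j) = isprop_fam j" "sub s (isprop_fam j) = isprop_fam j" "isprop_fam j \<up> n = isprop_fam j" "inst (isprop_fam j) a = isprop_fam j"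
  by (simp_all add: isprop_fam_def)

lemma propT_alt: "propT j = sig (U j) (isprop_fam j)" and El_alt: "El j p = proj1 (U j) (isprop_fam j) p"
  by (simp_all add: propT_def El_def isprop_fam_def)

lemma isprop_fam_facts:
  assumes wf: "wf \<Gamma>"
  shows "\<Gamma> \<turnstile> U j \<Ztypecolon> U (Suc j)" "\<Gamma> \<turnstile> isprop_fam j \<Ztypecolon> arr (U j) (U (Suc j))"
    "\<Gamma> \<turnstile> T \<Ztypecolon> U j \<Longrightarrow> \<Gamma> \<turnstile> isprop_fam j \<cdot> T \<doteq> isprop T \<Ztypecolon> U (Suc j)"
proof -
  show Uj: "\<Gamma> \<turnstile> U j \<Ztypecolon> U (Suc j)" by (rule ty_U[OF wf])
  have *: "U j # \<Gamma> \<turnstile> isprop (V 0) \<Ztypecolon> U (Suc j)"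
    using ty_cumul[OF ty_isprop] ty_V0[OF Uj] by simp
  show "\<Gamma> \<turnstile> isprop_fam j \<Ztypecolon> arr (U j) (U (Suc j))"
    unfolding isprop_fam_def by (rule ty_Lam_fam[OF *])
  show "\<Gamma> \<turnstile> T \<Ztypecolon> U j \<Longrightarrow> \<Gamma> \<turnstile> isprop_fam j \<cdot> T \<doteq> isprop T \<Ztypecolon> U (Suc j)"
    unfolding isprop_fam_def by (rule fam_beta[OF *]) simp_all
qed

lemma ty_El: "\<Gamma> \<turnstile> p \<Ztypecolon> propT j \<Longrightarrow> \<Gamma> \<turnstile> El j p \<Ztypecolon> U j"
  unfolding propT_alt El_alt using ty_proj1[OF isprop_fam_facts(1,2)] typed_wf by blast

text \<open>
  The second projection. Its type mentions the first projection of a variable, so in the pair case it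
  has to be reduced to the first component.
\<close>

lemma El_prop:
  assumes p: "\<Gamma> \<turnstile> p \<Ztypecolon> propT j"
  shows "inh \<Gamma> (isprop (El j p))"
proof -
  have wf: "wf \<Gamma>" using p typed_wf by blast
  note f = isprop_fam_facts[OF wf, where j = j]
  let ?S = "sig (U j) (isprop_fam j)" and ?D = "isprop (El j (V 0))"
  have S: "\<Gamma> \<turnstile> ?S \<Ztypecolon> U (Suc j)" by (rule ty_sig[OF f(1,2)])
  have D: "?S # \<Gamma> \<turnstile> ?D \<Ztypecolon> U (Suc j)"
    by (rule ty_cumul[OF ty_isprop[OF ty_El]]) (use ty_V0[OF S] in \<open>simp add: propT_alt\<close>)
  note c = sig_ctx[OF f(1,2)]
  let ?G = "isprop_fam j \<up> 1 \<cdot> V 0 # U j # \<Gamma>"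
  have wf2: "wf ?G" using wf_Cons[OF c(1)] .
  note f2 = isprop_fam_facts[OF wf2, where j = j]
  have v1: "?G \<turnstile> V 1 \<Ztypecolon> U j" and v0: "?G \<turnstile> V 0 \<Ztypecolon> isprop_fam j \<cdot> V 1"
    and pr: "?G \<turnstile> pair (U j) (isprop_fam j) (V 1) (V 0) \<Ztypecolon> ?S"
    using c(3,4,5) by simp_all
  have "?G \<turnstile> Lam ?S ?D \<up> 2 \<cdot> pair (U j \<up> 2) (isprop_fam j \<up> 2) (V 1) (V 0) \<doteq> isprop (El j (pair (U j) (isprop_fam j) (V 1) (V 0))) \<Ztypecolon> U (Suc j)"
    using sig_fam_beta[OF f(1,2) D] by simp
  moreover have "?G \<turnstile> isprop (El j (pair (U j) (isprop_fam j) (V 1) (V 0))) \<doteq> isprop (V 1) \<Ztypecolon> U (Suc j)"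
    using eq_cumul[OF isprop_cong[OF ty_El[unfolded propT_alt, OF pr] proj1_pair[OF f2(1,2) v1 v0 pr, folded El_alt]]] .
  moreover have "?G \<turnstile> V 0 \<Ztypecolon> isprop (V 1)" by (rule ty_conv[OF v0 f2(3)[OF v1]])
  ultimately have "?G \<turnstile> V 0 \<Ztypecolon> Lam ?S ?D \<up> 2 \<cdot> pair (U j \<up> 2) (isprop_fam j \<up> 2) (V 1) (V 0)"
    using ty_conv_sym eq_trans by blast
  from ty_Lam[OF ty_Lam[OF this]]
  have g: "\<Gamma> \<turnstile> Lam (U j) (Lam (isprop_fam j \<up> 1 \<cdot> V 0) (V 0)) \<Ztypecolon> case_sig (U j) (isprop_fam j) (Lam ?S ?D)"
    unfolding case_sig_def .
  note p' = p[unfolded propT_alt]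
  have "\<Gamma> \<turnstile> Lam ?S ?D \<cdot> p \<doteq> isprop (El j p) \<Ztypecolon> U (Suc j)"
    by (rule fam_beta[OF D p']) simp
  from inh_conv[OF inhI[OF ty_indSigma[OF f(1,2) ty_Lam_fam[OF D] g p']] this] show ?thesis .
qed

theorem theorem4p3:
  assumes "\<Gamma> \<turnstile> A \<Ztypecolon> U i"
  shows "\<Gamma> \<turnstile> tr_inf i A \<Ztypecolon> U i
    \<and> \<Gamma> \<turnstile> i0 i A \<Ztypecolon> arr A (tr_inf i A)
    \<and> (\<exists>t. \<Gamma> \<turnstile> t \<Ztypecolon> isprop (tr_inf i A))
    \<and> (\<forall>j P h.
         \<Gamma> \<turnstile> P \<Ztypecolon> arr (tr_inf i A) (propT j) \<longrightarrow>
         \<Gamma> \<turnstile> h \<Ztypecolon> Pi A (El j (P \<up> 1 \<cdot> (i0 i A \<up> 1 \<cdot> V 0))) \<longrightarrow>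
         (\<exists>k. \<Gamma> \<turnstile> k \<Ztypecolon> Pi (tr_inf i A) (El j (P \<up> 1 \<cdot> V 0))
            \<and> A # \<Gamma> \<turnstile> k \<up> 1 \<cdot> (i0 i A \<up> 1 \<cdot> V 0) \<doteq> h \<up> 1 \<cdot> V 0
                 \<Ztypecolon> El j (P \<up> 1 \<cdot> (i0 i A \<up> 1 \<cdot> V 0))))"
proof (intro conjI allI impI)
  note A = assms
  show "\<Gamma> \<turnstile> tr_inf i A \<Ztypecolon> U i" by (rule ty_tr_inf[OF A])
  show "\<Gamma> \<turnstile> i0 i A \<Ztypecolon> arr A (tr_inf i A)" by (rule ty_i0[OF A])
  show "\<exists>t. \<Gamma> \<turnstile> t \<Ztypecolon> isprop (tr_inf i A)" using tr_inf_isprop[OF A] unfolding inh_def .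
  fix j P h
  let ?X = "tr_inf i A"
  assume P: "\<Gamma> \<turnstile> P \<Ztypecolon> arr ?X (propT j)" and h: "\<Gamma> \<turnstile> h \<Ztypecolon> Pi A (El j (P \<up> 1 \<cdot> (i0 i A \<up> 1 \<cdot> V 0)))"
  note X = ty_tr_inf[OF A]
  let ?B = "El j (P \<up> 1 \<cdot> V 0)"
  let ?Q = "Lam ?X ?B"
  have PV: "?X # \<Gamma> \<turnstile> P \<up> 1 \<cdot> V 0 \<Ztypecolon> propT j"
    by (rule ty_arrE[OF _ ty_V0[OF X]]) (use weak(1)[OF wf_Cons[OF X] P] in simp)
  note B = ty_El[OF PV]
  note b = fam_beta_V0[OF B X]
  have E: "elim_ctx \<Gamma> i j A ?Q"
    unfolding elim_ctx_def
    using A ty_Lam_fam[OF B] inh_Pi[OF inh_conv[OF El_prop[OF PV] isprop_cong[OF B eq_sym[OF b]]]] by blast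
  note wA = wf_Cons[OF A]
  have P1: "A # \<Gamma> \<turnstile> P \<up> 1 \<Ztypecolon> arr (?X \<up> 1) (propT j)" using weak(1)[OF wA P] by simp
  have x: "A # \<Gamma> \<turnstile> i0 i A \<up> 1 \<cdot> V 0 \<Ztypecolon> ?X \<up> 1"
    by (rule ty_arrE[OF _ ty_V0[OF A]]) (use weak(1)[OF wA ty_i0[OF A]] in simp)
  have bx: "A # \<Gamma> \<turnstile> ?Q \<up> 1 \<cdot> (i0 i A \<up> 1 \<cdot> V 0) \<doteq> El j (P \<up> 1 \<cdot> (i0 i A \<up> 1 \<cdot> V 0)) \<Ztypecolon> U j"
  proof -
    have X1: "A # \<Gamma> \<turnstile> ?X \<up> 1 \<Ztypecolon> U i" by (rule weakU[OF X wA])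
    have "?X \<up> 1 # A # \<Gamma> \<turnstile> P \<up> 2 \<cdot> V 0 \<Ztypecolon> propT j"
      by (rule ty_arrE[OF _ ty_V0[OF X1]]) (use weak(1)[OF wf_Cons[OF X1] P1] in simp)
    from fam_beta[OF ty_El[OF this] x refl] show ?thesis by simp
  qed
  have "\<Gamma> \<turnstile> Pi A (?Q \<up> 1 \<cdot> (i0 i A \<up> 1 \<cdot> V 0)) \<doteq> Pi A (El j (P \<up> 1 \<cdot> (i0 i A \<up> 1 \<cdot> V 0))) \<Ztypecolon> U (max i j)"
    by (rule eq_Pi[OF eq_refl[OF cumul_le[OF A]] eq_cumul_le[OF bx]]) simp_all
  from tr_inf_elim[OF E ty_conv_sym[OF h this]] obtain k where
    k: "\<Gamma> \<turnstile> k \<Ztypecolon> piF ?X ?Q"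
    and c: "A # \<Gamma> \<turnstile> k \<up> 1 \<cdot> (i0 i A \<up> 1 \<cdot> V 0) \<doteq> h \<up> 1 \<cdot> V 0 \<Ztypecolon> ?Q \<up> 1 \<cdot> (i0 i A \<up> 1 \<cdot> V 0)"
    by blast
  have "\<Gamma> \<turnstile> piF ?X ?Q \<doteq> Pi ?X ?B \<Ztypecolon> U (max i j)"
    unfolding piF_def by (rule eq_Pi[OF eq_refl[OF cumul_le[OF X]] eq_cumul_le[OF b]]) simp_all
  with k c bx show "\<exists>k. \<Gamma> \<turnstile> k \<Ztypecolon> Pi ?X ?B
      \<and> A # \<Gamma> \<turnstile> k \<up> 1 \<cdot> (i0 i A \<up> 1 \<cdot> V 0) \<doteq> h \<up> 1 \<cdot> V 0 \<Ztypecolon> El j (P \<up> 1 \<cdot> (i0 i A \<up> 1 \<cdot> V 0))"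
    using ty_conv eq_conv by blast
qed

end
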